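(* Let $\theta_q:H_n(q)\to\mathbb Z[q^{1/2},q^{-1/2}]$ be a $\mathbb Z[q^{1/2},q^{-1/2}]$-linear function, let $J_1,\dotsc,J_m$ be nonempty subintervals of $[n]$, and let the star network $G=G_{J_1}\circ\cdots\circ G_{J_m}$ have weighted path matrix $B$. Then $$\theta_q\bigl(\widetilde C_{s_{J_1}}(q)\cdots\widetilde C_{s_{J_m}}(q)\bigr)=\sigma_B\bigl(\mathrm{Imm}_{\theta_q}(x)\bigr).$$
   Context: Hecke algebra. $H_n(q)$ is the algebra over $\mathbb Z[q^{1/2},q^{-1/2}]$ with unit $T_e$ generated by $T_{s_1},\dotsc,T_{s_{n-1}}$ ($s_i$ the adjacent transpositions in $\mathfrak S_n$) with relations $T_{s_i}^2=(q-1)T_{s_i}+qT_e$, $T_{s_i}T_{s_j}T_{s_i}=T_{s_j}T_{s_i}T_{s_j}$ if $|i-j|=1$, $T_{s_i}T_{s_j}=T_{s_j}T_{s_i}$ if $|i-j|\ge 2$; it has natural basis $\{T_w\mid w\in\mathfrak S_n\}$, where $T_w=T_{s_{i_1}}\cdots T_{s_{i_\ell}}$ for a reduced expression $w=s_{i_1}\cdots s_{i_\ell}$. Permutations are written in one-line notation $w=w_1\cdots w_n$, with $s_j v$ obtained from $v$ by swapping the letters in positions $j,j+1$ (so $(uv)_i=v_{u_i}$); $\ell(w)$ is the length (number of inversions). For an interval $J=[a,b]\subseteq[n]$, $\mathfrak S_J=\langle s_a,\dotsc,s_{b-1}\rangle$, $s_J$ is its longest element and $\widetilde C_{s_J}(q)=\sum_{w\in\mathfrak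 S_J}T_w$ (a modified signless Kazhdan-Lusztig basis element). Quantum matrix bialgebra. $\mathcal A$ is the associative unital $\mathbb Z[q^{1/2},q^{-1/2}]$-algebra generated by $x_{i,j}$ ($1\le i,j\le n$) with relations, for $i<j$ and $k<\ell$: $x_{i,\ell}x_{i,k}=q^{1/2}x_{i,k}x_{i,\ell}$, $x_{j,k}x_{i,k}=q^{1/2}x_{i,k}x_{j,k}$, $x_{j,k}x_{i,\ell}=x_{i,\ell}x_{j,k}$, $x_{j,\ell}x_{i,k}=x_{i,k}x_{j,\ell}+(q^{1/2}-q^{-1/2})x_{i,\ell}x_{j,k}$. Write $x^{u,w}=x_{u_1,w_1}\cdots x_{u_n,w_n}$ for $u,w\in\mathfrak S_n$; $\mathcal A_{[n],[n]}$ is the span of these, with basis $\{x^{e,w}\mid w\in\mathfrak S_n\}$. For linear $\theta_q$, $\mathrm{Imm}_{\theta_q}(x)=\sum_{w\in\mathfrak S_n}q^{-\ell(w)/2}\theta_q(T_w)\,x_{1,w_1}\cdots x_{n,w_n}\in\mathcal A_{[n],[n]}$. Star networks. For $1\le a<b\le n$, $G_{[a,b]}$ is the planar directed graph with sources $1,\dotsc,n$ in a column on the left (bottom to top), sinks $1,\dotsc,n$ in a column on the right (bottom to top), one interior (central) vertex, an edge from source $i$ to sink $i$ for $i<a$ and $i>b$, and, for $a\le i\le b$, an edge from source $i$ to the interior vertex and an edge from the interior vertex to sink $i$. $G_{[a,a]}$ has just the edges from source $i$ to sink $i$. $G\circ H$ identifies sink $i$ of $G$ with source $i$ of $H$. A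 star network is a concatenation $G=G_{J_1}\circ\cdots\circ G_{J_m}$. Weights and $\sigma_B$. Write $J_p=[i_p,j_p]$. For each $p\in\{1,\dotsc,m\}$ with $i_p<j_p$, take indeterminates $z_{h,p,k}$ ($i_p\le h\le j_p$, $k\in\{1,2\}$). $Z_G$ is the $\mathbb Z[q^{1/2},q^{-1/2}]$-algebra generated by all of these modulo $z_{h_2,p_2,k_2}z_{h_1,p_1,k_1}=z_{h_1,p_1,k_1}z_{h_2,p_2,k_2}$ if $p_1\ne p_2$ or $k_1\ne k_2$, and $z_{h_2,p,k}z_{h_1,p,k}=q^{1/2}z_{h_1,p,k}z_{h_2,p,k}$ if $h_1<h_2$. In $G_{J_p}$, the edge from source $h$ into the central vertex has weight $z_{h,p,1}$, the edge from the central vertex to sink $h$ has weight $z_{h,p,2}$, and all other edges have weight $1$. The weight of a path is the product of its edge weights in order along the path. The weighted path matrix $B=(b_{i,j})$ has $b_{i,j}$ equal to the sum of the weights of all paths from source $i$ to sink $j$ of $G$. Let $z_G$ be the product of all the indeterminates $z_{h,p,k}$, in lexicographic order of $(h,p,k)$, and let $[z_G]f$ be the coefficient of $z_G$ in $f\in Z_G$ after expansion in the basis of lexicographically ordered monomials. Then $\sigma_B:\mathcal A_{[n],[n]}\to\mathbb Z[q^{1/2},q^{-1/2}]$ is the linear map defined on the basis by $\sigma_B(x_{1,v_1}\cdots x_{n,v_n})=[z_G]\,b_{1,v_1}\cdots b_{n,v_n}$. *)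

theory Defs
  imports
    "HOL-Library.Poly_Mapping"
    "HOL-Library.Product_Lexorder"
    "HOL-Algebra.QuotRing"
    "HOL-Algebra.Module"
    "HOL-Algebra.Generated_Groups"
    "HOL-Algebra.Sym_Groups"
    "Graph_Theory.Arc_Walk"
begin

section \<open>Algebras presented by generators and relations\<close>

text \<open>
  Laurent polynomials in the indeterminate \<open>q^{1/2}\<close>, as the group ring of the integers:
  the exponent \<open>k\<close> stands for \<open>q^{k/2}\<close>.
\<close>

type_synonym laurent = "int \<Rightarrow>\<^sub>0 int"

definition qhalf :: "int \<Rightarrow> laurent" where
  "qhalf k = Poly_Mapping.single k 1"

datatype 'g word = Word (letters: "'g list")

instantiation word :: (type) monoid_add
begin

definition zero_word :: "'a word" where
  "0 = Word []"

definition plus_word :: "'a word \<Rightarrow> 'a word \<Rightarrow> 'a word" where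
  "u + v = Word (letters u @ letters v)"

instance
  by standard (simp_all add: zero_word_def plus_word_def)

end

text \<open>
  Words form a monoid under concatenation, so that the multiplication of
  \<^theory>\<open>HOL-Library.Poly_Mapping\<close> is that of the free associative algebra.
\<close>

type_synonym 'g free_alg = "'g word \<Rightarrow>\<^sub>0 laurent"

definition scalar :: "laurent \<Rightarrow> 'g free_alg" where
  "scalar c = Poly_Mapping.single 0 c"

definition var :: "'g \<Rightarrow> 'g free_alg" where
  "var x = Poly_Mapping.single (Word [x]) 1"

definition free_algebra :: "'g set \<Rightarrow> 'g free_alg ring" where
  "free_algebra X =
    \<lparr>carrier = {f. \<forall>w \<in> Poly_Mapping.keys f. set (letters w) \<subseteq> X},
     monoid.mult = (*), one = 1, zero = 0, add = (+)\<rparr>"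

text \<open>
  The algebra generated by \<open>X\<close> subject to the relations \<open>r = 0\<close> for \<open>r \<in> S\<close>.
  Note that \<^const>\<open>genideal\<close> is the generated two-sided ideal.
\<close>

definition presented_algebra ::
  "'g set \<Rightarrow> 'g free_alg set \<Rightarrow> (laurent, 'g free_alg set) module" where
  "presented_algebra X S =
    (let F = free_algebra X; I = Idl\<^bsub>F\<^esub> S in
      ring.extend (F Quot I)
        (module.fields (\<lambda>c f. (I +>\<^bsub>F\<^esub> scalar c) \<otimes>\<^bsub>F Quot I\<^esub> f)))"

definition generator :: "'g set \<Rightarrow> 'g free_alg set \<Rightarrow> 'g \<Rightarrow> 'g free_alg set" where
  "generator X S x = (Idl\<^bsub>free_algebra X\<^esub> S) +>\<^bsub>free_algebra X\<^esub> var x"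

definition list_mult :: "('a, 'b) monoid_scheme \<Rightarrow> 'a list \<Rightarrow> 'a" where
  "list_mult M xs = foldr (\<otimes>\<^bsub>M\<^esub>) xs \<one>\<^bsub>M\<^esub>"

definition linear_functional ::
  "(laurent, 'a) module \<Rightarrow> ('a \<Rightarrow> laurent) \<Rightarrow> bool" where
  "linear_functional M \<theta> \<longleftrightarrow>
    (\<forall>x \<in> carrier M. \<forall>y \<in> carrier M. \<theta> (x \<oplus>\<^bsub>M\<^esub> y) = \<theta> x + \<theta> y) \<and>
    (\<forall>c. \<forall>x \<in> carrier M. \<theta> (c \<odot>\<^bsub>M\<^esub> x) = c * \<theta> x)"


section \<open>Permutations\<close>

text \<open>
  A permutation \<open>w\<close> of \<open>{1..n}\<close> has one-line notation \<open>w 1, \<dots>, w n\<close>. The product in use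
  satisfies \<open>(u v) i = v (u i)\<close>, i.e. it is \<open>v \<circ> u\<close>, so that multiplying by the transposition
  \<open>(i, i + 1)\<close> on the left swaps the letters in positions \<open>i\<close> and \<open>i + 1\<close>.
\<close>

definition perms :: "nat \<Rightarrow> (nat \<Rightarrow> nat) set" where
  "perms n = {w. w permutes {1..n}}"

fun word_perm :: "nat list \<Rightarrow> nat \<Rightarrow> nat" where
  "word_perm [] = id"
| "word_perm (i # is) = word_perm is \<circ> transpose i (i + 1)"

definition perm_length :: "nat \<Rightarrow> (nat \<Rightarrow> nat) \<Rightarrow> nat" where
  "perm_length n w = card {(i, j). 1 \<le> i \<and> i < j \<and> j \<le> n \<and> w j < w i}"

definition reduced_expression :: "nat \<Rightarrow> nat list \<Rightarrow> (nat \<Rightarrow> nat) \<Rightarrow> bool" where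
  "reduced_expression n is w \<longleftrightarrow>
    set is \<subseteq> {1..<n} \<and> word_perm is = w \<and> length is = perm_length n w"

text \<open>
  The subgroup generated by the adjacent transpositions inside the interval \<open>[a, b]\<close>. It does
  not depend on the order in which permutations are multiplied.
\<close>

definition interval_perms :: "nat \<Rightarrow> nat \<times> nat \<Rightarrow> (nat \<Rightarrow> nat) set" where
  "interval_perms n = (\<lambda>(a, b). generate (sym_group n) ((\<lambda>i. transpose i (i + 1)) ` {a..<b}))"


section \<open>The Hecke algebra\<close>

definition hecke_relations :: "nat \<Rightarrow> nat free_alg set" where
  "hecke_relations n =
    {var i * var i - (scalar (qhalf 2 - 1) * var i + scalar (qhalf 2)) | i. i \<in> {1..<n}} \<union>
    {var i * var j * var i - var j * var i * var j | i j.
      i \<in> {1..<n} \<and> j \<in> {1..<n} \<and> (j = i + 1 \<or> i = j + 1)} \<union>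
    {var i * var j - var j * var i | i j.
      i \<in> {1..<n} \<and> j \<in> {1..<n} \<and> (i + 2 \<le> j \<or> j + 2 \<le> i)}"

definition hecke :: "nat \<Rightarrow> (laurent, nat free_alg set) module" where
  "hecke n = presented_algebra {1..<n} (hecke_relations n)"

definition T_gen :: "nat \<Rightarrow> nat \<Rightarrow> nat free_alg set" where
  "T_gen n = generator {1..<n} (hecke_relations n)"

text \<open>The choice of the reduced expression is immaterial by Matsumoto's theorem.\<close>

definition hecke_T :: "nat \<Rightarrow> (nat \<Rightarrow> nat) \<Rightarrow> nat free_alg set" where
  "hecke_T n w = list_mult (hecke n) (map (T_gen n) (SOME is. reduced_expression n is w))"

definition C_tilde :: "nat \<Rightarrow> nat \<times> nat \<Rightarrow> nat free_alg set" where
  "C_tilde n J = (\<Oplus>\<^bsub>hecke n\<^esub>w \<in> interval_perms n J. hecke_T n w)"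


section \<open>The quantum matrix bialgebra\<close>

definition qmat_relations :: "nat \<Rightarrow> (nat \<times> nat) free_alg set" where
  "qmat_relations n =
    {r. \<exists>i k l. 1 \<le> i \<and> i \<le> n \<and> 1 \<le> k \<and> k < l \<and> l \<le> n \<and>
      r = var (i, l) * var (i, k) - scalar (qhalf 1) * var (i, k) * var (i, l)} \<union>
    {r. \<exists>i j k. 1 \<le> i \<and> i < j \<and> j \<le> n \<and> 1 \<le> k \<and> k \<le> n \<and>
      r = var (j, k) * var (i, k) - scalar (qhalf 1) * var (i, k) * var (j, k)} \<union>
    {r. \<exists>i j k l. 1 \<le> i \<and> i < j \<and> j \<le> n \<and> 1 \<le> k \<and> k < l \<and> l \<le> n \<and>
      r = var (j, k) * var (i, l) - var (i, l) * var (j, k)} \<union>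
    {r. \<exists>i j k l. 1 \<le> i \<and> i < j \<and> j \<le> n \<and> 1 \<le> k \<and> k < l \<and> l \<le> n \<and>
      r = var (j, l) * var (i, k) -
        (var (i, k) * var (j, l) + scalar (qhalf 1 - qhalf (-1)) * var (i, l) * var (j, k))}"

definition qmat :: "nat \<Rightarrow> (laurent, (nat \<times> nat) free_alg set) module" where
  "qmat n = presented_algebra ({1..n} \<times> {1..n}) (qmat_relations n)"

definition qmat_gen :: "nat \<Rightarrow> nat \<Rightarrow> nat \<Rightarrow> (nat \<times> nat) free_alg set" where
  "qmat_gen n i j = generator ({1..n} \<times> {1..n}) (qmat_relations n) (i, j)"

definition x_mon ::
  "nat \<Rightarrow> (nat \<Rightarrow> nat) \<Rightarrow> (nat \<Rightarrow> nat) \<Rightarrow> (nat \<times> nat) free_alg set" where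
  "x_mon n u w = list_mult (qmat n) (map (\<lambda>i. qmat_gen n (u i) (w i)) [1..<n+1])"

text \<open>The span of all monomials \<open>x^{u,w}\<close>.\<close>

definition immanant_space :: "nat \<Rightarrow> (nat \<times> nat) free_alg set set" where
  "immanant_space n =
    {\<Oplus>\<^bsub>qmat n\<^esub>p \<in> perms n \<times> perms n. c p \<odot>\<^bsub>qmat n\<^esub> x_mon n (fst p) (snd p) | c. True}"

definition Imm :: "nat \<Rightarrow> (nat free_alg set \<Rightarrow> laurent) \<Rightarrow> (nat \<times> nat) free_alg set" where
  "Imm n \<theta> = (\<Oplus>\<^bsub>qmat n\<^esub>w \<in> perms n.
      (qhalf (- int (perm_length n w)) * \<theta> (hecke_T n w)) \<odot>\<^bsub>qmat n\<^esub> x_mon n id w)"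


section \<open>Star networks\<close>

text \<open>
  \<open>Boundary p i\<close> is the \<open>i\<close>-th vertex of the column reached after \<open>p\<close> of the concatenated
  graphs: the \<open>p\<close>-th factor has sources \<open>Boundary (p - 1) i\<close> and sinks \<open>Boundary p i\<close>. Thus
  the union of the factors performs the identification of sinks with sources.
\<close>

datatype vertex = Boundary nat nat | Central nat

fun star_arcs :: "nat \<Rightarrow> nat \<Rightarrow> nat \<times> nat \<Rightarrow> (vertex \<times> vertex) set" where
  "star_arcs n p (a, b) =
    (if a < b then
       {(Boundary (p - 1) i, Boundary p i) | i. 1 \<le> i \<and> i \<le> n \<and> (i < a \<or> b < i)} \<union>
       {(Boundary (p - 1) i, Central p) | i. a \<le> i \<and> i \<le> b} \<union>
       {(Central p, Boundary p i) | i. a \<le> i \<and> i \<le> b}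
     else {(Boundary (p - 1) i, Boundary p i) | i. 1 \<le> i \<and> i \<le> n})"

fun star_verts :: "nat \<Rightarrow> nat \<Rightarrow> nat \<times> nat \<Rightarrow> vertex set" where
  "star_verts n p (a, b) =
    Boundary (p - 1) ` {1..n} \<union> Boundary p ` {1..n} \<union> (if a < b then {Central p} else {})"

text \<open>
  The factors are numbered from \<open>1\<close> whereas list positions start at \<open>0\<close>. Column \<open>0\<close> is added
  explicitly only to make the empty concatenation the identity network.
\<close>

definition star_network ::
  "nat \<Rightarrow> (nat \<times> nat) list \<Rightarrow> (vertex, vertex \<times> vertex) pre_digraph" where
  "star_network n Js =
    \<lparr>verts = Boundary 0 ` {1..n} \<union> (\<Union>p \<in> {1..length Js}. star_verts n p (Js ! (p - 1))),
     arcs = (\<Union>p \<in> {1..length Js}. star_arcs n p (Js ! (p - 1))),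
     tail = fst, head = snd\<rparr>"

definition paths ::
  "nat \<Rightarrow> (nat \<times> nat) list \<Rightarrow> nat \<Rightarrow> nat \<Rightarrow> (vertex \<times> vertex) list set" where
  "paths n Js i j =
    {\<pi>. pre_digraph.apath (star_network n Js) (Boundary 0 i) \<pi> (Boundary (length Js) j)}"


section \<open>Edge weights and the weighted path matrix\<close>

text \<open>The triple \<open>(h, p, k)\<close> stands for the indeterminate \<open>z_{h,p,k}\<close>.\<close>

definition z_index :: "(nat \<times> nat) list \<Rightarrow> (nat \<times> nat \<times> nat) set" where
  "z_index Js = {(h, p, k). p \<in> {1..length Js} \<and> k \<in> {1, 2} \<and>
    fst (Js ! (p - 1)) < snd (Js ! (p - 1)) \<and>
    fst (Js ! (p - 1)) \<le> h \<and> h \<le> snd (Js ! (p - 1))}"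

definition z_relations :: "(nat \<times> nat) list \<Rightarrow> (nat \<times> nat \<times> nat) free_alg set" where
  "z_relations Js =
    {var (h2, p2, k2) * var (h1, p1, k1) - var (h1, p1, k1) * var (h2, p2, k2) |
      h1 p1 k1 h2 p2 k2. (h1, p1, k1) \<in> z_index Js \<and> (h2, p2, k2) \<in> z_index Js \<and>
        (p1 \<noteq> p2 \<or> k1 \<noteq> k2)} \<union>
    {var (h2, p, k) * var (h1, p, k) - scalar (qhalf 1) * var (h1, p, k) * var (h2, p, k) |
      h1 h2 p k. (h1, p, k) \<in> z_index Js \<and> (h2, p, k) \<in> z_index Js \<and> h1 < h2}"

definition Z_alg :: "(nat \<times> nat) list \<Rightarrow> (laurent, (nat \<times> nat \<times> nat) free_alg set) module" where
  "Z_alg Js = presented_algebra (z_index Js) (z_relations Js)"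

definition z_gen :: "(nat \<times> nat) list \<Rightarrow> nat \<times> nat \<times> nat \<Rightarrow> (nat \<times> nat \<times> nat) free_alg set" where
  "z_gen Js = generator (z_index Js) (z_relations Js)"

fun edge_weight ::
  "(nat \<times> nat) list \<Rightarrow> vertex \<times> vertex \<Rightarrow> (nat \<times> nat \<times> nat) free_alg set" where
  "edge_weight Js (Boundary _ h, Central p) = z_gen Js (h, p, 1)"
| "edge_weight Js (Central p, Boundary _ h) = z_gen Js (h, p, 2)"
| "edge_weight Js _ = \<one>\<^bsub>Z_alg Js\<^esub>"

definition path_matrix ::
  "nat \<Rightarrow> (nat \<times> nat) list \<Rightarrow> nat \<Rightarrow> nat \<Rightarrow> (nat \<times> nat \<times> nat) free_alg set" where
  "path_matrix n Js i j =
    (\<Oplus>\<^bsub>Z_alg Js\<^esub>\<pi> \<in> paths n Js i j. list_mult (Z_alg Js) (map (edge_weight Js) \<pi>))"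

text \<open>
  The coefficients of \<open>f\<close> in the basis of lexicographically ordered monomials, a monomial being
  given by the sorted list of its factors. The order on triples is lexicographic by
  \<^theory>\<open>HOL-Library.Product_Lexorder\<close>.
\<close>

definition z_expansion ::
  "(nat \<times> nat) list \<Rightarrow> (nat \<times> nat \<times> nat) free_alg set \<Rightarrow> (nat \<times> nat \<times> nat) list \<Rightarrow>\<^sub>0 laurent" where
  "z_expansion Js f =
    (THE c. (\<forall>\<mu> \<in> Poly_Mapping.keys c. sorted \<mu> \<and> set \<mu> \<subseteq> z_index Js) \<and>
      f = (\<Oplus>\<^bsub>Z_alg Js\<^esub>\<mu> \<in> Poly_Mapping.keys c.
            Poly_Mapping.lookup c \<mu> \<odot>\<^bsub>Z_alg Js\<^esub> list_mult (Z_alg Js) (map (z_gen Js) \<mu>)))"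

definition z_coeff :: "(nat \<times> nat) list \<Rightarrow> (nat \<times> nat \<times> nat) free_alg set \<Rightarrow> laurent" where
  "z_coeff Js f = Poly_Mapping.lookup (z_expansion Js f) (sorted_list_of_set (z_index Js))"

text \<open>
  The linear extension from the basis \<open>{x^{e,w}}\<close> of \<^const>\<open>immanant_space\<close>; the coordinates
  \<open>c\<close> are determined on \<^const>\<open>perms\<close>.
\<close>

definition sigma ::
  "nat \<Rightarrow> (nat \<times> nat) list \<Rightarrow> (nat \<Rightarrow> nat \<Rightarrow> (nat \<times> nat \<times> nat) free_alg set)
    \<Rightarrow> (nat \<times> nat) free_alg set \<Rightarrow> laurent" where
  "sigma n Js B = (\<lambda>f \<in> immanant_space n.
    let c = (SOME c. f = (\<Oplus>\<^bsub>qmat n\<^esub>w \<in> perms n. c w \<odot>\<^bsub>qmat n\<^esub> x_mon n id w))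
    in \<Sum>w \<in> perms n.
        c w * z_coeff Js (list_mult (Z_alg Js) (map (\<lambda>i. B i (w i)) [1..<n+1])))"

end

theory Submission
  imports Defs
begin

text \<open>
  Both sides are governed by one matrix \<open>K_J\<close> indexed by permutations: \<open>K_J(v, w)\<close> is
  \<open>q^{(inv_J(v) + inv_J(w))/2}\<close> if \<open>w \<in> v S_J\<close> and \<open>0\<close> otherwise, where \<open>inv_J\<close> counts the inversions
  among the letters in \<open>J\<close>. A family of paths through \<open>G_J\<close> using every edge once, moving the
  letters \<open>v\<close> to \<open>w\<close>, has normally ordered weight with coefficient \<open>K_J(v, w)\<close>, so that
  \<open>[z_G] b_{1,w_1} \<dots> b_{n,w_n}\<close> is the \<open>(e, w)\<close> entry of \<open>K_{J_1} \<dots> K_{J_m}\<close>. In the Hecke algebra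
  \<open>q^{-\<ell>(v)/2} T_v C_J\<close> equals the sum of the \<open>K_J(v, w) q^{-\<ell>(w)/2} T_w\<close>, by induction on \<open>\<ell>(v)\<close>: the matrix
  \<open>K_J\<close> commutes with left multiplication by the generators. The same commutation shows that the
  entries of \<open>K_{J_1} \<dots> K_{J_m}\<close> satisfy the relations of the quantum matrix bialgebra, which makes
  \<open>\<sigma>_B\<close> well defined.
\<close>

section \<open>Free and presented algebras\<close>

text \<open>The definitions \<open>hecke_T\<close>, \<open>sigma\<close> and
  \<open>z_expansion\<close> select a reduced word, coordinates and an expansion by description; the
  obstacle is to show that the selected objects give the expected values. For reduced words this is
  Matsumoto's theorem. In the other two algebras the values are read off by a linear functional
  given on words of the free algebra, which descends to the quotient once it kills every relation
  placed between two words: \<open>z_fun\<close> yields the coefficient of an ordered monomial,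
  \<open>matching\<close> an entry of the transfer matrix.

  The symmetric exponent of K_J has two sources: the inversions of v come from reordering the
  weights of the edges into the centre, those of w from the edges out of it. With T_w scaled by
  q^{-l(w)/2}, left multiplication by q^{-1/2} T_s has only the coefficients 1 and q^{1/2} -
  q^{-1/2}, which match the change of K_J under a swap.

  Permutations are handled as one-line lists: a generator then swaps adjacent entries, and a family
  of paths is a list indexed by its sources. The recursion of \<open>transfer\<close> removes the
  last star, whence the reversed list of intervals.\<close>

definition wmon :: "'g list \<Rightarrow> 'g free_alg" where
  "wmon xs = Poly_Mapping.single (Word xs) 1"

text \<open>A functional is prescribed on words and extended linearly. Its argument is a plain list,
  so that inversion counts and one-line notations can be read off directly.\<close>

definition lin :: "('g list \<Rightarrow> laurent) \<Rightarrow> 'g free_alg \<Rightarrow> laurent" where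
  "lin \<phi> f = (\<Sum>w\<in>Poly_Mapping.keys f. Poly_Mapping.lookup f w * \<phi> (letters w))"

lemma wmon_mult: "wmon xs * wmon ys = wmon (xs @ ys)"
  by (simp add: wmon_def mult_single plus_word_def)

lemma wmon_Nil: "wmon [] = 1"
  by (simp add: wmon_def flip: zero_word_def)

lemma var_wmon: "var x = wmon [x]"
  by (simp add: var_def wmon_def)

lemma prod_list_wmon: "prod_list (map wmon xss) = wmon (concat xss)"
  by (induction xss) (simp_all add: wmon_Nil wmon_mult)

lemma lookup_scalar_mult:
  "Poly_Mapping.lookup (scalar c * f) w = c * Poly_Mapping.lookup f w"
  by (simp add: scalar_def map.rep_eq when_def flip: mult_map_scale_conv_mult)

lemma
  shows scalar_0: "scalar 0 = 0" and scalar_1: "scalar 1 = 1"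
    and scalar_add: "scalar (a + b) = scalar a + scalar b"
    and scalar_mult: "scalar (a * b) = scalar a * scalar b"
  by (simp_all add: scalar_def single_add mult_single)

lemma scalar_sum: "scalar (\<Sum>a\<in>A. c a) = (\<Sum>a\<in>A. scalar (c a))"
  by (induction A rule: infinite_finite_induct) (simp_all add: scalar_0 scalar_add)

lemma free_alg_expand:
  "f = (\<Sum>w\<in>Poly_Mapping.keys f. scalar (Poly_Mapping.lookup f w) * wmon (letters w))"
proof (rule poly_mapping_eqI)
  fix v
  have "(\<Sum>w\<in>Poly_Mapping.keys f.
      Poly_Mapping.lookup (scalar (Poly_Mapping.lookup f w) * wmon (letters w)) v) =
    (\<Sum>w\<in>Poly_Mapping.keys f. if w = v then Poly_Mapping.lookup f v else 0)"
    by (intro sum.cong refl) (auto simp: lookup_scalar_mult wmon_def lookup_single)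
  then show "Poly_Mapping.lookup f v = Poly_Mapping.lookup
      (\<Sum>w\<in>Poly_Mapping.keys f. scalar (Poly_Mapping.lookup f w) * wmon (letters w)) v"
    by (simp add: lookup_sum in_keys_iff)
qed

text \<open>Centrality rests on the commutativity of \<open>laurent\<close> and on the empty word
  being neutral; the expansion into words reduces it to a single monomial.\<close>

lemma scalar_commute: "f * scalar c = scalar c * (f :: 'g free_alg)"
proof -
  have w: "wmon xs * scalar c = scalar c * wmon xs" for xs :: "'g list"
    by (simp add: wmon_def scalar_def mult_single)
  have "(scalar a * wmon xs) * scalar c = scalar c * (scalar a * wmon xs)" for a and xs :: "'g list"
  proof -
    have "(scalar a * wmon xs) * scalar c = scalar a * (scalar c * wmon xs)"
      by (simp add: mult.assoc w)
    also have "\<dots> = scalar (a * c) * wmon xs"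
      by (simp add: scalar_mult mult.assoc)
    also have "\<dots> = scalar (c * a) * wmon xs"
      by (simp add: mult.commute)
    finally show ?thesis
      by (simp add: scalar_mult mult.assoc)
  qed
  then show ?thesis
    by (subst (1 2) free_alg_expand[of f])
      (simp add: sum_distrib_left sum_distrib_right)
qed

lemma scalar_left_commute: "f * (scalar c * g) = scalar c * (f * (g :: 'g free_alg))"
  by (metis mult.assoc scalar_commute)

lemma lin_superset:
  assumes "finite A" "Poly_Mapping.keys f \<subseteq> A"
  shows "lin \<phi> f = (\<Sum>w\<in>A. Poly_Mapping.lookup f w * \<phi> (letters w))"
  unfolding lin_def using assms by (intro sum.mono_neutral_left) (auto simp: in_keys_iff)

lemma lin_add: "lin \<phi> (f + g) = lin \<phi> f + lin \<phi> g"
proof -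
  let ?A = "Poly_Mapping.keys f \<union> Poly_Mapping.keys g"
  have "Poly_Mapping.keys (f + g) \<subseteq> ?A"
    by (rule keys_add)
  then show ?thesis
    by (simp add: lin_superset[where A = ?A] lookup_add distrib_right sum.distrib)
qed

lemma lin_0: "lin \<phi> 0 = 0"
  by (simp add: lin_def)

lemma lin_sum: "lin \<phi> (\<Sum>a\<in>A. f a) = (\<Sum>a\<in>A. lin \<phi> (f a))"
  by (induction A rule: infinite_finite_induct) (simp_all add: lin_0 lin_add)

lemma lin_scalar: "lin \<phi> (scalar c * f) = c * lin \<phi> f"
proof -
  have "Poly_Mapping.keys (scalar c * f) \<subseteq> Poly_Mapping.keys f"
    by (auto simp: in_keys_iff lookup_scalar_mult)
  then show ?thesis
    by (simp add: lin_superset[where A = "Poly_Mapping.keys f"] lookup_scalar_mult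
        sum_distrib_left mult.assoc)
qed

lemma lin_minus: "lin \<phi> (- f) = - lin \<phi> f"
  using lin_add[of \<phi> f "- f"] by (simp add: lin_0 eq_neg_iff_add_eq_0 add.commute)

lemma lin_diff: "lin \<phi> (f - g) = lin \<phi> f - lin \<phi> g"
  using lin_add[of \<phi> f "- g"] by (simp add: lin_minus)

lemma lin_wmon: "lin \<phi> (wmon xs) = \<phi> xs"
  by (simp add: lin_def wmon_def)

section \<open>The free algebra on a given alphabet as a ring\<close>

abbreviation free_carrier :: "'g set \<Rightarrow> 'g free_alg set" where
  "free_carrier X \<equiv> carrier (free_algebra X)"

lemma free_carrier_iff:
  "f \<in> free_carrier X \<longleftrightarrow> (\<forall>w. Poly_Mapping.lookup f w \<noteq> 0 \<longrightarrow> set (letters w) \<subseteq> X)"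
  by (auto simp: free_algebra_def in_keys_iff)

lemma free_algebra_simps [simp]:
  "monoid.mult (free_algebra X) = (*)" "one (free_algebra X) = 1"
  "zero (free_algebra X) = 0" "add (free_algebra X) = (+)"
  by (simp_all add: free_algebra_def)

lemma free_carrier_0: "0 \<in> free_carrier X"
  by (simp add: free_carrier_iff)

lemma free_carrier_add: "f \<in> free_carrier X \<Longrightarrow> g \<in> free_carrier X \<Longrightarrow> f + g \<in> free_carrier X"
  unfolding free_carrier_iff lookup_add by (metis add_0)

lemma free_carrier_minus: "f \<in> free_carrier X \<Longrightarrow> - f \<in> free_carrier X"
  by (simp add: free_carrier_iff)

lemma free_carrier_diff: "f \<in> free_carrier X \<Longrightarrow> g \<in> free_carrier X \<Longrightarrow> f - g \<in> free_carrier X"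
  using free_carrier_add[of f X "- g"] by (simp add: free_carrier_minus)

lemma free_carrier_scalar: "scalar c \<in> free_carrier X"
  by (auto simp: free_carrier_iff scalar_def lookup_single when_def zero_word_def)

lemma free_carrier_wmon: "set xs \<subseteq> X \<Longrightarrow> wmon xs \<in> free_carrier X"
  by (auto simp: free_carrier_iff wmon_def lookup_single when_def)

lemma free_carrier_var: "x \<in> X \<Longrightarrow> var x \<in> free_carrier X"
  by (simp add: var_wmon free_carrier_wmon)

lemma free_carrier_1: "1 \<in> free_carrier X"
  using free_carrier_wmon[of "[]" X] by (simp add: wmon_Nil)

lemma free_carrier_mult:
  assumes "f \<in> free_carrier X" "g \<in> free_carrier X"
  shows "f * g \<in> free_carrier X"
proof -
  have "set (letters w) \<subseteq> X" if "w \<in> Poly_Mapping.keys (f * g)" for w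
  proof -
    from that obtain u v where "w = u + v" "u \<in> Poly_Mapping.keys f" "v \<in> Poly_Mapping.keys g"
      using keys_mult[of f g] by auto
    then show ?thesis
      using assms by (auto simp: free_algebra_def plus_word_def)
  qed
  then show ?thesis
    by (simp add: free_algebra_def)
qed

lemma free_carrier_sum:
  "(\<And>a. a \<in> A \<Longrightarrow> f a \<in> free_carrier X) \<Longrightarrow> (\<Sum>a\<in>A. f a) \<in> free_carrier X"
  by (induction A rule: infinite_finite_induct) (auto simp: free_carrier_0 free_carrier_add)

lemma free_carrier_prod_list:
  "(\<And>a. a \<in> set xs \<Longrightarrow> f a \<in> free_carrier X) \<Longrightarrow> prod_list (map f xs) \<in> free_carrier X"
  by (induction xs) (auto simp: free_carrier_1 free_carrier_mult)

lemmas free_carrier_intros =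
  free_carrier_add free_carrier_minus free_carrier_diff free_carrier_0 free_carrier_scalar
  free_carrier_wmon free_carrier_var free_carrier_1 free_carrier_mult free_carrier_sum
  free_carrier_prod_list

lemma ring_free_algebra: "ring (free_algebra X)"
proof (rule ringI)
  show "abelian_group (free_algebra X)"
  proof (rule abelian_groupI)
    fix f assume "f \<in> free_carrier X"
    then show "\<exists>g\<in>free_carrier X. g \<oplus>\<^bsub>free_algebra X\<^esub> f = \<zero>\<^bsub>free_algebra X\<^esub>"
      by (intro bexI[of _ "- f"]) (auto intro: free_carrier_minus)
  qed (auto simp: add_ac intro: free_carrier_intros)
  show "Group.monoid (free_algebra X)"
    by (rule monoidI) (auto simp: mult.assoc intro: free_carrier_intros)
qed (auto simp: algebra_simps)

lemma a_inv_free_algebra: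
  assumes "f \<in> free_carrier X"
  shows "\<ominus>\<^bsub>free_algebra X\<^esub> f = - f"
  using assms
  by (intro abelian_group.minus_equality[OF ring.is_abelian_group[OF ring_free_algebra]])
    (auto intro: free_carrier_minus)

lemma a_minus_free_algebra:
  assumes "f \<in> free_carrier X" "g \<in> free_carrier X"
  shows "f \<ominus>\<^bsub>free_algebra X\<^esub> g = f - g"
  using assms by (simp add: a_minus_def a_inv_free_algebra)

section \<open>Calculation in a presented algebra through representatives\<close>

locale presentation =
  fixes X :: "'g set" and S :: "'g free_alg set"
  assumes relations_carrier: "S \<subseteq> free_carrier X"
begin

abbreviation "Q \<equiv> presented_algebra X S"
abbreviation "I \<equiv> Idl\<^bsub>free_algebra X\<^esub> S"

definition proj :: "'g free_alg \<Rightarrow> 'g free_alg set" where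
  "proj f = I +>\<^bsub>free_algebra X\<^esub> f"

text \<open>Congruence modulo the ideal, with membership of both sides built in: sums, products and
  chains of congruences then compose without side conditions, and calculations use the operations of
  \<open>free_alg\<close> in place of those on cosets.\<close>

definition eqv :: "'g free_alg \<Rightarrow> 'g free_alg \<Rightarrow> bool" (infix \<open>\<approx>\<close> 50) where
  "f \<approx> g \<longleftrightarrow> f \<in> free_carrier X \<and> g \<in> free_carrier X \<and> f - g \<in> I"

lemma ideal_I: "ideal I (free_algebra X)"
  using ring.genideal_ideal[OF ring_free_algebra relations_carrier] .

sublocale ideal I "free_algebra X"
  by (rule ideal_I)

lemma presented_simps:
  "carrier Q = proj ` free_carrier X" "\<one>\<^bsub>Q\<^esub> = proj 1" "\<zero>\<^bsub>Q\<^esub> = proj 0"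
proof -
  have "I = I +>\<^bsub>free_algebra X\<^esub> \<zero>\<^bsub>free_algebra X\<^esub>"
    by (rule a_coset_add_zero[OF a_subset, symmetric])
  then have "I = proj 0"
    by (simp add: proj_def)
  then show "carrier Q = proj ` free_carrier X" "\<one>\<^bsub>Q\<^esub> = proj 1" "\<zero>\<^bsub>Q\<^esub> = proj 0"
    by (auto simp: presented_algebra_def Let_def ring.defs proj_def FactRing_def A_RCOSETS_def'
        image_def)
qed

lemma proj_carrier: "f \<in> free_carrier X \<Longrightarrow> proj f \<in> carrier Q"
  by (simp add: presented_simps)

lemma proj_mult:
  "f \<in> free_carrier X \<Longrightarrow> g \<in> free_carrier X \<Longrightarrow> proj f \<otimes>\<^bsub>Q\<^esub> proj g = proj (f * g)"
  by (simp add: presented_algebra_def Let_def ring.defs proj_def FactRing_def rcoset_mult_add)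

lemma proj_add:
  "f \<in> free_carrier X \<Longrightarrow> g \<in> free_carrier X \<Longrightarrow> proj f \<oplus>\<^bsub>Q\<^esub> proj g = proj (f + g)"
  by (simp add: presented_algebra_def Let_def ring.defs proj_def FactRing_def a_rcos_sum)

lemma proj_smult: "f \<in> free_carrier X \<Longrightarrow> c \<odot>\<^bsub>Q\<^esub> proj f = proj (scalar c * f)"
  by (simp add: presented_algebra_def Let_def ring.defs module.defs proj_def FactRing_def
      rcoset_mult_add free_carrier_scalar)

lemma generator_eq_proj: "generator X S x = proj (wmon [x])"
  by (simp add: generator_def proj_def var_wmon)

lemma abelian_monoid_presented: "abelian_monoid Q"
  by (rule abelian_monoidI)
    (auto simp: presented_simps proj_add proj_carrier add_ac free_carrier_add free_carrier_0)

lemma finsum_proj: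
  assumes "finite A" "\<And>a. a \<in> A \<Longrightarrow> f a \<in> free_carrier X"
  shows "(\<Oplus>\<^bsub>Q\<^esub>a\<in>A. proj (f a)) = proj (\<Sum>a\<in>A. f a)"
  using assms
proof (induction A rule: finite_induct)
  case empty
  then show ?case
    by (simp add: abelian_monoid.finsum_empty[OF abelian_monoid_presented] presented_simps)
next
  case (insert a A)
  then show ?case
    by (subst abelian_monoid.finsum_insert[OF abelian_monoid_presented])
      (auto simp: proj_carrier proj_add free_carrier_sum)
qed

lemma finsum_proj':
  assumes "finite A" "\<And>a. a \<in> A \<Longrightarrow> f a \<in> free_carrier X" "\<And>a. a \<in> A \<Longrightarrow> h a = proj (f a)"
  shows "(\<Oplus>\<^bsub>Q\<^esub>a\<in>A. h a) = proj (\<Sum>a\<in>A. f a)"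
proof -
  have "(\<Oplus>\<^bsub>Q\<^esub>a\<in>A. h a) = (\<Oplus>\<^bsub>Q\<^esub>a\<in>A. proj (f a))"
    by (rule abelian_monoid.finsum_cong'[OF abelian_monoid_presented])
      (use assms in \<open>auto simp: proj_carrier\<close>)
  then show ?thesis
    using assms by (simp add: finsum_proj)
qed

lemma list_mult_proj:
  assumes "\<And>a. a \<in> set xs \<Longrightarrow> f a \<in> free_carrier X" "\<And>a. a \<in> set xs \<Longrightarrow> h a = proj (f a)"
  shows "list_mult Q (map h xs) = proj (prod_list (map f xs))"
  using assms
proof (induction xs)
  case (Cons a xs)
  have "list_mult Q (map h (a # xs)) = h a \<otimes>\<^bsub>Q\<^esub> list_mult Q (map h xs)"
    by (simp add: list_mult_def)
  also have "\<dots> = proj (f a) \<otimes>\<^bsub>Q\<^esub> proj (prod_list (map f xs))"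
    using Cons by simp
  also have "\<dots> = proj (prod_list (map f (a # xs)))"
    using Cons.prems by (simp add: proj_mult free_carrier_prod_list)
  finally show ?case .
qed (simp add: list_mult_def presented_simps)

lemma list_mult_generator:
  assumes "set xs \<subseteq> X"
  shows "list_mult Q (map (generator X S) xs) = proj (wmon xs)"
proof -
  have "list_mult Q (map (generator X S) xs) = proj (prod_list (map (\<lambda>x. wmon [x]) xs))"
    by (rule list_mult_proj) (use assms in \<open>auto simp: generator_eq_proj intro!: free_carrier_wmon\<close>)
  also have "prod_list (map (\<lambda>x. wmon [x]) xs) = wmon xs"
    by (induction xs) (simp_all add: wmon_Nil wmon_mult)
  finally show ?thesis .
qed

lemma proj_eq_iff:
  "f \<in> free_carrier X \<Longrightarrow> g \<in> free_carrier X \<Longrightarrow> proj f = proj g \<longleftrightarrow> f \<approx> g"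
  unfolding proj_def eqv_def
  using quotient_eq_iff_same_a_r_cos[OF ideal_I, of f g]
  by (simp add: a_minus_free_algebra eq_commute)

lemma eqv_iff:
  "f \<approx> g \<longleftrightarrow> f \<in> free_carrier X \<and> g \<in> free_carrier X \<and> proj f = proj g"
  using proj_eq_iff by (auto simp: eqv_def)

lemma eqv_proj: "f \<approx> g \<Longrightarrow> proj f = proj g"
  by (simp add: eqv_iff)

lemma eqv_refl: "f \<in> free_carrier X \<Longrightarrow> f \<approx> f"
  by (simp add: eqv_iff)

lemma eqv_sym: "f \<approx> g \<Longrightarrow> g \<approx> f"
  by (simp add: eqv_iff)

lemma eqv_trans [trans]: "f \<approx> g \<Longrightarrow> g \<approx> h \<Longrightarrow> f \<approx> h"
  by (simp add: eqv_iff)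

lemma eqv_mult: "f \<approx> f' \<Longrightarrow> g \<approx> g' \<Longrightarrow> f * g \<approx> f' * g'"
  by (simp add: eqv_iff free_carrier_mult flip: proj_mult)

lemma eqv_add: "f \<approx> f' \<Longrightarrow> g \<approx> g' \<Longrightarrow> f + g \<approx> f' + g'"
  by (simp add: eqv_iff free_carrier_add flip: proj_add)

lemma eqv_scalar: "f \<approx> g \<Longrightarrow> scalar c * f \<approx> scalar c * g"
  by (simp add: eqv_mult eqv_refl free_carrier_scalar)

lemma eqv_sum: "(\<And>a. a \<in> A \<Longrightarrow> f a \<approx> g a) \<Longrightarrow> (\<Sum>a\<in>A. f a) \<approx> (\<Sum>a\<in>A. g a)"
  by (induction A rule: infinite_finite_induct)
    (auto simp: eqv_refl free_carrier_0 intro: eqv_add)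

lemma relation_eqv:
  assumes "f - g \<in> S" "f \<in> free_carrier X" "g \<in> free_carrier X"
  shows "f \<approx> g"
  using assms genideal_self[OF relations_carrier] by (auto simp: eqv_def)

text \<open>The kernel of a functional need not be an ideal, but the elements that it kills between
  any two words form one, and this ideal contains the relations. Independence of monomials enters
  below in this form.\<close>

lemma lin_eq_of_eqv:
  assumes rel: "\<And>r us vs. r \<in> S \<Longrightarrow> lin \<phi> (wmon us * r * wmon vs) = 0" and "f \<approx> g"
  shows "lin \<phi> f = lin \<phi> g"
proof -
  let ?J = "{f \<in> free_carrier X. \<forall>us vs. lin \<phi> (wmon us * f * wmon vs) = 0}"
  \<comment> \<open>The factor \<open>x\<close> is expanded into words, and each word is absorbed
    into the left context; \<open>r\<close> does the same on the right.\<close>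
  have l: "lin \<phi> (wmon us * (x * f) * wmon vs) = 0"
    if "f \<in> ?J" for f us vs x
  proof -
    have "lin \<phi> (wmon us * (x * f) * wmon vs) =
      (\<Sum>w\<in>Poly_Mapping.keys x. lin \<phi> (scalar (Poly_Mapping.lookup x w) *
        (wmon (us @ letters w) * f * wmon vs)))"
      by (subst free_alg_expand[of x], simp only: sum_distrib_left sum_distrib_right lin_sum)
        (intro sum.cong refl arg_cong[of _ _ "lin \<phi>"],
          simp add: scalar_left_commute mult.assoc flip: wmon_mult)
    also have "\<dots> = 0"
      using that by (simp add: lin_scalar)
    finally show ?thesis .
  qed
  have r: "lin \<phi> (wmon us * (f * x) * wmon vs) = 0"
    if "f \<in> ?J" for f us vs x
  proof -
    have "lin \<phi> (wmon us * (f * x) * wmon vs) =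
      (\<Sum>w\<in>Poly_Mapping.keys x. lin \<phi> (scalar (Poly_Mapping.lookup x w) *
        (wmon us * f * wmon (letters w @ vs))))"
      by (subst free_alg_expand[of x], simp only: sum_distrib_left sum_distrib_right lin_sum)
        (intro sum.cong refl arg_cong[of _ _ "lin \<phi>"],
          simp add: scalar_left_commute mult.assoc flip: wmon_mult)
    also have "\<dots> = 0"
      using that by (simp add: lin_scalar)
    finally show ?thesis .
  qed
  have "subgroup ?J (add_monoid (free_algebra X))"
  proof (rule group.subgroupI)
    show "Group.group (add_monoid (free_algebra X))"
      by (rule add.is_group)
    show "?J \<noteq> {}"
      by (auto intro!: exI[of _ 0] simp: free_carrier_0 lin_0)
    fix f assume f: "f \<in> ?J"
    then have "inv\<^bsub>add_monoid (free_algebra X)\<^esub> f = - f"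
      using a_inv_free_algebra[of f X] by (simp add: a_inv_def)
    then show "inv\<^bsub>add_monoid (free_algebra X)\<^esub> f \<in> ?J"
      using f by (auto simp: free_carrier_minus lin_minus)
  qed (auto simp: free_carrier_add lin_add distrib_left distrib_right)
  then have "ideal ?J (free_algebra X)"
    by (rule idealI[OF ring_free_algebra]) (use l r in \<open>auto intro: free_carrier_mult\<close>)
  moreover have "S \<subseteq> ?J"
    using relations_carrier rel by auto
  ultimately have "I \<subseteq> ?J"
    by (rule genideal_minimal)
  then have "lin \<phi> (wmon [] * (f - g) * wmon []) = 0"
    using \<open>f \<approx> g\<close> by (auto simp: eqv_def)
  then show ?thesis
    by (simp add: wmon_Nil lin_diff)
qed

lemma linear_functional_sum:
  assumes \<theta>: "linear_functional Q \<theta>" and "finite A" "\<And>a. a \<in> A \<Longrightarrow> f a \<in> free_carrier X"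
  shows "\<theta> (proj (\<Sum>a\<in>A. scalar (c a) * f a)) = (\<Sum>a\<in>A. c a * \<theta> (proj (f a)))"
  using assms(2,3)
proof (induction A rule: finite_induct)
  case empty
  \<comment> \<open>\<open>linear_functional\<close> does not mention zero; its value there comes
    from scaling by \<open>0\<close>.\<close>
  have "\<theta> (0 \<odot>\<^bsub>Q\<^esub> proj 0) = 0 * \<theta> (proj 0)"
    using \<theta> by (auto simp: linear_functional_def presented_simps free_carrier_0)
  then show ?case
    by (simp add: proj_smult free_carrier_0)
next
  case (insert a A)
  then have "proj (\<Sum>a\<in>insert a A. scalar (c a) * f a) =
      c a \<odot>\<^bsub>Q\<^esub> proj (f a) \<oplus>\<^bsub>Q\<^esub> proj (\<Sum>a\<in>A. scalar (c a) * f a)"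
    by (simp add: proj_smult proj_add free_carrier_intros)
  moreover have "c a \<odot>\<^bsub>Q\<^esub> proj (f a) \<in> carrier Q" "proj (\<Sum>a\<in>A. scalar (c a) * f a) \<in> carrier Q"
    using insert.prems by (auto simp: proj_smult proj_carrier free_carrier_intros)
  ultimately show ?case
    using \<theta> insert by (simp add: linear_functional_def proj_carrier)
qed

end

section \<open>Permutations in one-line notation\<close>

text \<open>The multiset form makes membership invariant under swaps and allows it to be tested
  separately on the letters inside and outside an interval.\<close>

definition one_lines :: "nat \<Rightarrow> nat list set" where
  "one_lines n = {vs. mset vs = mset [1..<n+1]}"

definition one_line :: "nat \<Rightarrow> (nat \<Rightarrow> nat) \<Rightarrow> nat list" where
  "one_line n w = map w [1..<n+1]"

text \<open>Positions count from \<open>0\<close>, so on one-line notations \<open>swap_at p\<close>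
  is left multiplication by the adjacent transposition of \<open>p + 1\<close> and
  \<open>p + 2\<close>.\<close>

definition swap_at :: "nat \<Rightarrow> 'a list \<Rightarrow> 'a list" where
  "swap_at p vs = take p vs @ vs ! Suc p # vs ! p # drop (Suc (Suc p)) vs"

fun list_inv :: "nat list \<Rightarrow> nat" where
  "list_inv [] = 0"
| "list_inv (x # xs) = length (filter (\<lambda>y. y < x) xs) + list_inv xs"

lemma set_upt_Suc_1: "set [1..<n+1] = {1..n}"
  unfolding set_upt Suc_eq_plus1[symmetric] by (rule atLeastLessThanSuc_atLeastAtMost)

lemma one_linesD:
  assumes "vs \<in> one_lines n"
  shows "length vs = n" "distinct vs" "set vs = {1..n}"
proof -
  have m: "mset vs = mset [1..<n+1]"
    using assms by (simp add: one_lines_def)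
  show "length vs = n"
    using mset_eq_length[OF m] by simp
  show "distinct vs"
    using mset_eq_imp_distinct_iff[OF m] by simp
  show "set vs = {1..n}"
    using mset_eq_setD[OF m] by (simp only: set_upt_Suc_1)
qed

lemma one_linesI:
  assumes "distinct vs" "set vs = {1..n}"
  shows "vs \<in> one_lines n"
proof -
  have "set vs = set [1..<n+1]"
    using assms(2) by (simp only: set_upt_Suc_1)
  then show ?thesis
    using set_eq_iff_mset_eq_distinct[of vs "[1..<n+1]"] assms(1) distinct_upt
    by (auto simp: one_lines_def simp del: upt_Suc)
qed

lemma finite_one_lines: "finite (one_lines n)"
proof (rule finite_subset)
  show "one_lines n \<subseteq> {vs. set vs \<subseteq> {1..n} \<and> length vs = n}"
    by (auto dest: one_linesD)
qed (simp add: finite_lists_length_eq)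

lemma split_at:
  "Suc p < length vs \<Longrightarrow> vs = take p vs @ vs ! p # vs ! Suc p # drop (Suc (Suc p)) vs"
  by (simp add: Cons_nth_drop_Suc)

lemma swap_at_append: "length xs = p \<Longrightarrow> swap_at p (xs @ a # b # ys) = xs @ b # a # ys"
  by (simp add: swap_at_def nth_append)

lemma swap_at_cases:
  assumes "Suc p < length vs"
  obtains xs a b ys where "length xs = p" "vs = xs @ a # b # ys" "swap_at p vs = xs @ b # a # ys"
    "vs ! p = a" "vs ! Suc p = b"
  using split_at[OF assms] assms
  by (intro that[of "take p vs" "vs ! p" "vs ! Suc p" "drop (Suc (Suc p)) vs"])
    (auto simp: swap_at_def)

lemma swap_at_swap_at: "Suc p < length vs \<Longrightarrow> swap_at p (swap_at p vs) = vs"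
  by (elim swap_at_cases) (auto simp: swap_at_append)

lemma mset_swap_at: "Suc p < length vs \<Longrightarrow> mset (swap_at p vs) = mset vs"
  by (elim swap_at_cases) simp

lemma swap_at_one_lines: "vs \<in> one_lines n \<Longrightarrow> Suc p < n \<Longrightarrow> swap_at p vs \<in> one_lines n"
  using one_linesD(1)[of vs n] by (simp add: one_lines_def mset_swap_at del: upt_Suc)

lemma list_inv_upt: "list_inv [a..<b] = 0"
  by (induction "b - a" arbitrary: a) (auto simp: upt_conv_Cons filter_empty_conv)

lemma list_inv_swap: "a < b \<Longrightarrow> list_inv (xs @ b # a # ys) = Suc (list_inv (xs @ a # b # ys))"
  by (induction xs) auto

text \<open>The lower end \<open>a\<close> is left free because the induction removes the first
  position: \<open>?A\<close> collects the inversions that start there, \<open>?B\<close> those that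
  start later.\<close>

lemma card_inversions:
  "card {(i, j). a \<le> i \<and> i < j \<and> j < b \<and> w j < w i} = list_inv (map w [a..<b])"
proof (induction "b - a" arbitrary: a)
  case (Suc k)
  then have ab: "a < b" "k = b - Suc a"
    by auto
  let ?A = "Pair a ` {j. Suc a \<le> j \<and> j < b \<and> w j < w a}"
  let ?B = "{(i, j). Suc a \<le> i \<and> i < j \<and> j < b \<and> w j < (w i :: nat)}"
  have fin: "finite ?B"
    by (rule finite_subset[of _ "{..<b} \<times> {..<b}"]) auto
  have eq: "{(i, j). a \<le> i \<and> i < j \<and> j < b \<and> w j < w i} = ?A \<union> ?B"
    using Suc_le_eq by (auto simp: le_less)
  have "card ?A = card {j. Suc a \<le> j \<and> j < b \<and> w j < w a}"
    by (simp add: card_image inj_on_def)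
  also have "{j. Suc a \<le> j \<and> j < b \<and> w j < w a} = set (filter (\<lambda>j. w j < w a) [Suc a..<b])"
    by auto
  also have "card \<dots> = length (filter (\<lambda>y. y < w a) (map w [Suc a..<b]))"
    by (subst distinct_card) (auto simp: filter_map o_def)
  finally have "card ?A = length (filter (\<lambda>y. y < w a) (map w [Suc a..<b]))"
    by simp
  moreover have "card (?A \<union> ?B) = card ?A + card ?B"
    by (rule card_Un_disjoint) (auto intro: fin)
  ultimately show ?case
    using Suc.hyps(1)[OF ab(2)] ab(1) by (simp add: eq upt_conv_Cons)
next
  case 0
  then have "{(i, j). a \<le> i \<and> i < j \<and> j < b \<and> w j < w i} = {}"
    by auto
  then show ?case
    using 0 by (simp only: card.empty) simp
qed

lemma perm_length_eq: "perm_length n w = list_inv (one_line n w)"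
  unfolding perm_length_def one_line_def card_inversions[symmetric]
  by (simp add: less_Suc_eq_le)

lemma length_one_line [simp]: "length (one_line n w) = n"
  by (simp add: one_line_def)

lemma nth_one_line: "p < n \<Longrightarrow> one_line n w ! p = w (Suc p)"
  by (simp add: one_line_def nth_map del: upt_Suc)

lemma bij_one_line: "bij_betw (one_line n) (perms n) (one_lines n)"
\<comment> \<open>Beyond \<open>{1..n}\<close> the inverse has to be the identity, as
  \<open>permutes\<close> demands; the shift by one is due to list positions counting from
  \<open>0\<close>.\<close>
proof (rule bij_betw_byWitness[where f' = "\<lambda>vs i. if i \<in> {1..n} then vs ! (i - 1) else i"])
  show "\<forall>w\<in>perms n. (\<lambda>i. if i \<in> {1..n} then one_line n w ! (i - 1) else i) = w"
    by (auto simp: perms_def nth_one_line permutes_def fun_eq_iff)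
  show "\<forall>vs\<in>one_lines n. one_line n (\<lambda>i. if i \<in> {1..n} then vs ! (i - 1) else i) = vs"
    by (auto simp: nth_one_line dest!: one_linesD(1) intro!: nth_equalityI)
  show "one_line n ` perms n \<subseteq> one_lines n"
  proof safe
    fix w assume w: "w \<in> perms n"
    then have inj: "inj w" and im: "w ` {1..n} = {1..n}"
      by (auto simp: perms_def permutes_inj permutes_image)
    show "one_line n w \<in> one_lines n"
      by (rule one_linesI)
        (use inj im in \<open>auto simp: one_line_def distinct_map atLeastLessThanSuc_atLeastAtMost
          simp del: upt_Suc intro: inj_on_subset\<close>)
  qed
  show "(\<lambda>vs i. if i \<in> {1..n} then vs ! (i - 1) else i) ` one_lines n \<subseteq> perms n"
  proof safe
    fix vs assume vs: "vs \<in> one_lines n"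
    let ?w = "\<lambda>i. if i \<in> {1..n} then vs ! (i - 1) else i"
    have "bij_betw ?w {1..n} {1..n}"
    proof (rule bij_betw_imageI)
      show "inj_on ?w {1..n}"
        using one_linesD[OF vs] by (auto simp: inj_on_def nth_eq_iff_index_eq)
      have "?w ` {1..n} = (\<lambda>i. vs ! i) ` {0..<n}"
        by (force simp: image_iff intro: bexI[of _ "Suc _"])
      also have "\<dots> = {1..n}"
        using one_linesD[OF vs] nth_image[of n vs] by simp
      finally show "?w ` {1..n} = {1..n}" .
    qed
    then show "?w \<in> perms n"
      unfolding perms_def by (auto intro!: bij_imp_permutes)
  qed
qed

lemma one_line_comp_transpose:
  assumes "1 \<le> i" "i < n"
  shows "one_line n (w \<circ> transpose i (i + 1)) = swap_at (i - 1) (one_line n w)"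
proof -
  have u: "[1..<n+1] = [1..<i] @ i # Suc i # [i+2..<n+1]"
    using assms upt_add_eq_append[of 1 i "n + 1 - i"]
    by (simp add: upt_conv_Cons del: upt_Suc)
  have "map (w \<circ> transpose i (i + 1)) [1..<i] = map w [1..<i]"
    "map (w \<circ> transpose i (i + 1)) [i+2..<n+1] = map w [i+2..<n+1]"
    by (auto simp: transpose_def)
  then show ?thesis
    unfolding one_line_def u by (simp add: swap_at_append del: upt_Suc)
qed

lemma perms_comp_transpose:
  "w \<in> perms n \<Longrightarrow> i \<in> {1..<n} \<Longrightarrow> w \<circ> transpose i (i + 1) \<in> perms n"
  unfolding perms_def using permutes_compose[OF permutes_swap_id[of i "{1..n}" "i + 1"], of w] by auto

lemma perm_length_comp_transpose:
  assumes "i \<in> {1..<n}" "w i < w (i + 1)"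
  shows "perm_length n (w \<circ> transpose i (i + 1)) = Suc (perm_length n w)"
proof -
  obtain p where p: "i = Suc p"
    using assms(1) by (cases i) auto
  then have "Suc p < length (one_line n w)"
    using assms by auto
  then obtain xs a b ys where *: "length xs = p" "one_line n w = xs @ a # b # ys"
    "swap_at p (one_line n w) = xs @ b # a # ys"
    "one_line n w ! p = a" "one_line n w ! Suc p = b"
    by (rule swap_at_cases)
  have "a < b"
    using assms p nth_one_line[of p n w] nth_one_line[of "Suc p" n w] *(4,5) by simp
  then show ?thesis
    using assms(1) list_inv_swap[of a b xs ys] one_line_comp_transpose[of i n w] p *(2,3)
    by (simp add: perm_length_eq)
qed

section \<open>The transfer matrix of a star\<close>

lemma qhalf_mult: "qhalf a * qhalf b = qhalf (a + b)"
  by (simp add: qhalf_def mult_single)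

lemma qhalf_0: "qhalf 0 = 1"
  by (simp add: qhalf_def)

definition in_interval :: "nat \<times> nat \<Rightarrow> nat \<Rightarrow> bool" where
  "in_interval J x \<longleftrightarrow> fst J \<le> x \<and> x \<le> snd J"

text \<open>The blocks are the orbits of \<SS>_J on the letters. Two permutations whose one-line
  notations agree up to blocks in every position lie in the same coset v \<SS>_J, since
  multiplication on the right acts on letters.\<close>

definition same_block :: "nat \<times> nat \<Rightarrow> nat \<Rightarrow> nat \<Rightarrow> bool" where
  "same_block J x y \<longleftrightarrow> x = y \<or> in_interval J x \<and> in_interval J y"

definition star_inv :: "nat \<times> nat \<Rightarrow> nat list \<Rightarrow> nat" where
  "star_inv J vs = list_inv (filter (in_interval J) vs)"

definition star_matrix :: "nat \<times> nat \<Rightarrow> nat list \<Rightarrow> nat list \<Rightarrow> laurent" where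
  "star_matrix J vs ws =
    (if list_all2 (same_block J) vs ws then qhalf (int (star_inv J vs + star_inv J ws)) else 0)"

lemma star_inv_swap:
  "in_interval J a \<Longrightarrow> in_interval J b \<Longrightarrow> a < b \<Longrightarrow>
    star_inv J (xs @ b # a # ys) = Suc (star_inv J (xs @ a # b # ys))"
  by (simp add: star_inv_def list_inv_swap)

lemma star_inv_swap_outside:
  "\<not> (in_interval J a \<and> in_interval J b) \<Longrightarrow>
    star_inv J (xs @ b # a # ys) = star_inv J (xs @ a # b # ys)"
  by (auto simp: star_inv_def)

abbreviation qdiff :: laurent where
  "qdiff \<equiv> qhalf 1 - qhalf (-1)"

lemma qdiff_mult: "qdiff * qhalf k = qhalf (k + 1) - qhalf (k - 1)"
  by (simp add: left_diff_distrib qhalf_mult add.commute)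

text \<open>
  The transfer matrix commutes with the operator \<open>w \<mapsto> s w\<close> (if \<open>\<ell>(s w) > \<ell>(w)\<close>),
  \<open>w \<mapsto> s w + (q^{1/2} - q^{-1/2}) w\<close> (otherwise). In the Hecke algebra this operator is left
  multiplication by the normalised generator, while in the quantum matrix bialgebra it
  expresses \<open>x^{u,w}\<close> in terms of \<open>x^{s u,w'}\<close> for \<open>\<ell>(s u) < \<ell>(u)\<close>.
\<close>

lemma star_matrix_commute:
  assumes p: "Suc p < length vs" "length vs = length ws" and "distinct vs" "distinct ws"
  shows "star_matrix J (swap_at p vs) ws +
      (if vs ! Suc p < vs ! p then qdiff * star_matrix J vs ws else 0) =
    star_matrix J vs (swap_at p ws) +
      (if ws ! Suc p < ws ! p then qdiff * star_matrix J vs ws else 0)"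
proof -
  obtain xs a b ys where v: "length xs = p" "vs = xs @ a # b # ys"
    "swap_at p vs = xs @ b # a # ys" "vs ! p = a" "vs ! Suc p = b"
    using p(1) by (rule swap_at_cases)
  have "Suc p < length ws"
    using p by simp
  then obtain xs' c d ys' where w: "length xs' = p" "ws = xs' @ c # d # ys'"
    "swap_at p ws = xs' @ d # c # ys'" "ws ! p = c" "ws ! Suc p = d"
    by (rule swap_at_cases)
  have ab: "a \<noteq> b" "c \<noteq> d"
    using assms v(2) w(2) by auto
  \<comment> \<open>Whether the other positions match is common to all terms of the identity; if
    they do not match, every term vanishes.\<close>
  define R where "R \<longleftrightarrow> list_all2 (same_block J) xs xs' \<and> list_all2 (same_block J) ys ys'"
  have all2: "list_all2 (same_block J) (xs @ a' # b' # ys) (xs' @ c' # d' # ys') \<longleftrightarrow>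
      R \<and> same_block J a' c' \<and> same_block J b' d'" for a' b' c' d'
    using v(1) w(1) by (auto simp: list_all2_append R_def)
  show ?thesis
  proof (cases R)
    case False
    then show ?thesis
      unfolding v(3-5) w(3-5) unfolding v(2) w(2) star_matrix_def all2 by simp
  next
    case True
    let ?N = "star_inv J (xs @ a # b # ys)" and ?N' = "star_inv J (xs @ b # a # ys)"
    let ?M = "star_inv J (xs' @ c # d # ys')" and ?M' = "star_inv J (xs' @ d # c # ys')"
    have eq: "star_matrix J (xs @ a' # b' # ys) (xs' @ c' # d' # ys') =
      (if same_block J a' c' \<and> same_block J b' d'
       then qhalf (int (star_inv J (xs @ a' # b' # ys) + star_inv J (xs' @ c' # d' # ys'))) else 0)"
      for a' b' c' d'
      unfolding star_matrix_def all2 using True by simp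
    show ?thesis
    proof (cases "in_interval J a \<and> in_interval J b")
      case ab_in: True
      show ?thesis
      proof (cases "in_interval J c \<and> in_interval J d")
        case cd_in: True
        \<comment> \<open>With all four letters in \<open>J\<close> every entry is nonzero, and each
          swap shifts the exponent by one. If the two pairs are ordered differently, the difference
          of the two powers is the correction term by \<open>qdiff_mult\<close>.\<close>
        have N: "if a < b then ?N' = Suc ?N else ?N = Suc ?N'"
          using ab_in ab star_inv_swap[of J a b xs ys] star_inv_swap[of J b a xs ys] by auto
        have M: "if c < d then ?M' = Suc ?M else ?M = Suc ?M'"
          using cd_in ab star_inv_swap[of J c d xs' ys'] star_inv_swap[of J d c xs' ys'] by auto
        have "same_block J x y" if "x \<in> {a, b}" "y \<in> {c, d}" for x y
          using ab_in cd_in that by (auto simp: same_block_def)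
        then show ?thesis
          unfolding v(3-5) w(3-5) unfolding v(2) w(2) eq qdiff_mult using N M ab
          by (auto simp: qdiff_mult add_ac split: if_splits)
      next
        case False
        then show ?thesis
          unfolding v(3-5) w(3-5) unfolding v(2) w(2) eq using ab_in ab by (auto simp: same_block_def)
      qed
    next
      case ab_out: False
      have N: "?N' = ?N"
        using star_inv_swap_outside ab_out by blast
      show ?thesis
      proof (cases "in_interval J c \<and> in_interval J d")
        case True
        then show ?thesis
          unfolding v(3-5) w(3-5) unfolding v(2) w(2) eq using ab_out ab by (auto simp: same_block_def)
      next
        case False
        then have M: "?M' = ?M"
          using star_inv_swap_outside by blast
        \<comment> \<open>Convexity of \<open>J\<close>: a letter outside compares alike with all
          letters inside. As at most one letter of each pair lies in \<open>J\<close>, matching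
          pairs are ordered alike, so the two correction terms agree.\<close>
        have o: "a < b \<longleftrightarrow> c < d" if "same_block J a c" "same_block J b d"
          using that ab_out ab False by (auto simp: same_block_def in_interval_def)
        \<comment> \<open>If the letters match straight, they cannot also match crosswise: the
          letter outside \<open>J\<close> would have to equal both \<open>c\<close> and
          \<open>d\<close>.\<close>
        have z: "\<not> (same_block J a d \<and> same_block J b c)" if "same_block J a c" "same_block J b d"
          using that ab_out ab False by (auto simp: same_block_def)
        show ?thesis
          unfolding v(3-5) w(3-5) unfolding v(2) w(2) eq N M using o z ab
          by (auto simp: not_less_iff_gr_or_eq)
      qed
    qed
  qed
qed

text \<open>The intervals are listed in reverse order.\<close>

fun transfer :: "nat \<Rightarrow> (nat \<times> nat) list \<Rightarrow> nat list \<Rightarrow> nat list \<Rightarrow> laurent" where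
  "transfer n [] us ws = (if us = ws then 1 else 0)"
| "transfer n (J # Js) us ws = (\<Sum>vs\<in>one_lines n. transfer n Js us vs * star_matrix J vs ws)"

text \<open>\<open>star_matrix_commute\<close> moves the swap through one star after another until
  it reaches the row index. The new row has an ascent at \<open>p\<close>, so only the column
  contributes a correction term.\<close>

lemma transfer_swap:
  assumes "us \<in> one_lines n" "ws \<in> one_lines n" "Suc p < n" "us ! Suc p < us ! p"
  shows "transfer n Js us ws = transfer n Js (swap_at p us) (swap_at p ws) +
    (if ws ! Suc p < ws ! p then qdiff * transfer n Js (swap_at p us) ws else 0)"
  using assms(2)
proof (induction Js arbitrary: ws)
  case Nil
  have "Suc p < length us" "Suc p < length ws"
    using assms one_linesD(1) Nil by metis+
  \<comment> \<open>The correction term vanishes: \<open>swap_at p us\<close> has an ascent at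
    \<open>p\<close>, so it differs from \<open>ws\<close> whenever \<open>ws\<close> has a descent
    there.\<close>
  then show ?case
    using assms(4) by (elim swap_at_cases) auto
next
  case (Cons J Js)
  let ?t = "\<lambda>vs. transfer n Js (swap_at p us) vs"
  let ?K = "star_matrix J"
  have len: "length vs = n" "distinct vs" if "vs \<in> one_lines n" for vs
    using that one_linesD by auto
  have "transfer n (J # Js) us ws =
      (\<Sum>vs\<in>one_lines n. ?t (swap_at p vs) * ?K vs ws +
        ?t vs * (if vs ! Suc p < vs ! p then qdiff * ?K vs ws else 0))"
    using Cons.IH by (auto simp: algebra_simps intro!: sum.cong)
  also have "\<dots> = (\<Sum>vs\<in>one_lines n. ?t (swap_at p vs) * ?K vs ws) +
        (\<Sum>vs\<in>one_lines n. ?t vs * (if vs ! Suc p < vs ! p then qdiff * ?K vs ws else 0))"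
    by (rule sum.distrib)
  \<comment> \<open>As \<open>swap_at p\<close> is an involution of \<open>one_lines n\<close>, the
    swap passes from the factor \<open>?t\<close> to the star matrix.\<close>
  also have "(\<Sum>vs\<in>one_lines n. ?t (swap_at p vs) * ?K vs ws) =
      (\<Sum>vs\<in>one_lines n. ?t vs * ?K (swap_at p vs) ws)"
    by (rule sum.reindex_bij_witness[of _ "swap_at p" "swap_at p"])
      (use assms(3) len in \<open>auto simp: swap_at_swap_at swap_at_one_lines\<close>)
  also have "\<dots> + (\<Sum>vs\<in>one_lines n. ?t vs *
        (if vs ! Suc p < vs ! p then qdiff * ?K vs ws else 0)) =
      (\<Sum>vs\<in>one_lines n. ?t vs * (?K (swap_at p vs) ws +
        (if vs ! Suc p < vs ! p then qdiff * ?K vs ws else 0)))"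
    by (simp add: distrib_left sum.distrib)
  also have "\<dots> = (\<Sum>vs\<in>one_lines n. ?t vs * (?K vs (swap_at p ws) +
        (if ws ! Suc p < ws ! p then qdiff * ?K vs ws else 0)))"
    by (intro sum.cong refl arg_cong2[of _ _ _ _ "(*)"] star_matrix_commute)
      (use len assms(3) Cons.prems in auto)
  also have "\<dots> = transfer n (J # Js) (swap_at p us) (swap_at p ws) +
      (if ws ! Suc p < ws ! p then qdiff * transfer n (J # Js) (swap_at p us) ws else 0)"
    by (auto simp: distrib_left sum.distrib sum_distrib_left mult.left_commute)
  finally show ?case .
qed

section \<open>Descents and induction on the length\<close>

lemma finite_perms: "finite (perms n)"
  by (simp add: perms_def finite_permutations)

lemma id_perms: "id \<in> perms n"
  by (simp add: perms_def permutes_id)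

lemma one_line_id: "one_line n id = [1..<n+1]"
  by (simp add: one_line_def del: upt_Suc)

lemma one_line_in: "w \<in> perms n \<Longrightarrow> one_line n w \<in> one_lines n"
  using bij_one_line[of n] bij_betwE by blast

lemma comp_transpose_twice: "w \<circ> transpose i j \<circ> transpose i j = w"
  by (auto simp: fun_eq_iff transpose_def)

lemma perms_inj: "w \<in> perms n \<Longrightarrow> w i = w j \<longleftrightarrow> i = j"
  by (auto simp: perms_def dest: permutes_inj injD)

lemma perms_descent_or_ascent: "w \<in> perms n \<Longrightarrow> w i < w (i + 1) \<or> w (i + 1) < w i"
  using perms_inj[of w n i "i + 1"] by auto

lemma perm_length_descent:
  assumes "i \<in> {1..<n}" "w (i + 1) < w i"
  shows "perm_length n w = Suc (perm_length n (w \<circ> transpose i (i + 1)))"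
  using perm_length_comp_transpose[of i n "w \<circ> transpose i (i + 1)"] assms
  by (simp add: comp_transpose_twice)

lemma perm_eq_id_of_ascents:
  assumes w: "w \<in> perms n" and asc: "\<And>i. i \<in> {1..<n} \<Longrightarrow> w i < w (i + 1)"
  shows "w = id"
proof -
  have "sorted_wrt (<) (one_line n w)"
    by (subst sorted_wrt_iff_nth_Suc_transp) (use asc in \<open>auto simp: nth_one_line\<close>)
  then have "sorted (one_line n w)" "distinct (one_line n w)"
    by (auto simp: strict_sorted_iff)
  moreover have "set (one_line n w) = set [1..<n+1]"
    using one_linesD(3)[OF one_line_in[OF w]] by (simp only: set_upt_Suc_1)
  ultimately have "one_line n w = [1..<n+1]"
    by (intro sorted_distinct_set_unique) (simp_all del: upt_Suc)
  then have "one_line n w = one_line n id"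
    by (simp only: one_line_id)
  then show ?thesis
    using inj_onD[OF bij_betw_imp_inj_on[OF bij_one_line[of n]] _ w id_perms] by blast
qed

text \<open>Induction along the weak order: a permutation other than the identity has a descent, and
  undoing it lowers the length by one.\<close>

lemma perms_induct [consumes 1, case_names id ascent]:
  assumes "w \<in> perms n" and "P id"
    and "\<And>w i. w \<in> perms n \<Longrightarrow> i \<in> {1..<n} \<Longrightarrow> w i < w (i + 1) \<Longrightarrow> P w \<Longrightarrow>
      P (w \<circ> transpose i (i + 1))"
  shows "P w"
  using assms(1)
proof (induction "perm_length n w" arbitrary: w rule: less_induct)
  case less
  show ?case
  proof (cases "\<forall>i\<in>{1..<n}. w i < w (i + 1)")
    case True
    then have "w = id"
      using perm_eq_id_of_ascents less.prems by blast
    then show ?thesis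
      using assms(2) by simp
  next
    case False
    then obtain i where i: "i \<in> {1..<n}" "w (i + 1) < w i"
      using perms_descent_or_ascent[OF less.prems] by blast
    have "P (w \<circ> transpose i (i + 1) \<circ> transpose i (i + 1))"
    proof (rule assms(3))
      show w': "w \<circ> transpose i (i + 1) \<in> perms n"
        using perms_comp_transpose less.prems i by blast
      then show "P (w \<circ> transpose i (i + 1))"
        using less.hyps perm_length_descent[OF i] by simp
    qed (use i in auto)
    then show ?thesis
      by (simp only: comp_transpose_twice)
  qed
qed

section \<open>Reduced expressions\<close>

lemma perm_length_id: "perm_length n id = 0"
  unfolding perm_length_eq one_line_id by (rule list_inv_upt)

lemma reduced_Nil: "reduced_expression n [] w \<longleftrightarrow> w = id"
  by (auto simp: reduced_expression_def perm_length_id)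

lemma word_perm_perms: "set is \<subseteq> {1..<n} \<Longrightarrow> word_perm is \<in> perms n"
  by (induction "is") (auto intro: perms_comp_transpose[simplified] id_perms)

lemma reduced_perms: "reduced_expression n is w \<Longrightarrow> w \<in> perms n"
  by (auto simp: reduced_expression_def word_perm_perms)

lemma perm_length_comp_transpose_le:
  assumes "w \<in> perms n" "i \<in> {1..<n}"
  shows "perm_length n (w \<circ> transpose i (i + 1)) \<le> Suc (perm_length n w)"
  using perms_descent_or_ascent[OF assms(1), of i]
proof
  assume "w i < w (i + 1)"
  then show ?thesis
    using perm_length_comp_transpose[of i n w] assms(2) by linarith
next
  assume "w (i + 1) < w i"
  then show ?thesis
    using perm_length_descent[of i n w] assms(2) by linarith
qed

lemma perm_length_word_perm: "set is \<subseteq> {1..<n} \<Longrightarrow> perm_length n (word_perm is) \<le> length is"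
proof (induction "is")
  case Nil
  then show ?case
    by (simp only: word_perm.simps perm_length_id)
next
  case (Cons i "is")
  then have i: "i \<in> {1..<n}" and "is": "set is \<subseteq> {1..<n}"
    by auto
  have "perm_length n (word_perm (i # is)) = perm_length n (word_perm is \<circ> transpose i (i + 1))"
    by (simp only: word_perm.simps)
  also have "\<dots> \<le> Suc (perm_length n (word_perm is))"
    by (rule perm_length_comp_transpose_le[OF word_perm_perms[OF "is"] i])
  also have "\<dots> \<le> length (i # is)"
    using Cons.IH[OF "is"] by simp
  finally show ?case .
qed

text \<open>If the first letter were an ascent, the remaining word would be shorter than the length
  of the permutation that it spells. Reduced words can thus be handled by recursion on
  descents.\<close>

lemma reduced_Cons:
  "reduced_expression n (i # is) w \<longleftrightarrow>
    i \<in> {1..<n} \<and> w (i + 1) < w i \<and> reduced_expression n is (w \<circ> transpose i (i + 1))"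
proof
  assume r: "reduced_expression n (i # is) w"
  then have i: "i \<in> {1..<n}" and "is": "set is \<subseteq> {1..<n}"
    and w: "w \<circ> transpose i (i + 1) = word_perm is" and l: "perm_length n w = Suc (length is)"
    by (auto simp: reduced_expression_def comp_transpose_twice)
  have le: "perm_length n (w \<circ> transpose i (i + 1)) \<le> length is"
    unfolding w by (rule perm_length_word_perm[OF "is"])
  then have "\<not> w i < w (i + 1)"
    using perm_length_comp_transpose[OF i, of w] l by linarith
  then have d: "w (i + 1) < w i"
    using perms_descent_or_ascent[OF reduced_perms[OF r]] by blast
  then show "i \<in> {1..<n} \<and> w (i + 1) < w i \<and> reduced_expression n is (w \<circ> transpose i (i + 1))"
    using i "is" w l perm_length_descent[OF i d] by (auto simp: reduced_expression_def)
next
  assume "i \<in> {1..<n} \<and> w (i + 1) < w i \<and> reduced_expression n is (w \<circ> transpose i (i + 1))"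
  then show "reduced_expression n (i # is) w"
    using perm_length_descent[of i n w]
    by (auto simp: reduced_expression_def comp_transpose_twice)
qed

lemma reduced_exists: "w \<in> perms n \<Longrightarrow> \<exists>is. reduced_expression n is w"
proof (induction rule: perms_induct)
  case id
  then show ?case
    using reduced_Nil by blast
next
  case (ascent w i)
  then obtain "is" where "reduced_expression n is w"
    by blast
  then have "reduced_expression n (i # is) (w \<circ> transpose i (i + 1))"
    using ascent by (simp add: reduced_Cons comp_transpose_twice)
  then show ?case
    by blast
qed

section \<open>Multiplication in the Hecke algebra\<close>

lemma hecke_relations_carrier: "hecke_relations n \<subseteq> free_carrier {1..<n}"
  unfolding hecke_relations_def
  by (intro Un_least subsetI; clarify) (intro free_carrier_intros; simp)+

locale hecke_algebra = presentation "{1..<n}" "hecke_relations n" for n :: nat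
begin

abbreviation hecke_eqv (infix \<open>\<approx>\<close> 50) where
  "f \<approx> g \<equiv> eqv f g"

lemma eqv_wmon_Cons: "i \<in> {1..<n} \<Longrightarrow> wmon is \<approx> wmon js \<Longrightarrow> wmon (i # is) \<approx> wmon (i # js)"
  using eqv_mult[OF eqv_refl[of "wmon [i]"], of "wmon is" "wmon js"]
  by (simp add: wmon_mult free_carrier_wmon)

lemma eqv_wmon_append:
  "wmon is \<approx> wmon js \<Longrightarrow> set ks \<subseteq> {1..<n} \<Longrightarrow> wmon (is @ ks) \<approx> wmon (js @ ks)"
  using eqv_mult[OF _ eqv_refl[of "wmon ks"], of "wmon is" "wmon js"]
  by (simp add: wmon_mult free_carrier_wmon)

lemma
  assumes "i \<in> {1..<n}" "j \<in> {1..<n}"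
  shows quadratic: "wmon [i, i] \<approx> scalar (qhalf 2 - 1) * wmon [i] + scalar (qhalf 2)"
    and braid: "j = i + 1 \<Longrightarrow> wmon [i, j, i] \<approx> wmon [j, i, j]"
    and far_commute: "i + 2 \<le> j \<or> j + 2 \<le> i \<Longrightarrow> wmon [i, j] \<approx> wmon [j, i]"
proof -
  have "var i * var i - (scalar (qhalf 2 - 1) * var i + scalar (qhalf 2)) \<in> hecke_relations n"
    using assms unfolding hecke_relations_def by blast
  then show "wmon [i, i] \<approx> scalar (qhalf 2 - 1) * wmon [i] + scalar (qhalf 2)"
    using assms by (intro relation_eqv) (auto simp: var_wmon wmon_mult intro!: free_carrier_intros)
  show "wmon [i, j, i] \<approx> wmon [j, i, j]" if "j = i + 1"
  proof (intro relation_eqv)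
    have "var i * var j * var i - var j * var i * var j \<in> hecke_relations n"
      using assms that unfolding hecke_relations_def by blast
    then show "wmon [i, j, i] - wmon [j, i, j] \<in> hecke_relations n"
      by (simp add: var_wmon wmon_mult)
  qed (use assms in \<open>auto intro!: free_carrier_intros\<close>)
  show "wmon [i, j] \<approx> wmon [j, i]" if "i + 2 \<le> j \<or> j + 2 \<le> i"
  proof (intro relation_eqv)
    have "var i * var j - var j * var i \<in> hecke_relations n"
      using assms that unfolding hecke_relations_def by blast
    then show "wmon [i, j] - wmon [j, i] \<in> hecke_relations n"
      by (simp add: var_wmon wmon_mult)
  qed (use assms in \<open>auto intro!: free_carrier_intros\<close>)
qed

section \<open>Matsumoto's theorem\<close>

lemma reduced_set: "reduced_expression n is w \<Longrightarrow> set is \<subseteq> {1..<n}"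
  by (simp add: reduced_expression_def)

text \<open>Both \<open>i\<close> and \<open>j\<close> are descents of \<open>w\<close>, so there
  are reduced words that begin with \<open>i, j\<close> and with \<open>j, i\<close> and share a
  tail \<open>ks\<close>. The induction hypothesis, applied behind the first letter, links each
  given word to one of them, and the commutation relation links these two.\<close>

lemma matsumoto_far:
  assumes IH: "\<And>w' is js. perm_length n w' < perm_length n w \<Longrightarrow> reduced_expression n is w' \<Longrightarrow>
      reduced_expression n js w' \<Longrightarrow> wmon is \<approx> wmon js"
    and i: "reduced_expression n (i # is) w" and j: "reduced_expression n (j # js) w"
    and ij: "i + 2 \<le> j \<or> j + 2 \<le> i"
  shows "wmon (i # is) \<approx> wmon (j # js)"
proof -
  let ?s = "\<lambda>i. transpose i (i + 1)"
  have i': "i \<in> {1..<n}" "w (i + 1) < w i" "reduced_expression n is (w \<circ> ?s i)"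
    and j': "j \<in> {1..<n}" "w (j + 1) < w j" "reduced_expression n js (w \<circ> ?s j)"
    using i j by (auto simp: reduced_Cons)
  have w: "w \<in> perms n"
    using reduced_perms[OF i] .
  obtain ks where ks: "reduced_expression n ks (w \<circ> ?s i \<circ> ?s j)"
    using reduced_exists perms_comp_transpose w i'(1) j'(1) by metis
  have comm: "w \<circ> ?s j \<circ> ?s i = w \<circ> ?s i \<circ> ?s j"
    using ij by (auto simp: fun_eq_iff transpose_def)
  have "reduced_expression n (j # ks) (w \<circ> ?s i)"
    using ks j' ij by (auto simp: reduced_Cons transpose_def)
  then have "wmon is \<approx> wmon (j # ks)"
    using IH[OF _ i'(3)] perm_length_descent[OF i'(1,2)] by simp
  then have 1: "wmon (i # is) \<approx> wmon ([i, j] @ ks)"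
    using eqv_wmon_Cons i'(1) by simp
  have "reduced_expression n (i # ks) (w \<circ> ?s j)"
    using ks i' ij unfolding reduced_Cons comm by (auto simp: transpose_def)
  then have "wmon js \<approx> wmon (i # ks)"
    using IH[OF _ j'(3)] perm_length_descent[OF j'(1,2)] by simp
  then have 2: "wmon (j # js) \<approx> wmon ([j, i] @ ks)"
    using eqv_wmon_Cons j'(1) by simp
  have "wmon ([i, j] @ ks) \<approx> wmon ([j, i] @ ks)"
    using far_commute[OF i'(1) j'(1) ij] reduced_set[OF ks] by (rule eqv_wmon_append)
  then show ?thesis
    using 1 2 eqv_sym eqv_trans by blast
qed

text \<open>The same argument with the braid relation; the words in the middle begin with
  \<open>i, j, i\<close> and \<open>j, i, j\<close>.\<close>

lemma matsumoto_near:
  assumes IH: "\<And>w' is js. perm_length n w' < perm_length n w \<Longrightarrow> reduced_expression n is w' \<Longrightarrow>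
      reduced_expression n js w' \<Longrightarrow> wmon is \<approx> wmon js"
    and i: "reduced_expression n (i # is) w" and j: "reduced_expression n (j # js) w"
    and ij: "j = i + 1"
  shows "wmon (i # is) \<approx> wmon (j # js)"
proof -
  let ?s = "\<lambda>i. transpose i (i + 1)"
  have i': "i \<in> {1..<n}" "w (i + 1) < w i" "reduced_expression n is (w \<circ> ?s i)"
    and j': "j \<in> {1..<n}" "w (j + 1) < w j" "reduced_expression n js (w \<circ> ?s j)"
    using i j by (auto simp: reduced_Cons)
  have w: "w \<in> perms n"
    using reduced_perms[OF i] .
  obtain ks where ks: "reduced_expression n ks (w \<circ> ?s i \<circ> ?s j \<circ> ?s i)"
    using reduced_exists perms_comp_transpose w i'(1) j'(1) by metis
  have comm: "w \<circ> ?s j \<circ> ?s i \<circ> ?s j = w \<circ> ?s i \<circ> ?s j \<circ> ?s i"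
    using ij by (auto simp: fun_eq_iff transpose_def)
  \<comment> \<open>The letters of \<open>w\<close> at \<open>i\<close>, \<open>i + 1\<close>,
    \<open>i + 2\<close> decrease, so each of the three transpositions undoes a descent and the word
    stays reduced.\<close>
  have "reduced_expression n (j # i # ks) (w \<circ> ?s i)"
    using ks i' j' ij by (auto simp: reduced_Cons transpose_def)
  then have "wmon is \<approx> wmon (j # i # ks)"
    using IH[OF _ i'(3)] perm_length_descent[OF i'(1,2)] by simp
  then have 1: "wmon (i # is) \<approx> wmon ([i, j, i] @ ks)"
    using eqv_wmon_Cons i'(1) by simp
  have "reduced_expression n (i # j # ks) (w \<circ> ?s j)"
    using ks i' j' ij unfolding reduced_Cons comm by (auto simp: transpose_def)
  then have "wmon js \<approx> wmon (i # j # ks)"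
    using IH[OF _ j'(3)] perm_length_descent[OF j'(1,2)] by simp
  then have 2: "wmon (j # js) \<approx> wmon ([j, i, j] @ ks)"
    using eqv_wmon_Cons j'(1) by simp
  have "wmon ([i, j, i] @ ks) \<approx> wmon ([j, i, j] @ ks)"
    using braid[OF i'(1) j'(1) ij] reduced_set[OF ks] by (rule eqv_wmon_append)
  then show ?thesis
    using 1 2 eqv_sym eqv_trans by blast
qed

text \<open>Needed because \<open>hecke_T\<close> picks an unspecified reduced word, while
  multiplication by a generator produces a particular one. Only the first letters of the two words
  are compared; the rest is left to the induction on the length.\<close>

lemma matsumoto:
  assumes "reduced_expression n is w" "reduced_expression n js w"
  shows "wmon is \<approx> wmon js"
  using assms
proof (induction "perm_length n w" arbitrary: w "is" js rule: less_induct)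
  case less
  have len: "length is = length js"
    using less.prems by (simp add: reduced_expression_def)
  have IH: "wmon is' \<approx> wmon js'" if "perm_length n w' < perm_length n w"
    "reduced_expression n is' w'" "reduced_expression n js' w'" for w' is' js'
    using less.hyps that by blast
  show ?case
  proof (cases "is")
    case Nil
    then show ?thesis
      using len eqv_refl[OF free_carrier_wmon, of "[]"] by simp
  next
    case (Cons i is')
    then obtain j js' where js: "js = j # js'"
      using len by (cases js) auto
    consider "i = j" | "j = i + 1" | "i = j + 1" | "i + 2 \<le> j \<or> j + 2 \<le> i"
      by linarith
    then show ?thesis
    proof cases
      case 1
      have "wmon is' \<approx> wmon js'"
        using less.prems 1 perm_length_descent[of i n w] unfolding Cons js reduced_Cons
        by (intro less.hyps[of "w \<circ> transpose i (i + 1)"]) auto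
      then show ?thesis
        using less.prems(1) eqv_wmon_Cons 1 unfolding Cons js reduced_Cons by blast
    next
      case 2
      show ?thesis
        unfolding Cons js
        by (rule matsumoto_near[OF _ less.prems[unfolded Cons js] 2]) (rule IH)
    next
      case 3
      show ?thesis
        unfolding Cons js
        by (rule eqv_sym[OF matsumoto_near[OF _ less.prems(2,1)[unfolded Cons js] 3]]) (rule IH)
    next
      case 4
      show ?thesis
        unfolding Cons js
        by (rule matsumoto_far[OF _ less.prems[unfolded Cons js] 4]) (rule IH)
    qed
  qed
qed

section \<open>Normalised basis elements and the action of the generators\<close>

definition T :: "(nat \<Rightarrow> nat) \<Rightarrow> nat free_alg" where
  "T w = wmon (SOME is. reduced_expression n is w)"

definition Tnorm :: "(nat \<Rightarrow> nat) \<Rightarrow> nat free_alg" where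
  "Tnorm w = scalar (qhalf (- int (perm_length n w))) * T w"

lemma some_reduced: "w \<in> perms n \<Longrightarrow> reduced_expression n (SOME is. reduced_expression n is w) w"
  using reduced_exists someI_ex by metis

lemma hecke_T_eq: "w \<in> perms n \<Longrightarrow> hecke_T n w = proj (T w)"
  unfolding hecke_T_def T_def hecke_def T_gen_def
  using list_mult_generator[OF reduced_set[OF some_reduced]] .

lemma T_carrier: "w \<in> perms n \<Longrightarrow> T w \<in> free_carrier {1..<n}"
  unfolding T_def by (rule free_carrier_wmon[OF reduced_set[OF some_reduced]])

lemma T_eqv: "reduced_expression n is w \<Longrightarrow> T w \<approx> wmon is"
  unfolding T_def by (rule matsumoto[OF some_reduced[OF reduced_perms]])

lemma T_mult_ascent:
  assumes "w \<in> perms n" "i \<in> {1..<n}" "w i < w (i + 1)"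
  shows "wmon [i] * T w \<approx> T (w \<circ> transpose i (i + 1))"
proof -
  have r: "reduced_expression n (SOME is. reduced_expression n is w) w" (is "reduced_expression n ?is w")
    by (rule some_reduced[OF assms(1)])
  then have "reduced_expression n (i # ?is) (w \<circ> transpose i (i + 1))"
    using assms by (simp add: reduced_Cons comp_transpose_twice)
  from eqv_sym[OF T_eqv[OF this]] show ?thesis
    by (simp add: T_def wmon_mult)
qed

text \<open>Up to congruence \<open>T w\<close> is the generator times \<open>T\<close> of the
  shorter permutation, so the quadratic relation applies to the two leading generators.\<close>

lemma T_mult_descent:
  assumes w: "w \<in> perms n" and i: "i \<in> {1..<n}" and d: "w (i + 1) < w i"
  shows "wmon [i] * T w \<approx>
    scalar (qhalf 2 - 1) * T w + scalar (qhalf 2) * T (w \<circ> transpose i (i + 1))"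
proof -
  let ?v = "w \<circ> transpose i (i + 1)"
  have v: "?v \<in> perms n"
    using perms_comp_transpose w i by blast
  have "wmon [i] * T ?v \<approx> T (?v \<circ> transpose i (i + 1))"
    by (rule T_mult_ascent[OF v i]) (use d in auto)
  then have 1: "wmon [i] * T ?v \<approx> T w"
    by (simp only: comp_transpose_twice)
  have wi: "wmon [i] \<approx> wmon [i]"
    using eqv_refl[OF free_carrier_wmon[of "[i]" "{1..<n}"]] i by simp
  have "wmon [i] * T w \<approx> wmon [i] * (wmon [i] * T ?v)"
    by (rule eqv_mult[OF wi eqv_sym[OF 1]])
  also have "wmon [i] * (wmon [i] * T ?v) = wmon [i, i] * T ?v"
    by (simp add: wmon_mult flip: mult.assoc)
  also have "\<dots> \<approx> (scalar (qhalf 2 - 1) * wmon [i] + scalar (qhalf 2)) * T ?v"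
    by (rule eqv_mult[OF quadratic[OF i i] eqv_refl[OF T_carrier[OF v]]])
  also have "\<dots> = scalar (qhalf 2 - 1) * (wmon [i] * T ?v) + scalar (qhalf 2) * T ?v"
    by (simp add: distrib_right mult.assoc)
  also have "\<dots> \<approx> scalar (qhalf 2 - 1) * T w + scalar (qhalf 2) * T ?v"
    by (intro eqv_add eqv_scalar 1 eqv_refl T_carrier v)
  finally show ?thesis .
qed

lemma Tnorm_mult:
  assumes w: "w \<in> perms n" and i: "i \<in> {1..<n}"
  shows "scalar (qhalf (-1)) * wmon [i] * Tnorm w \<approx>
    Tnorm (w \<circ> transpose i (i + 1)) + (if w (i + 1) < w i then scalar qdiff * Tnorm w else 0)"
proof -
  let ?v = "w \<circ> transpose i (i + 1)" and ?l = "int (perm_length n w)"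
  have e: "scalar (qhalf (-1)) * wmon [i] * Tnorm w = scalar (qhalf (-1 - ?l)) * (wmon [i] * T w)"
  proof -
    have "scalar (qhalf (-1)) * wmon [i] * Tnorm w =
        scalar (qhalf (-1)) * (scalar (qhalf (- ?l)) * (wmon [i] * T w))"
      by (simp only: Tnorm_def mult.assoc scalar_left_commute[of "wmon [i]"])
    also have "\<dots> = scalar (qhalf (-1) * qhalf (- ?l)) * (wmon [i] * T w)"
      by (simp only: scalar_mult mult.assoc)
    finally show ?thesis
      unfolding qhalf_mult add_uminus_conv_diff .
  qed
  show ?thesis
  proof (cases "w (i + 1) < w i")
    case False
    then have a: "w i < w (i + 1)"
      using perms_descent_or_ascent[OF w] by blast
    have l: "-1 - ?l = - int (perm_length n ?v)"
      using perm_length_comp_transpose[OF i a] by simp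
    have "scalar (qhalf (-1 - ?l)) * (wmon [i] * T w) \<approx> scalar (qhalf (-1 - ?l)) * T ?v"
      by (rule eqv_scalar[OF T_mult_ascent[OF w i a]])
    also have "scalar (qhalf (-1 - ?l)) * T ?v = Tnorm ?v"
      unfolding l Tnorm_def ..
    finally show ?thesis
      using False e by simp
  next
    case True
    have "scalar (qhalf (-1 - ?l)) * (wmon [i] * T w) \<approx> scalar (qhalf (-1 - ?l)) *
        (scalar (qhalf 2 - 1) * T w + scalar (qhalf 2) * T ?v)"
      by (rule eqv_scalar[OF T_mult_descent[OF w i True]])
    also have "\<dots> = scalar (qhalf (-1 - ?l) * (qhalf 2 - 1)) * T w +
        scalar (qhalf (-1 - ?l) * qhalf 2) * T ?v"
      by (simp add: distrib_left scalar_mult mult.assoc)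
    also have "qhalf (-1 - ?l) * qhalf 2 = qhalf (- int (perm_length n ?v))"
      unfolding qhalf_mult using perm_length_descent[OF i True] by simp
    \<comment> \<open>Extracting q^{1/2} turns the coefficient q - 1 of the quadratic relation into
      q^{1/2} - q^{-1/2}.\<close>
    also have "qhalf (-1 - ?l) * (qhalf 2 - 1) = qdiff * qhalf (- ?l)"
    proof -
      have "-1 - ?l + 2 = - ?l + 1" "-1 - ?l = - ?l - 1"
        by simp_all
      then show ?thesis
        by (simp only: qdiff_mult right_diff_distrib qhalf_mult mult_1_right)
    qed
    also have "scalar (qdiff * qhalf (- ?l)) * T w + scalar (qhalf (- int (perm_length n ?v))) * T ?v =
        Tnorm ?v + scalar qdiff * Tnorm w"
      by (simp only: Tnorm_def scalar_mult mult.assoc add.commute)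
    finally show ?thesis
      by (simp only: e True if_True)
  qed
qed

end

section \<open>Parabolic subgroups of intervals\<close>

lemma transpose_interval_permutes:
  fixes i :: nat
  shows "i \<in> {a..<b} \<Longrightarrow> transpose i (i + 1) permutes {a..b}"
  by (rule permutes_swap_id) auto

text \<open>A permutation of \<open>{a..b}\<close> other than the identity has a descent inside the
  interval, and undoing it gives a shorter permutation of \<open>{a..b}\<close>; so the generators
  inside the interval suffice.\<close>

lemma interval_perms_eq:
  assumes "1 \<le> a" "b \<le> n"
  shows "interval_perms n (a, b) = {w. w permutes {a..b}}" (is "_ = ?P")
proof
  interpret group "sym_group n"
    by (rule sym_group_is_group)
  have sub: "{a..b} \<subseteq> {1..n}"
    using assms by auto
  have "subgroup ?P (sym_group n)"
  proof (rule subgroupI)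
    show "?P \<subseteq> carrier (sym_group n)"
      using permutes_subset[OF _ sub] by (auto simp: sym_group_carrier)
    show "?P \<noteq> {}"
      using permutes_id by blast
    show "inv\<^bsub>sym_group n\<^esub> w \<in> ?P" if "w \<in> ?P" for w
      using that permutes_subset[OF _ sub, of w] permutes_inv by (simp add: sym_group_carrier)
    show "v \<otimes>\<^bsub>sym_group n\<^esub> w \<in> ?P" if "v \<in> ?P" "w \<in> ?P" for v w
      using that permutes_compose by (simp add: sym_group_mult)
  qed
  then show "interval_perms n (a, b) \<subseteq> ?P"
    unfolding interval_perms_def prod.case
    by (rule generate_subgroup_incl[rotated]) (use transpose_interval_permutes in blast)
  have "w \<in> interval_perms n (a, b)" if "w permutes {a..b}" for w
    using that
  proof (induction "perm_length n w" arbitrary: w rule: less_induct)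
    case less
    have w: "w \<in> perms n"
      using permutes_subset[OF less.prems sub] by (simp add: perms_def)
    have fixed: "w i = i" if "\<not> (a \<le> i \<and> i \<le> b)" for i
      using less.prems that by (auto simp: permutes_def)
    have ins: "a \<le> w i \<and> w i \<le> b" if "a \<le> i \<and> i \<le> b" for i
      using permutes_in_image[OF less.prems, of i] that by auto
    show ?case
    proof (cases "\<forall>i\<in>{a..<b}. w i < w (i + 1)")
      case True
      \<comment> \<open>Across and beyond the ends of the interval ascents are automatic: points
        outside are fixed and points inside stay inside.\<close>
      have "w i < w (i + 1)" for i
      proof (cases "i \<in> {a..<b}")
        case False
        then consider "i + 1 < a" | "i + 1 = a" "a \<le> b" | "i = b" "a \<le> b" | "b < i" | "b < a"
          by fastforce
        then show ?thesis
          by cases (use fixed[of i] fixed[of "i + 1"] ins[of i] ins[of "i + 1"] in auto)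
      qed (use True in auto)
      then have "w = id"
        using perm_eq_id_of_ascents[OF w] by blast
      then show ?thesis
        using generate.one[of "sym_group n"] by (simp add: interval_perms_def sym_group_one)
    next
      case False
      then obtain i where i: "i \<in> {a..<b}" "w (i + 1) < w i"
        using perms_descent_or_ascent[OF w] by blast
      then have i': "i \<in> {1..<n}"
        using assms by auto
      have "w \<circ> transpose i (i + 1) \<in> interval_perms n (a, b)"
        using less.hyps[of "w \<circ> transpose i (i + 1)"] perm_length_descent[of i n w, OF i' i(2)]
          permutes_compose[OF transpose_interval_permutes[OF i(1)] less.prems] by simp
      moreover have "transpose i (i + 1) \<in> interval_perms n (a, b)"
        unfolding interval_perms_def prod.case using i(1) by (intro generate.incl) auto
      ultimately have "w \<circ> transpose i (i + 1) \<circ> transpose i (i + 1) \<in> interval_perms n (a, b)"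
        using generate.eng[of _ "sym_group n"] by (fastforce simp: interval_perms_def sym_group_mult)
      then show ?thesis
        by (simp only: comp_transpose_twice)
    qed
  qed
  then show "?P \<subseteq> interval_perms n (a, b)"
    by blast
qed

lemma list_inv_append_le:
  "(\<And>x y. x \<in> set xs \<Longrightarrow> y \<in> set ys \<Longrightarrow> x \<le> y) \<Longrightarrow> list_inv (xs @ ys) = list_inv xs + list_inv ys"
proof (induction xs)
  case (Cons x xs)
  then have "filter (\<lambda>y. y < x) ys = []"
    by (auto simp: filter_empty_conv not_less)
  then show ?case
    using Cons by simp
qed simp

lemma upt_split3:
  "1 \<le> a \<Longrightarrow> a \<le> b \<Longrightarrow> b \<le> n \<Longrightarrow> [1..<n+1] = [1..<a] @ [a..<b+1] @ [b+1..<n+1]"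
  using upt_add_eq_append[of 1 a "n + 1 - a"] upt_add_eq_append[of a "b + 1" "n - b"]
  by (simp del: upt_Suc)

text \<open>The letters outside \<open>[a, b]\<close> are fixed and stand in order before or after
  the block, so every inversion is between two letters of the block.\<close>

lemma star_inv_interval_perm:
  assumes "1 \<le> a" "a \<le> b" "b \<le> n" and w: "w permutes {a..b}"
  shows "star_inv (a, b) (one_line n w) = perm_length n w"
proof -
  have ins: "a \<le> w i \<and> w i \<le> b" if "a \<le> i \<and> i \<le> b" for i
    using permutes_in_image[OF w, of i] that by auto
  have out: "map w [1..<a] = [1..<a]" "map w [b+1..<n+1] = [b+1..<n+1]"
    using w by (auto simp: permutes_def intro!: map_idI simp del: upt_Suc)
  have ol: "one_line n w = [1..<a] @ map w [a..<b+1] @ [b+1..<n+1]"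
    unfolding one_line_def upt_split3[OF assms(1-3)] map_append out ..
  have "filter (in_interval (a, b)) [1..<a] = []" "filter (in_interval (a, b)) [b+1..<n+1] = []"
    by (auto simp: filter_empty_conv in_interval_def simp del: upt_Suc)
  moreover have "filter (in_interval (a, b)) (map w [a..<b+1]) = map w [a..<b+1]"
    using ins by (auto simp: filter_id_conv in_interval_def simp del: upt_Suc)
  ultimately have "filter (in_interval (a, b)) (one_line n w) = map w [a..<b+1]"
    unfolding ol filter_append by simp
  moreover have "list_inv (one_line n w) = list_inv (map w [a..<b+1])"
  proof -
    have "list_inv (one_line n w) = list_inv [1..<a] + list_inv (map w [a..<b+1] @ [b+1..<n+1])"
      unfolding ol
    proof (rule list_inv_append_le)
      fix x y assume "x \<in> set [1..<a]" "y \<in> set (map w [a..<b+1] @ [b+1..<n+1])"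
      then show "x \<le> y"
        using ins assms(2) unfolding set_append set_map set_upt by fastforce
    qed
    also have "list_inv (map w [a..<b+1] @ [b+1..<n+1]) =
        list_inv (map w [a..<b+1]) + list_inv [b+1..<n+1]"
    proof (rule list_inv_append_le)
      fix x y assume "x \<in> set (map w [a..<b+1])" "y \<in> set [b+1..<n+1]"
      then show "x \<le> y"
        using ins unfolding set_map set_upt by fastforce
    qed
    finally show ?thesis
      by (simp only: list_inv_upt add_0 add_0_right)
  qed
  ultimately show ?thesis
    by (simp add: star_inv_def perm_length_eq)
qed

lemma same_block_one_line_id:
  assumes "1 \<le> a" "a \<le> b" "b \<le> n" and w: "w \<in> perms n"
  shows "list_all2 (same_block (a, b)) (one_line n id) (one_line n w) \<longleftrightarrow> w permutes {a..b}"
proof -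
  have "list_all2 (same_block (a, b)) (one_line n id) (one_line n w) \<longleftrightarrow>
      (\<forall>i\<in>{1..n}. same_block (a, b) i (w i))"
    unfolding one_line_def list_all2_map1 list_all2_map2 list_all2_same set_upt_Suc_1 id_apply ..
  also have "\<dots> \<longleftrightarrow> (\<forall>i. i \<notin> {a..b} \<longrightarrow> w i = i)"
  proof
    assume all: "\<forall>i\<in>{1..n}. same_block (a, b) i (w i)"
    show "\<forall>i. i \<notin> {a..b} \<longrightarrow> w i = i"
    proof safe
      fix i assume "i \<notin> {a..b}"
      moreover have "i \<notin> {1..n} \<Longrightarrow> w i = i"
        using w by (simp add: perms_def permutes_def)
      moreover have "i \<in> {1..n} \<Longrightarrow> same_block (a, b) i (w i)"
        using all by blast
      ultimately show "w i = i"
        by (cases "i \<in> {1..n}") (auto simp: same_block_def in_interval_def)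
    qed
  next
    assume out: "\<forall>i. i \<notin> {a..b} \<longrightarrow> w i = i"
    show "\<forall>i\<in>{1..n}. same_block (a, b) i (w i)"
    proof
      fix i
      \<comment> \<open>If \<open>w i\<close> were outside the interval, \<open>w\<close> would fix
        it, and injectivity would give \<open>w i = i\<close>.\<close>
      have "w i \<in> {a..b}" if "i \<in> {a..b}"
        using out perms_inj[OF w, of "w i" i] that by (cases "w i \<in> {a..b}") auto
      then show "same_block (a, b) i (w i)"
        using out by (cases "i \<in> {a..b}") (auto simp: same_block_def in_interval_def)
    qed
  qed
  also have "\<dots> \<longleftrightarrow> w permutes {a..b}"
    using w by (auto simp: perms_def permutes_def)
  finally show ?thesis .
qed

section \<open>Products of the elements C_J in the normalised basis\<close>

context hecke_algebra
begin

definition C :: "nat \<times> nat \<Rightarrow> nat free_alg" where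
  "C J = (\<Sum>w\<in>interval_perms n J. T w)"

lemma interval_perms_subset: "1 \<le> a \<Longrightarrow> b \<le> n \<Longrightarrow> interval_perms n (a, b) \<subseteq> perms n"
  using permutes_subset[of _ "{a..b}" "{1..n}"] by (auto simp: interval_perms_eq perms_def)

lemma
  assumes "1 \<le> a" "b \<le> n"
  shows C_carrier: "C (a, b) \<in> free_carrier {1..<n}"
    and C_tilde_eq: "C_tilde n (a, b) = proj (C (a, b))"
proof -
  show "C (a, b) \<in> free_carrier {1..<n}"
    unfolding C_def using interval_perms_subset[OF assms] by (intro free_carrier_sum T_carrier) blast
  show "C_tilde n (a, b) = proj (C (a, b))"
    unfolding C_tilde_def C_def hecke_def
  proof (rule finsum_proj'[OF finite_subset[OF interval_perms_subset[OF assms] finite_perms]])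
    fix w assume "w \<in> interval_perms n (a, b)"
    then have "w \<in> perms n"
      using interval_perms_subset[OF assms] by blast
    then show "T w \<in> free_carrier {1..<n}" "hecke_T n w = proj (T w)"
      by (rule T_carrier hecke_T_eq)+
  qed
qed

lemma Tnorm_id: "Tnorm id \<approx> 1"
  using T_eqv[of "[]" id] by (simp add: Tnorm_def perm_length_id qhalf_0 scalar_1 reduced_Nil wmon_Nil)

text \<open>In row \<open>id\<close> the matrix is q^{l(w)/2} on \<SS>_J and 0 elsewhere, which
  cancels the scaling in \<open>Tnorm\<close> and leaves the definition of \<open>C\<close>. The
  other rows follow by multiplying on the left by scaled generators and comparing with
  \<open>star_matrix_commute\<close>.\<close>

lemma Tnorm_mult_C:
  assumes J: "1 \<le> a" "a \<le> b" "b \<le> n" and v: "v \<in> perms n"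
  shows "Tnorm v * C (a, b) \<approx>
    (\<Sum>w\<in>perms n. scalar (star_matrix (a, b) (one_line n v) (one_line n w)) * Tnorm w)"
  using v
proof (induction rule: perms_induct)
  case id
  have star_id: "star_inv (a, b) (one_line n id) = 0"
    using star_inv_interval_perm[OF J permutes_id] by (simp add: perm_length_id)
  have "C (a, b) = (\<Sum>w\<in>perms n. if w permutes {a..b} then T w else 0)"
    unfolding C_def using interval_perms_subset[OF J(1,3)]
    by (subst sum.inter_filter[symmetric, OF finite_perms])
      (auto simp: interval_perms_eq[OF J(1,3)] intro!: sum.cong)
  also have "\<dots> = (\<Sum>w\<in>perms n. scalar (star_matrix (a, b) (one_line n id) (one_line n w)) * Tnorm w)"
  proof (intro sum.cong refl)
    fix w assume w: "w \<in> perms n"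
    show "(if w permutes {a..b} then T w else 0) =
        scalar (star_matrix (a, b) (one_line n id) (one_line n w)) * Tnorm w"
      using star_inv_interval_perm[OF J, of w]
      by (simp add: star_matrix_def same_block_one_line_id[OF J w] star_id scalar_0 Tnorm_def
          qhalf_mult qhalf_0 scalar_1 flip: mult.assoc scalar_mult)
  qed
  finally have "(\<Sum>w\<in>perms n. scalar (star_matrix (a, b) (one_line n id) (one_line n w)) * Tnorm w) =
      1 * C (a, b)"
    by (simp only: mult_1_left)
  then show ?case
    using eqv_mult[OF Tnorm_id eqv_refl[OF C_carrier[OF J(1,3)]]] by (simp only:)
next
  case (ascent v i)
  let ?s = "\<lambda>w. w \<circ> transpose i (i + 1)"
  let ?K = "\<lambda>v w. star_matrix (a, b) (one_line n v) (one_line n w)"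
  let ?e = "\<lambda>w. if w (i + 1) < w i then scalar qdiff * Tnorm w else 0"
  have s: "?s w \<in> perms n" if "w \<in> perms n" for w
    using that ascent(2) by (rule perms_comp_transpose)
  have wi: "scalar (qhalf (-1)) * wmon [i] \<in> free_carrier {1..<n}"
    using ascent(2) by (intro free_carrier_intros) simp
  \<comment> \<open>The step is an ascent of \<open>v\<close>, so no correction term arises on the
    side of the row.\<close>
  have "scalar (qhalf (-1)) * wmon [i] * Tnorm v \<approx> Tnorm (?s v)"
    using Tnorm_mult[OF ascent(1,2)] ascent(3) by simp
  then have "Tnorm (?s v) * C (a, b) \<approx> scalar (qhalf (-1)) * wmon [i] * Tnorm v * C (a, b)"
    by (rule eqv_mult[OF eqv_sym eqv_refl[OF C_carrier[OF J(1,3)]]])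
  also have "\<dots> = scalar (qhalf (-1)) * wmon [i] * (Tnorm v * C (a, b))"
    by (simp only: mult.assoc)
  also have "\<dots> \<approx> scalar (qhalf (-1)) * wmon [i] * (\<Sum>w\<in>perms n. scalar (?K v w) * Tnorm w)"
    by (rule eqv_mult[OF eqv_refl[OF wi] ascent(4)])
  also have "\<dots> = (\<Sum>w\<in>perms n. scalar (?K v w) * (scalar (qhalf (-1)) * wmon [i] * Tnorm w))"
    by (simp only: sum_distrib_left scalar_left_commute)
  also have "\<dots> \<approx> (\<Sum>w\<in>perms n. scalar (?K v w) * (Tnorm (?s w) + ?e w))"
    by (intro eqv_sum eqv_scalar Tnorm_mult ascent(2))
  also have "\<dots> = (\<Sum>w\<in>perms n. scalar (?K v w) * Tnorm (?s w)) +
      (\<Sum>w\<in>perms n. scalar (?K v w) * ?e w)"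
    by (simp only: distrib_left sum.distrib)
  \<comment> \<open>Reindexing by the involution \<open>?s\<close> moves the swap from the basis
    element to the column index.\<close>
  also have "(\<Sum>w\<in>perms n. scalar (?K v w) * Tnorm (?s w)) =
      (\<Sum>w\<in>perms n. scalar (?K v (?s w)) * Tnorm w)"
    by (rule sum.reindex_bij_witness[of _ ?s ?s]) (simp_all only: s comp_transpose_twice)
  also have "\<dots> + (\<Sum>w\<in>perms n. scalar (?K v w) * ?e w) =
      (\<Sum>w\<in>perms n. scalar (?K v (?s w) + (if w (i + 1) < w i then qdiff * ?K v w else 0)) * Tnorm w)"
    unfolding sum.distrib[symmetric]
  proof (intro sum.cong refl)
    fix w
    have "scalar (?K v w) * (scalar qdiff * Tnorm w) = scalar (qdiff * ?K v w) * Tnorm w"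
      by (simp only: mult.commute[of qdiff] scalar_mult mult.assoc)
    then show "scalar (?K v (?s w)) * Tnorm w + scalar (?K v w) * ?e w =
        scalar (?K v (?s w) + (if w (i + 1) < w i then qdiff * ?K v w else 0)) * Tnorm w"
      by (cases "w (i + 1) < w i") (simp_all only: if_True if_False scalar_add distrib_right
          mult_zero_right add_0_right simp_thms)
  qed
  also have "\<dots> = (\<Sum>w\<in>perms n. scalar (?K (?s v) w) * Tnorm w)"
  proof (intro sum.cong refl arg_cong2[of _ _ _ _ "(*)"] arg_cong[of _ _ scalar])
    fix w assume w: "w \<in> perms n"
    obtain p where p: "i = Suc p"
      using ascent(2) by (cases i) auto
    have pn: "Suc p < n"
      using ascent(2) p by auto
    have dist: "distinct (one_line n u)" if "u \<in> perms n" for u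
      using one_linesD(2)[OF one_line_in[OF that]] .
    have nth: "one_line n u ! Suc p < one_line n u ! p \<longleftrightarrow> u (i + 1) < u i" for u
      using pn p by (simp add: nth_one_line)
    have sw: "one_line n (?s u) = swap_at p (one_line n u)" for u
      using one_line_comp_transpose[of i n u] ascent(2) p by auto
    show "?K v (?s w) + (if w (i + 1) < w i then qdiff * ?K v w else 0) = ?K (?s v) w"
      using star_matrix_commute[of p "one_line n v" "one_line n w" "(a, b)"]
        dist[OF ascent(1)] dist[OF w] pn ascent(3) unfolding sw nth by (simp add: p)
  qed
  finally show ?case .
qed

lemma prod_C_eqv:
  assumes "\<forall>(a, b)\<in>set Js. 1 \<le> a \<and> a \<le> b \<and> b \<le> n"
  shows "prod_list (map C Js) \<approx>
    (\<Sum>w\<in>perms n. scalar (transfer n (rev Js) (one_line n id) (one_line n w)) * Tnorm w)"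
  using assms
proof (induction Js rule: rev_induct)
  case Nil
  have "inj_on (one_line n) (perms n)"
    using bij_one_line bij_betw_def by blast
  then have "(\<Sum>w\<in>perms n. scalar (transfer n (rev []) (one_line n id) (one_line n w)) * Tnorm w) =
      (\<Sum>w\<in>perms n. if id = w then Tnorm w else 0)"
    by (intro sum.cong refl)
      (auto simp: inj_on_eq_iff[OF _ id_perms] scalar_0 scalar_1)
  also have "\<dots> = Tnorm id"
    by (simp add: finite_perms id_perms)
  finally show ?case
    using eqv_sym[OF Tnorm_id] by (simp only: list.map prod_list.Nil)
next
  case (snoc J Js)
  obtain a b where J: "J = (a, b)" "1 \<le> a" "a \<le> b" "b \<le> n"
    using snoc.prems by (cases J) auto
  let ?t = "\<lambda>w. transfer n (rev Js) (one_line n id) (one_line n w)"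
  let ?K = "\<lambda>v w. star_matrix J (one_line n v) (one_line n w)"
  have "prod_list (map C (Js @ [J])) = prod_list (map C Js) * C J"
    by simp
  also have "\<dots> \<approx> (\<Sum>v\<in>perms n. scalar (?t v) * Tnorm v) * C J"
    unfolding J(1)
    by (rule eqv_mult[OF snoc.IH eqv_refl[OF C_carrier[OF J(2,4)]]]) (use snoc.prems in auto)
  also have "\<dots> = (\<Sum>v\<in>perms n. scalar (?t v) * (Tnorm v * C J))"
    by (simp only: sum_distrib_right mult.assoc)
  also have "\<dots> \<approx> (\<Sum>v\<in>perms n. scalar (?t v) * (\<Sum>w\<in>perms n. scalar (?K v w) * Tnorm w))"
    unfolding J(1) by (intro eqv_sum eqv_scalar Tnorm_mult_C J)
  also have "\<dots> = (\<Sum>v\<in>perms n. \<Sum>w\<in>perms n. scalar (?t v * ?K v w) * Tnorm w)"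
    by (simp only: sum_distrib_left scalar_mult mult.assoc)
  also have "\<dots> = (\<Sum>w\<in>perms n. scalar (\<Sum>v\<in>perms n. ?t v * ?K v w) * Tnorm w)"
    by (subst sum.swap) (simp only: sum_distrib_right scalar_sum)
  also have "\<dots> = (\<Sum>w\<in>perms n. scalar (transfer n (rev (Js @ [J])) (one_line n id) (one_line n w)) * Tnorm w)"
  proof (intro sum.cong refl arg_cong2[of _ _ _ _ "(*)"] arg_cong[of _ _ scalar])
    fix w
    \<comment> \<open>\<open>transfer\<close> sums over lists; the bijection \<open>one_line\<close>
      turns this into the sum over permutations.\<close>
    show "(\<Sum>v\<in>perms n. ?t v * ?K v w) = transfer n (rev (Js @ [J])) (one_line n id) (one_line n w)"
      using sum.reindex_bij_betw[OF bij_one_line[of n], of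
          "\<lambda>vs. transfer n (rev Js) (one_line n id) vs * star_matrix J vs (one_line n w)"] by simp
  qed
  finally show ?case .
qed

lemma theta_prod_C_tilde:
  assumes "\<forall>(a, b)\<in>set Js. 1 \<le> a \<and> a \<le> b \<and> b \<le> n" and "linear_functional (hecke n) \<theta>"
  shows "\<theta> (list_mult (hecke n) (map (C_tilde n) Js)) =
    (\<Sum>w\<in>perms n. qhalf (- int (perm_length n w)) * \<theta> (hecke_T n w) *
      transfer n (rev Js) (one_line n id) (one_line n w))"
proof -
  let ?t = "\<lambda>w. transfer n (rev Js) (one_line n id) (one_line n w)"
  have "list_mult (hecke n) (map (C_tilde n) Js) = proj (prod_list (map C Js))"
    unfolding hecke_def by (rule list_mult_proj) (use assms(1) C_carrier C_tilde_eq in \<open>fast\<close>)+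
  also have "\<dots> = proj (\<Sum>w\<in>perms n. scalar (?t w) * Tnorm w)"
    by (rule eqv_proj[OF prod_C_eqv[OF assms(1)]])
  also have "\<dots> = proj (\<Sum>w\<in>perms n. scalar (?t w * qhalf (- int (perm_length n w))) * T w)"
    by (simp only: Tnorm_def scalar_mult mult.assoc)
  finally have "\<theta> (list_mult (hecke n) (map (C_tilde n) Js)) =
      (\<Sum>w\<in>perms n. ?t w * qhalf (- int (perm_length n w)) * \<theta> (proj (T w)))"
    using assms(2) linear_functional_sum[of \<theta> "perms n" T] finite_perms T_carrier
    by (simp add: hecke_def)
  then show ?thesis
    by (simp add: hecke_T_eq mult_ac)
qed

end

section \<open>The quantum matrix bialgebra\<close>

text \<open>Rewrite rules that evaluate a functional on a relation standing between two words, the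
  form required by \<open>lin_eq_of_eqv\<close>.\<close>

lemma lin_context:
  shows "lin \<phi> (wmon us * wmon xs * wmon vs) = \<phi> (us @ xs @ vs)"
    and "lin \<phi> (wmon us * (scalar c * f) * wmon vs) = c * lin \<phi> (wmon us * f * wmon vs)"
    and "lin \<phi> (wmon us * (f + g) * wmon vs) =
      lin \<phi> (wmon us * f * wmon vs) + lin \<phi> (wmon us * g * wmon vs)"
    and "lin \<phi> (wmon us * (f - g) * wmon vs) =
      lin \<phi> (wmon us * f * wmon vs) - lin \<phi> (wmon us * g * wmon vs)"
  by (simp_all add: wmon_mult lin_wmon scalar_left_commute mult.assoc lin_scalar
      algebra_simps lin_add lin_diff)

lemma qmat_relations_carrier: "qmat_relations n \<subseteq> free_carrier ({1..n} \<times> {1..n})"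
  unfolding qmat_relations_def
  by (intro Un_least subsetI; clarify) (intro free_carrier_intros; simp)+

locale qmat_algebra = presentation "{1..n} \<times> {1..n}" "qmat_relations n" for n :: nat
begin

text \<open>A word is a list of pairs of a row and a column index. A matrix indexed by permutations
  is extended to all words: x^{u,w} receives the entry at u and w, and a word not of this form
  receives \<open>0\<close>.\<close>

definition matching :: "(nat list \<Rightarrow> nat list \<Rightarrow> laurent) \<Rightarrow> (nat \<times> nat) list \<Rightarrow> laurent" where
  "matching \<tau> ps =
    (if map fst ps \<in> one_lines n \<and> map snd ps \<in> one_lines n then \<tau> (map fst ps) (map snd ps) else 0)"

text \<open>The case \<open>k < l\<close> is the relation for commuting generators, the case
  \<open>l < k\<close> the one with a correction term; \<open>transfer_swap\<close> covers both at
  once.\<close>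

lemma matching_swap:
  assumes "i < j" "k \<noteq> l"
  shows "matching (transfer n Js) (us @ [(j, k), (i, l)] @ vs) =
    matching (transfer n Js) (us @ [(i, l), (j, k)] @ vs) +
    (if l < k then qdiff * matching (transfer n Js) (us @ [(i, k), (j, l)] @ vs) else 0)"
proof -
  let ?us = "map fst (us @ [(j, k), (i, l)] @ vs)" and ?ws = "map snd (us @ [(j, k), (i, l)] @ vs)"
  let ?p = "length us"
  have sw: "map fst (us @ [(i, l), (j, k)] @ vs) = swap_at ?p ?us"
    "map snd (us @ [(i, l), (j, k)] @ vs) = swap_at ?p ?ws"
    "map fst (us @ [(i, k), (j, l)] @ vs) = swap_at ?p ?us"
    "map snd (us @ [(i, k), (j, l)] @ vs) = ?ws"
    by (simp_all add: swap_at_append)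
  have len: "Suc ?p < length ?us" "Suc ?p < length ?ws"
    by simp_all
  have mem: "swap_at ?p xs \<in> one_lines n \<longleftrightarrow> xs \<in> one_lines n" if "Suc ?p < length xs" for xs
    unfolding one_lines_def mem_Collect_eq mset_swap_at[OF that] ..
  show ?thesis
  proof (cases "?us \<in> one_lines n \<and> ?ws \<in> one_lines n")
    case True
    have "Suc ?p < n"
      using len(1) one_linesD(1)[of ?us n] True by linarith
    moreover have "?us ! Suc ?p < ?us ! ?p" "?ws ! Suc ?p < ?ws ! ?p \<longleftrightarrow> l < k"
      using assms by (simp_all add: nth_append)
    ultimately have "transfer n Js ?us ?ws = transfer n Js (swap_at ?p ?us) (swap_at ?p ?ws) +
        (if l < k then qdiff * transfer n Js (swap_at ?p ?us) ?ws else 0)"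
      using transfer_swap[of ?us n ?ws ?p Js] True by simp
    then show ?thesis
      using True unfolding matching_def sw mem[OF len(1)] mem[OF len(2)]
      by (simp only: simp_thms if_True)
  next
    case False
    then have "matching (transfer n Js) (us @ [(j, k), (i, l)] @ vs) = 0"
      "matching (transfer n Js) (us @ [(i, l), (j, k)] @ vs) = 0"
      "matching (transfer n Js) (us @ [(i, k), (j, l)] @ vs) = 0"
      unfolding matching_def sw mem[OF len(1)] mem[OF len(2)] by (simp_all only: if_False)
    then show ?thesis
      by simp
  qed
qed

text \<open>The relations that only produce a factor q^{1/2} involve a repeated row or column index,
  and a word containing them cannot have permutations on both sides.\<close>

lemma matching_repeated:
  "matching \<tau> (us @ [(i, k), (i, l)] @ vs) = 0" "matching \<tau> (us @ [(i, k), (j, k)] @ vs) = 0"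
  by (auto simp: matching_def dest!: one_linesD(2))

lemma matching_vanishes:
  assumes "r \<in> qmat_relations n"
  shows "lin (matching (transfer n Js)) (wmon us * r * wmon vs) = 0"
  using assms unfolding qmat_relations_def
proof (elim UnE CollectE exE conjE)
  fix i k l
  assume "r = var (i, l) * var (i, k) - scalar (qhalf 1) * var (i, k) * var (i, l)"
  then have r: "r = wmon [(i, l), (i, k)] - scalar (qhalf 1) * wmon [(i, k), (i, l)]"
    by (simp only: var_wmon wmon_mult mult.assoc append_Cons append_Nil)
  show ?thesis
    unfolding r lin_context matching_repeated by simp
next
  fix i j k
  assume "r = var (j, k) * var (i, k) - scalar (qhalf 1) * var (i, k) * var (j, k)"
  then have r: "r = wmon [(j, k), (i, k)] - scalar (qhalf 1) * wmon [(i, k), (j, k)]"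
    by (simp only: var_wmon wmon_mult mult.assoc append_Cons append_Nil)
  show ?thesis
    unfolding r lin_context matching_repeated by simp
next
  fix i j k l
  assume "i < j" "k < l" and "r = var (j, k) * var (i, l) - var (i, l) * var (j, k)"
  then have r: "r = wmon [(j, k), (i, l)] - wmon [(i, l), (j, k)]"
    by (simp only: var_wmon wmon_mult append_Cons append_Nil)
  show ?thesis
    unfolding r lin_context using matching_swap[of i j k l Js us vs] \<open>i < j\<close> \<open>k < l\<close> by simp
next
  fix i j k l
  assume "i < j" "k < l" and "r = var (j, l) * var (i, k) -
    (var (i, k) * var (j, l) + scalar qdiff * var (i, l) * var (j, k))"
  then have r: "r = wmon [(j, l), (i, k)] -
      (wmon [(i, k), (j, l)] + scalar qdiff * wmon [(i, l), (j, k)])"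
    by (simp only: var_wmon wmon_mult mult.assoc append_Cons append_Nil)
  show ?thesis
    unfolding r lin_context using matching_swap[of i j l k Js us vs] \<open>i < j\<close> \<open>k < l\<close> by simp
qed

definition x_word :: "(nat \<Rightarrow> nat) \<Rightarrow> (nat \<Rightarrow> nat) \<Rightarrow> (nat \<times> nat) free_alg" where
  "x_word u w = wmon (map (\<lambda>i. (u i, w i)) [1..<n+1])"

lemma matching_x_word:
  assumes "w \<in> perms n"
  shows "lin (matching \<tau>) (x_word id w) = \<tau> (one_line n id) (one_line n w)"
proof -
  have "map fst (map (\<lambda>i. (id i, w i)) [1..<n+1]) = one_line n id"
    "map snd (map (\<lambda>i. (id i, w i)) [1..<n+1]) = one_line n w"
    unfolding one_line_def map_map o_def fst_conv snd_conv by (rule refl)+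
  then show ?thesis
    unfolding x_word_def lin_wmon matching_def
    using one_line_in[OF assms] one_line_in[OF id_perms] by (simp only: simp_thms if_True)
qed

lemma
  assumes "u \<in> perms n" "w \<in> perms n"
  shows x_word_carrier: "x_word u w \<in> free_carrier ({1..n} \<times> {1..n})"
    and x_mon_eq: "x_mon n u w = proj (x_word u w)"
proof -
  have "u i \<in> {1..n} \<and> w i \<in> {1..n}" if "i \<in> {1..n}" for i
    using assms permutes_in_image[of u "{1..n}" i] permutes_in_image[of w "{1..n}" i] that
    unfolding perms_def by blast
  then have s: "set (map (\<lambda>i. (u i, w i)) [1..<n+1]) \<subseteq> {1..n} \<times> {1..n}"
    unfolding set_map set_upt_Suc_1 by blast
  show "x_word u w \<in> free_carrier ({1..n} \<times> {1..n})"
    unfolding x_word_def by (rule free_carrier_wmon[OF s])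
  have "map (\<lambda>i. qmat_gen n (u i) (w i)) [1..<n+1] =
      map (generator ({1..n} \<times> {1..n}) (qmat_relations n)) (map (\<lambda>i. (u i, w i)) [1..<n+1])"
    unfolding map_map o_def qmat_gen_def ..
  then show "x_mon n u w = proj (x_word u w)"
    unfolding x_mon_def qmat_def x_word_def by (simp only: list_mult_generator[OF s])
qed

lemma finsum_x_mon:
  assumes "finite A" "\<And>a. a \<in> A \<Longrightarrow> u a \<in> perms n" "\<And>a. a \<in> A \<Longrightarrow> w a \<in> perms n"
  shows "(\<Oplus>\<^bsub>qmat n\<^esub>a\<in>A. c a \<odot>\<^bsub>qmat n\<^esub> x_mon n (u a) (w a)) =
    proj (\<Sum>a\<in>A. scalar (c a) * x_word (u a) (w a))"
  unfolding qmat_def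
proof (rule finsum_proj'[OF assms(1)])
  fix a assume "a \<in> A"
  then have uw: "u a \<in> perms n" "w a \<in> perms n"
    using assms by auto
  show "scalar (c a) * x_word (u a) (w a) \<in> free_carrier ({1..n} \<times> {1..n})"
    by (intro free_carrier_intros x_word_carrier uw)
  show "c a \<odot>\<^bsub>presented_algebra ({1..n} \<times> {1..n}) (qmat_relations n)\<^esub> x_mon n (u a) (w a) =
      proj (scalar (c a) * x_word (u a) (w a))"
    unfolding x_mon_eq[OF uw] by (rule proj_smult[OF x_word_carrier[OF uw]])
qed

text \<open>
  Any choice of coordinates gives the same value because \<^const>\<open>matching\<close> of the transfer matrix
  vanishes on the relations; this replaces the linear independence of the monomials.
\<close>

lemma sigma_Imm:
  assumes z: "\<And>w. w \<in> perms n \<Longrightarrow> z_coeff Js (list_mult (Z_alg Js) (map (\<lambda>i. B i (w i)) [1..<n+1])) =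
    transfer n (rev Js) (one_line n id) (one_line n w)"
  shows "sigma n Js B (Imm n \<theta>) = (\<Sum>w\<in>perms n. qhalf (- int (perm_length n w)) * \<theta> (hecke_T n w) *
    transfer n (rev Js) (one_line n id) (one_line n w))"
proof -
  let ?t = "\<lambda>w. transfer n (rev Js) (one_line n id) (one_line n w)"
  let ?S = "\<lambda>c. \<Sum>w\<in>perms n. scalar (c w) * x_word id w"
  define a where "a w = qhalf (- int (perm_length n w)) * \<theta> (hecke_T n w)" for w
  have S: "(\<Oplus>\<^bsub>qmat n\<^esub>w\<in>perms n. c w \<odot>\<^bsub>qmat n\<^esub> x_mon n id w) = proj (?S c)" for c
    using finsum_x_mon[of "perms n" "\<lambda>_. id" "\<lambda>w. w" c] finite_perms id_perms by blast
  have S_carrier: "?S c \<in> free_carrier ({1..n} \<times> {1..n})" for c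
    by (intro free_carrier_intros x_word_carrier id_perms)
  have lin_S: "lin (matching (transfer n (rev Js))) (?S c) = (\<Sum>w\<in>perms n. c w * ?t w)" for c
    unfolding lin_sum lin_scalar by (intro sum.cong refl) (simp only: matching_x_word)
  have Imm: "Imm n \<theta> = proj (?S a)"
    unfolding Imm_def a_def[symmetric] by (rule S)
  \<comment> \<open>\<open>sigma\<close> is restricted to \<open>immanant_space\<close>, so
    membership has to be exhibited: the coefficients are supported on the pairs with first entry
    \<open>id\<close>.\<close>
  have "Imm n \<theta> = (\<Oplus>\<^bsub>qmat n\<^esub>p\<in>perms n \<times> perms n.
      (if fst p = id then a (snd p) else 0) \<odot>\<^bsub>qmat n\<^esub> x_mon n (fst p) (snd p))"
  proof -
    have "(\<Oplus>\<^bsub>qmat n\<^esub>p\<in>perms n \<times> perms n.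
        (if fst p = id then a (snd p) else 0) \<odot>\<^bsub>qmat n\<^esub> x_mon n (fst p) (snd p)) =
      proj (\<Sum>p\<in>perms n \<times> perms n. scalar (if fst p = id then a (snd p) else 0) * x_word (fst p) (snd p))"
      by (rule finsum_x_mon) (use finite_perms in auto)
    also have "(\<Sum>p\<in>perms n \<times> perms n. scalar (if fst p = id then a (snd p) else 0) * x_word (fst p) (snd p)) =
        (\<Sum>p\<in>Pair id ` perms n. scalar (if fst p = id then a (snd p) else 0) * x_word (fst p) (snd p))"
      by (rule sum.mono_neutral_right) (use finite_perms id_perms in \<open>auto simp: scalar_0\<close>)
    also have "\<dots> = ?S a"
      by (subst sum.reindex) (auto simp: inj_on_def)
    finally show ?thesis
      by (simp only: Imm)
  qed
  then have mem: "Imm n \<theta> \<in> immanant_space n"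
    unfolding immanant_space_def
    by (intro CollectI exI[of _ "\<lambda>p. if fst p = id then a (snd p) else 0"] conjI TrueI)
  let ?P = "\<lambda>c. Imm n \<theta> = (\<Oplus>\<^bsub>qmat n\<^esub>w\<in>perms n. c w \<odot>\<^bsub>qmat n\<^esub> x_mon n id w)"
  define c where "c = (SOME c. ?P c)"
  have "?P a"
    unfolding S by (rule Imm)
  then have "?P c"
    unfolding c_def by (rule someI[of ?P])
  then have "proj (?S c) = proj (?S a)"
    unfolding S Imm by simp
  then have "eqv (?S c) (?S a)"
    by (simp only: proj_eq_iff[OF S_carrier S_carrier])
  then have "(\<Sum>w\<in>perms n. c w * ?t w) = (\<Sum>w\<in>perms n. a w * ?t w)"
    using lin_eq_of_eqv[OF matching_vanishes] unfolding lin_S[symmetric] by blast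
  moreover have "sigma n Js B (Imm n \<theta>) = (\<Sum>w\<in>perms n. c w * ?t w)"
    unfolding sigma_def restrict_apply'[OF mem] c_def[symmetric] Let_def
    by (intro sum.cong refl) (simp only: z)
  ultimately show ?thesis
    unfolding a_def by simp
qed

end

section \<open>Normal ordering of the edge weights\<close>

text \<open>Since \<open>snd x\<close> is the layer \<open>(p, k)\<close>, only pairs within one
  layer count; exchanging indeterminates of different layers costs no power of q.\<close>

fun z_inv :: "(nat \<times> nat \<times> nat) list \<Rightarrow> nat" where
  "z_inv [] = 0"
| "z_inv (x # xs) = length (filter (\<lambda>y. snd y = snd x \<and> fst y < fst x) xs) + z_inv xs"

text \<open>The coefficient that the ordered monomial with content \<open>M\<close> has in the
  normally ordered form of the word \<open>xs\<close>.\<close>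

definition z_fun :: "(nat \<times> nat \<times> nat) multiset \<Rightarrow> (nat \<times> nat \<times> nat) list \<Rightarrow> laurent" where
  "z_fun M xs = (if mset xs = M then qhalf (int (z_inv xs)) else 0)"

lemma z_inv_swap:
  assumes "snd x = snd y" "fst y < fst x"
  shows "z_inv (us @ x # y # vs) = Suc (z_inv (us @ y # x # vs))"
  using assms by (induction us) auto

lemma z_inv_swap_commuting: "snd x \<noteq> snd y \<Longrightarrow> z_inv (us @ x # y # vs) = z_inv (us @ y # x # vs)"
  by (induction us) auto

lemma z_fun_swap: "snd x = snd y \<Longrightarrow> fst y < fst x \<Longrightarrow>
    z_fun M (us @ [x, y] @ vs) = qhalf 1 * z_fun M (us @ [y, x] @ vs)"
  by (simp add: z_fun_def z_inv_swap qhalf_mult add_mset_commute)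

lemma z_fun_swap_commuting: "snd x \<noteq> snd y \<Longrightarrow> z_fun M (us @ [x, y] @ vs) = z_fun M (us @ [y, x] @ vs)"
  by (simp add: z_fun_def z_inv_swap_commuting add_mset_commute)

text \<open>The order is lexicographic in \<open>(h, p, k)\<close>, so within a layer it is the
  order of \<open>h\<close>.\<close>

lemma z_inv_sorted: "sorted xs \<Longrightarrow> z_inv xs = 0"
proof (induction xs)
  case (Cons x xs)
  have "\<not> (snd y = snd x \<and> fst y < fst x)" if "y \<in> set xs" for y
    using Cons.prems that by (cases x; cases y) fastforce
  then show ?case
    using Cons by (simp add: filter_empty_conv)
qed simp

lemma finite_z_index: "finite (z_index Js)"
proof -
  have "z_index Js \<subseteq> (\<Union>p\<in>{1..length Js}. {..snd (Js ! (p - 1))} \<times> {p} \<times> {1, 2})"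
    by (auto simp: z_index_def)
  then show ?thesis
    by (rule finite_subset) auto
qed

lemma z_relations_carrier: "z_relations Js \<subseteq> free_carrier (z_index Js)"
  unfolding z_relations_def
  by (intro Un_least subsetI; clarify) (intro free_carrier_intros; assumption)+

locale edge_algebra = presentation "z_index Js" "z_relations Js" for Js :: "(nat \<times> nat) list"
begin

abbreviation edge_eqv (infix \<open>\<approx>\<close> 50) where
  "f \<approx> g \<equiv> eqv f g"

lemma z_fun_vanishes:
  assumes "r \<in> z_relations Js"
  shows "lin (z_fun M) (wmon us * r * wmon vs) = 0"
  using assms unfolding z_relations_def
proof (elim UnE CollectE exE conjE)
  fix h1 p1 k1 h2 p2 k2
  assume ne: "p1 \<noteq> p2 \<or> k1 \<noteq> k2" and "r = var (h2, p2, k2) * var (h1, p1, k1) - var (h1, p1, k1) * var (h2, p2, k2)"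
  then have r: "r = wmon [(h2, p2, k2), (h1, p1, k1)] - wmon [(h1, p1, k1), (h2, p2, k2)]"
    by (simp only: var_wmon wmon_mult append_Cons append_Nil)
  show ?thesis
    unfolding r lin_context using ne by (subst z_fun_swap_commuting) auto
next
  fix h1 h2 p k
  assume lt: "h1 < h2" and "r = var (h2, p, k) * var (h1, p, k) - scalar (qhalf 1) * var (h1, p, k) * var (h2, p, k)"
  then have r: "r = wmon [(h2, p, k), (h1, p, k)] - scalar (qhalf 1) * wmon [(h1, p, k), (h2, p, k)]"
    by (simp only: var_wmon wmon_mult mult.assoc append_Cons append_Nil)
  show ?thesis
    unfolding r lin_context using lt by (subst z_fun_swap) auto
qed

lemma swap_eqv:
  assumes "x \<in> z_index Js" "y \<in> z_index Js" "y < x"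
  shows "wmon [x, y] \<approx> scalar (qhalf (if snd y = snd x \<and> fst y < fst x then 1 else 0)) * wmon [y, x]"
proof -
  obtain h1 p1 k1 h2 p2 k2 where x: "x = (h2, p2, k2)" and y: "y = (h1, p1, k1)"
    by (cases x; cases y) auto
  show ?thesis
  proof (cases "snd y = snd x")
    case True
    then have lt: "h1 < h2" and pk: "p1 = p2" "k1 = k2"
      using assms(3) x y by auto
    have "var (h2, p2, k2) * var (h1, p2, k2) - scalar (qhalf 1) * var (h1, p2, k2) * var (h2, p2, k2)
        \<in> z_relations Js"
      using assms(1,2) lt unfolding x y pk z_relations_def by blast
    then have "wmon [x, y] - scalar (qhalf 1) * wmon [y, x] \<in> z_relations Js"
      unfolding x y pk by (simp only: var_wmon wmon_mult mult.assoc append_Cons append_Nil)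
    then have "wmon [x, y] \<approx> scalar (qhalf 1) * wmon [y, x]"
      by (rule relation_eqv) (use assms in \<open>auto intro!: free_carrier_intros\<close>)
    then show ?thesis
      using lt pk x y by simp
  next
    case False
    then have ne: "p1 \<noteq> p2 \<or> k1 \<noteq> k2"
      using x y by auto
    have "var (h2, p2, k2) * var (h1, p1, k1) - var (h1, p1, k1) * var (h2, p2, k2) \<in> z_relations Js"
      using assms(1,2) ne unfolding x y z_relations_def by blast
    then have "wmon [x, y] - wmon [y, x] \<in> z_relations Js"
      unfolding x y by (simp only: var_wmon wmon_mult append_Cons append_Nil)
    then have "wmon [x, y] \<approx> wmon [y, x]"
      by (rule relation_eqv) (use assms in \<open>auto intro!: free_carrier_intros\<close>)
    then show ?thesis
      using False by (simp add: qhalf_0 scalar_1)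
  qed
qed

text \<open>One step of insertion sort: \<open>x\<close> moves right past smaller entries only, and
  each of them in its own layer costs a factor q^{1/2}. The entries it stops in front of are not
  smaller, hence are not counted.\<close>

lemma insort_eqv:
  assumes "set (x # xs) \<subseteq> z_index Js" "sorted xs"
  shows "wmon (x # xs) \<approx> scalar (qhalf (int (length (filter (\<lambda>y. snd y = snd x \<and> fst y < fst x) xs)))) *
    wmon (insort x xs)"
  using assms
proof (induction xs)
  case Nil
  then show ?case
    using eqv_refl[OF free_carrier_wmon[of "[x]"]] by (simp add: qhalf_0 scalar_1)
next
  case (Cons y ys)
  let ?N = "\<lambda>ys. int (length (filter (\<lambda>y. snd y = snd x \<and> fst y < fst x) ys))"
  show ?case
  proof (cases "x \<le> y")
    case True
    have "\<not> (snd z = snd x \<and> fst z < fst x)" if "z \<in> set (y # ys)" for z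
    proof -
      have "x \<le> z"
        using Cons.prems(2) True that by auto
      then show ?thesis
        by (cases x; cases z) auto
    qed
    then have "filter (\<lambda>y. snd y = snd x \<and> fst y < fst x) (y # ys) = []"
      by (simp only: filter_empty_conv) blast
    then have "scalar (qhalf (?N (y # ys))) = (1 :: (nat \<times> nat \<times> nat) free_alg)"
      by (simp only: list.size of_nat_0 qhalf_0 scalar_1)
    moreover have "insort x (y # ys) = x # y # ys"
      using True by simp
    ultimately show ?thesis
      using eqv_refl[OF free_carrier_wmon[OF Cons.prems(1)]] by (simp only: mult_1_left)
  next
    case False
    let ?e = "if snd y = snd x \<and> fst y < fst x then 1 else 0 :: int"
    have N: "?N (y # ys) = ?e + ?N ys"
      by simp
    have xy: "x \<in> z_index Js" "y \<in> z_index Js" "y < x" and ys: "set ys \<subseteq> z_index Js"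
      using Cons.prems False by auto
    have "wmon (x # y # ys) = wmon [x, y] * wmon ys"
      by (simp add: wmon_mult)
    also have "\<dots> \<approx> scalar (qhalf ?e) * wmon [y, x] * wmon ys"
      by (rule eqv_mult[OF swap_eqv[OF xy] eqv_refl[OF free_carrier_wmon[OF ys]]])
    also have "\<dots> = scalar (qhalf ?e) * wmon [y] * wmon (x # ys)"
      by (simp add: wmon_mult mult.assoc)
    also have "\<dots> \<approx> scalar (qhalf ?e) * wmon [y] * (scalar (qhalf (?N ys)) * wmon (insort x ys))"
    proof (rule eqv_mult[OF eqv_refl Cons.IH])
      show "scalar (qhalf ?e) * wmon [y] \<in> free_carrier (z_index Js)"
        by (intro free_carrier_intros) (use xy in simp)
    qed (use Cons.prems in auto)
    also have "\<dots> = scalar (qhalf ?e) * (scalar (qhalf (?N ys)) * (wmon [y] * wmon (insort x ys)))"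
      by (simp only: mult.assoc scalar_left_commute[of "wmon [y]"])
    also have "\<dots> = scalar (qhalf (?e + ?N ys)) * wmon (insort x (y # ys))"
      using False by (simp add: wmon_mult flip: qhalf_mult scalar_mult mult.assoc)
    finally show ?thesis
      unfolding N .
  qed
qed

lemma sort_eqv: "set xs \<subseteq> z_index Js \<Longrightarrow> wmon xs \<approx> scalar (qhalf (int (z_inv xs))) * wmon (sort xs)"
proof (induction xs)
  case Nil
  then show ?case
    using eqv_refl[OF free_carrier_wmon[of "[]"]] by (simp add: qhalf_0 scalar_1)
next
  case (Cons x xs)
  let ?N = "\<lambda>ys. int (length (filter (\<lambda>y. snd y = snd x \<and> fst y < fst x) ys))"
  \<comment> \<open>The count for \<open>x\<close> is independent of the order of the tail and may
    be taken after sorting.\<close>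
  have N: "?N (sort xs) = ?N xs"
    by (simp add: filter_sort)
  have x: "set [x] \<subseteq> z_index Js"
    using Cons.prems by simp
  have "wmon (x # xs) = wmon [x] * wmon xs"
    by (simp add: wmon_mult)
  also have "\<dots> \<approx> wmon [x] * (scalar (qhalf (int (z_inv xs))) * wmon (sort xs))"
    by (rule eqv_mult[OF eqv_refl[OF free_carrier_wmon[OF x]] Cons.IH]) (use Cons.prems in simp)
  also have "\<dots> = scalar (qhalf (int (z_inv xs))) * wmon (x # sort xs)"
    by (simp add: scalar_left_commute wmon_mult)
  also have "\<dots> \<approx> scalar (qhalf (int (z_inv xs))) * (scalar (qhalf (?N (sort xs))) * wmon (insort x (sort xs)))"
    by (rule eqv_scalar[OF insort_eqv]) (use Cons.prems in auto)
  also have "\<dots> = scalar (qhalf (int (z_inv xs) + ?N xs)) * wmon (sort (x # xs))"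
    unfolding N by (simp add: scalar_mult mult.assoc flip: qhalf_mult)
  also have "int (z_inv xs) + ?N xs = int (z_inv (x # xs))"
    by simp
  finally show ?case .
qed

section \<open>Expansion in ordered monomials\<close>

definition combination :: "((nat \<times> nat \<times> nat) list \<Rightarrow>\<^sub>0 laurent) \<Rightarrow> (nat \<times> nat \<times> nat) free_alg" where
  "combination c = (\<Sum>\<mu>\<in>Poly_Mapping.keys c. scalar (Poly_Mapping.lookup c \<mu>) * wmon \<mu>)"

definition normal_form :: "((nat \<times> nat \<times> nat) list \<Rightarrow>\<^sub>0 laurent) \<Rightarrow> bool" where
  "normal_form c \<longleftrightarrow> (\<forall>\<mu>\<in>Poly_Mapping.keys c. sorted \<mu> \<and> set \<mu> \<subseteq> z_index Js)"

lemma combination_carrier: "normal_form c \<Longrightarrow> combination c \<in> free_carrier (z_index Js)"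
  unfolding combination_def normal_form_def
  by (intro free_carrier_sum free_carrier_mult free_carrier_scalar free_carrier_wmon) blast

lemma finsum_combination:
  assumes "normal_form c"
  shows "(\<Oplus>\<^bsub>Z_alg Js\<^esub>\<mu>\<in>Poly_Mapping.keys c.
      Poly_Mapping.lookup c \<mu> \<odot>\<^bsub>Z_alg Js\<^esub> list_mult (Z_alg Js) (map (z_gen Js) \<mu>)) =
    proj (combination c)"
  unfolding Z_alg_def z_gen_def combination_def
proof (rule finsum_proj')
  fix \<mu> assume "\<mu> \<in> Poly_Mapping.keys c"
  then have \<mu>: "set \<mu> \<subseteq> z_index Js"
    using assms unfolding normal_form_def by blast
  show "scalar (Poly_Mapping.lookup c \<mu>) * wmon \<mu> \<in> free_carrier (z_index Js)"
    by (intro free_carrier_intros \<mu>)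
  show "Poly_Mapping.lookup c \<mu> \<odot>\<^bsub>Q\<^esub> list_mult Q (map (generator (z_index Js) (z_relations Js)) \<mu>) =
      proj (scalar (Poly_Mapping.lookup c \<mu>) * wmon \<mu>)"
    unfolding list_mult_generator[OF \<mu>] by (rule proj_smult[OF free_carrier_wmon[OF \<mu>]])
qed simp

lemma normal_form_exists:
  assumes f: "f \<in> free_carrier (z_index Js)"
  shows "\<exists>c. normal_form c \<and> f \<approx> combination c"
proof -
  let ?c = "\<lambda>w. Poly_Mapping.lookup f w * qhalf (int (z_inv (letters w)))"
  define g where "g = (\<Sum>w\<in>Poly_Mapping.keys f. scalar (?c w) * wmon (sort (letters w)))"
  have letters: "set (letters w) \<subseteq> z_index Js" if "w \<in> Poly_Mapping.keys f" for w
    using f that by (simp add: free_algebra_def)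
  have "(\<Sum>w\<in>Poly_Mapping.keys f. scalar (Poly_Mapping.lookup f w) * wmon (letters w)) \<approx>
      (\<Sum>w\<in>Poly_Mapping.keys f. scalar (Poly_Mapping.lookup f w) *
        (scalar (qhalf (int (z_inv (letters w)))) * wmon (sort (letters w))))"
    by (intro eqv_sum eqv_scalar sort_eqv letters)
  then have fg: "f \<approx> g"
    unfolding free_alg_expand[of f, symmetric] g_def scalar_mult mult.assoc .
  have keys_g: "Poly_Mapping.keys g \<subseteq> (\<lambda>w. Word (sort (letters w))) ` Poly_Mapping.keys f"
  proof
    fix v assume "v \<in> Poly_Mapping.keys g"
    then have "(\<Sum>w\<in>Poly_Mapping.keys f. Poly_Mapping.lookup (scalar (?c w) * wmon (sort (letters w))) v) \<noteq> 0"
      by (simp add: g_def in_keys_iff lookup_sum)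
    then obtain w where "w \<in> Poly_Mapping.keys f"
      "Poly_Mapping.lookup (scalar (?c w) * wmon (sort (letters w))) v \<noteq> 0"
      by (meson sum.not_neutral_contains_not_neutral)
    then show "v \<in> (\<lambda>w. Word (sort (letters w))) ` Poly_Mapping.keys f"
      by (auto simp: lookup_scalar_mult wmon_def lookup_single when_def split: if_splits)
  qed
  have inj: "inj Word"
    by (auto simp: inj_def)
  \<comment> \<open>Sorting can merge several words of \<open>f\<close>; forming \<open>g\<close> in
    the free algebra has collected them, and \<open>c\<close> only renames the keys from words to
    lists.\<close>
  define c where "c = Poly_Mapping.map_key Word g"
  have lookup_c: "Poly_Mapping.lookup c \<mu> = Poly_Mapping.lookup g (Word \<mu>)" for \<mu>
    by (simp add: c_def map_key.rep_eq[OF inj])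
  have keys_c: "\<mu> \<in> Poly_Mapping.keys c \<longleftrightarrow> Word \<mu> \<in> Poly_Mapping.keys g" for \<mu>
    by (simp add: in_keys_iff lookup_c)
  have "normal_form c"
    unfolding normal_form_def keys_c
  proof
    fix \<mu> assume "\<mu> \<in> Poly_Mapping.keys c"
    then obtain w where "w \<in> Poly_Mapping.keys f" "\<mu> = sort (letters w)"
      using keys_g keys_c by blast
    then show "sorted \<mu> \<and> set \<mu> \<subseteq> z_index Js"
      using letters by simp
  qed
  moreover have "combination c = g"
  proof -
    have "combination c = (\<Sum>w\<in>Poly_Mapping.keys g. scalar (Poly_Mapping.lookup g w) * wmon (letters w))"
      unfolding combination_def lookup_c
      by (rule sum.reindex_bij_witness[of _ letters Word]) (auto simp: keys_c)
    then show ?thesis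
      unfolding free_alg_expand[of g, symmetric] .
  qed
  ultimately show ?thesis
    using fg by blast
qed

text \<open>The functional for the content of a sorted \<mu> is 1 on \<mu> and 0 on every other
  sorted list, because a sorted list is determined by its content. These are the dual functionals of
  the ordered monomials.\<close>

lemma lookup_normal_form:
  assumes "normal_form c" "sorted \<mu>"
  shows "Poly_Mapping.lookup c \<mu> = lin (z_fun (mset \<mu>)) (combination c)"
proof -
  have "lin (z_fun (mset \<mu>)) (combination c) =
      (\<Sum>\<nu>\<in>Poly_Mapping.keys c. Poly_Mapping.lookup c \<nu> * z_fun (mset \<mu>) \<nu>)"
    unfolding combination_def lin_sum lin_scalar lin_wmon ..
  also have "\<dots> = (\<Sum>\<nu>\<in>Poly_Mapping.keys c. if \<mu> = \<nu> then Poly_Mapping.lookup c \<nu> else 0)"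
  proof (intro sum.cong refl)
    fix \<nu> assume "\<nu> \<in> Poly_Mapping.keys c"
    then have "sorted \<nu>"
      using assms(1) unfolding normal_form_def by blast
    then show "Poly_Mapping.lookup c \<nu> * z_fun (mset \<mu>) \<nu> = (if \<mu> = \<nu> then Poly_Mapping.lookup c \<nu> else 0)"
      using assms(2) properties_for_sort[of \<nu> \<mu>] properties_for_sort[of \<mu> \<mu>]
      by (auto simp: z_fun_def z_inv_sorted qhalf_0)
  qed
  also have "\<dots> = Poly_Mapping.lookup c \<mu>"
    by (simp add: in_keys_iff)
  finally show ?thesis ..
qed

text \<open>Sorting gives an expansion and the dual functionals show that it is unique, which
  justifies the definite description in \<open>z_expansion\<close>. The coefficient of z_G is then
  the value of a functional on any representative.\<close>

lemma z_coeff_proj: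
  assumes f: "f \<in> free_carrier (z_index Js)"
  shows "z_coeff Js (proj f) = lin (z_fun (mset_set (z_index Js))) f"
proof -
  have iff: "(\<forall>\<mu>\<in>Poly_Mapping.keys c. sorted \<mu> \<and> set \<mu> \<subseteq> z_index Js) \<and>
      proj f = (\<Oplus>\<^bsub>Z_alg Js\<^esub>\<mu>\<in>Poly_Mapping.keys c.
        Poly_Mapping.lookup c \<mu> \<odot>\<^bsub>Z_alg Js\<^esub> list_mult (Z_alg Js) (map (z_gen Js) \<mu>)) \<longleftrightarrow>
      normal_form c \<and> f \<approx> combination c" for c
    unfolding normal_form_def[symmetric]
    using finsum_combination[of c] proj_eq_iff[OF f combination_carrier[of c]] by auto
  have coeff: "Poly_Mapping.lookup c \<mu> = lin (z_fun (mset \<mu>)) f"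
    if "normal_form c \<and> f \<approx> combination c" "sorted \<mu>" for c \<mu>
    using lookup_normal_form[of c \<mu>] lin_eq_of_eqv[OF z_fun_vanishes, of f "combination c"] that by simp
  obtain c where c: "normal_form c \<and> f \<approx> combination c"
    using normal_form_exists[OF f] by blast
  have "c' = c" if c': "normal_form c' \<and> f \<approx> combination c'" for c'
  proof (rule poly_mapping_eqI)
    fix \<mu>
    show "Poly_Mapping.lookup c' \<mu> = Poly_Mapping.lookup c \<mu>"
    proof (cases "sorted \<mu>")
      case True
      then show ?thesis
        using coeff[OF c] coeff[OF c'] by simp
    next
      case False
      then have "\<mu> \<notin> Poly_Mapping.keys c" "\<mu> \<notin> Poly_Mapping.keys c'"
        using c c' unfolding normal_form_def by blast+
      then show ?thesis
        by (simp add: in_keys_iff)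
    qed
  qed
  then have "z_expansion Js (proj f) = c"
    unfolding z_expansion_def iff using c by (intro the_equality) blast+
  then show ?thesis
    using coeff[OF c, of "sorted_list_of_set (z_index Js)"] finite_z_index[of Js]
      mset_set_set[of "sorted_list_of_set (z_index Js)"]
    by (simp add: z_coeff_def)
qed

end

section \<open>Paths in star networks\<close>

fun walk :: "'v \<Rightarrow> ('v \<times> 'v) list \<Rightarrow> 'v \<Rightarrow> bool" where
  "walk u [] v \<longleftrightarrow> u = v"
| "walk u (e # es) v \<longleftrightarrow> fst e = u \<and> walk (snd e) es v"

lemma walk_append: "walk u (es @ es') v \<longleftrightarrow> (\<exists>x. walk u es x \<and> walk x es' v)"
  by (induction es arbitrary: u) auto

definition network_arcs :: "nat \<Rightarrow> (nat \<times> nat) list \<Rightarrow> (vertex \<times> vertex) set" where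
  "network_arcs n Js = (\<Union>p\<in>{1..length Js}. star_arcs n p (Js ! (p - 1)))"

text \<open>Columns have even rank and the centre of a star lies between its two columns. The rank
  increases along every arc, so the network is acyclic, and it tells which star an arc belongs
  to.\<close>

fun rank :: "vertex \<Rightarrow> nat" where
  "rank (Boundary p i) = 2 * p"
| "rank (Central p) = 2 * p - 1"

lemma star_arcs_rank:
  assumes "e \<in> star_arcs n p J" "1 \<le> p"
  shows "2 * (p - 1) \<le> rank (fst e)" "rank (fst e) < rank (snd e)" "rank (snd e) \<le> 2 * p"
  using assms by (cases J; auto split: if_splits)+

lemma network_arcs_rank:
  assumes "e \<in> network_arcs n Js"
  shows "rank (fst e) < rank (snd e)" "rank (snd e) \<le> 2 * length Js"
proof -
  obtain p where p: "1 \<le> p" "p \<le> length Js" "e \<in> star_arcs n p (Js ! (p - 1))"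
    using assms by (auto simp: network_arcs_def)
  then show "rank (fst e) < rank (snd e)" "rank (snd e) \<le> 2 * length Js"
    using star_arcs_rank[OF p(3,1)] by auto
qed

lemma network_arcs_snoc:
  "network_arcs n (Js @ [J]) = network_arcs n Js \<union> star_arcs n (Suc (length Js)) J"
proof -
  have "{1..length (Js @ [J])} = insert (Suc (length Js)) {1..length Js}"
    by auto
  then show ?thesis
    by (auto simp: network_arcs_def nth_append split: if_splits)
qed

lemma walk_rank:
  "walk u es v \<Longrightarrow> \<forall>e\<in>set es. rank (fst e) < rank (snd e) \<Longrightarrow>
    rank u \<le> rank v \<and> (\<forall>e\<in>set es. rank u < rank (snd e) \<and> rank (snd e) \<le> rank v)"
proof (induction es arbitrary: u)
  case (Cons e es)
  have u: "rank u < rank (snd e)"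
    using Cons.prems by (metis list.set_intros(1) walk.simps(2))
  have IH: "rank (snd e) \<le> rank v \<and> (\<forall>e'\<in>set es. rank (snd e) < rank (snd e') \<and> rank (snd e') \<le> rank v)"
    by (rule Cons.IH) (use Cons.prems in simp_all)
  have "rank u < rank (snd e') \<and> rank (snd e') \<le> rank v" if "e' \<in> set (e # es)" for e'
  proof (cases "e' = e")
    case False
    then have "e' \<in> set es"
      using that by simp
    then show ?thesis
      using IH u less_trans by blast
  qed (use IH u in simp)
  then show ?case
    using IH u by (meson less_imp_le less_le_trans)
qed simp

text \<open>\<open>apath\<close> asks for distinct vertices; this is automatic, as the rank
  increases along a walk.\<close>

lemma in_paths_iff:
  "es \<in> paths n Js i j \<longleftrightarrow> i \<in> {1..n} \<and> set es \<subseteq> network_arcs n Js \<and>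
    walk (Boundary 0 i) es (Boundary (length Js) j)"
proof -
  interpret pre_digraph "star_network n Js" .
  have ends: "tail (star_network n Js) = fst" "head (star_network n Js) = snd"
    by (simp_all add: star_network_def)
  have cas: "cas u es v \<longleftrightarrow> walk u es v" for u es v
    by (induction es arbitrary: u) (simp_all add: ends)
  have arcs: "arcs (star_network n Js) = network_arcs n Js"
    by (simp add: star_network_def network_arcs_def)
  have star: "Boundary 0 i \<in> star_verts n p J \<Longrightarrow> i \<in> {1..n}" for p J
    by (cases J) (auto split: if_splits)
  have verts: "Boundary 0 i \<in> verts (star_network n Js) \<longleftrightarrow> i \<in> {1..n}"
  proof -
    have "verts (star_network n Js) =
        Boundary 0 ` {1..n} \<union> (\<Union>p\<in>{1..length Js}. star_verts n p (Js ! (p - 1)))"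
      unfolding star_network_def pre_digraph.simps ..
    moreover have "Boundary 0 i \<in> Boundary 0 ` {1..n} \<longleftrightarrow> i \<in> {1..n}"
      by blast
    ultimately show ?thesis
      using star by blast
  qed
  have "set es \<subseteq> network_arcs n Js \<Longrightarrow> walk u es v \<Longrightarrow> distinct (awalk_verts u es)" for u v es
  proof (induction es arbitrary: u)
    case (Cons e es)
    have rank: "\<forall>e\<in>set es. rank (fst e) < rank (snd e)" "rank (fst e) < rank (snd e)"
      using Cons.prems(1) network_arcs_rank(1)[of _ n Js] by auto
    have walk: "walk (snd e) es v" "fst e = u"
      using Cons.prems(2) by auto
    have "\<forall>x\<in>set (awalk_verts (snd e) es). rank (snd e) \<le> rank x"
      unfolding awalk_verts_conv'[OF walk(1)[folded cas]]
      using walk_rank[OF walk(1) rank(1)] walk(1) by (cases es) (auto simp: ends)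
    then show ?case
      using Cons walk rank(2) by (auto simp: ends)
  qed simp
  then show ?thesis
    unfolding paths_def mem_Collect_eq apath_def awalk_def cas arcs verts by blast
qed

section \<open>Cutting off the last star\<close>

definition segment :: "nat \<times> nat \<Rightarrow> nat \<Rightarrow> nat \<Rightarrow> nat \<Rightarrow> (vertex \<times> vertex) list" where
  "segment J p k j = (if fst J < snd J \<and> in_interval J j
    then [(Boundary (p - 1) k, Central p), (Central p, Boundary p j)]
    else [(Boundary (p - 1) k, Boundary p j)])"

text \<open>The sources from which the star of \<open>J\<close> leads to the sink
  \<open>j\<close>.\<close>

definition block_of :: "nat \<Rightarrow> nat \<times> nat \<Rightarrow> nat \<Rightarrow> nat set" where
  "block_of n J j = {k \<in> {1..n}. same_block J k j}"

lemma paths_Nil: "paths n [] i j = (if i \<in> {1..n} \<and> i = j then {[]} else {})"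
  by (auto simp: in_paths_iff network_arcs_def)

text \<open>A path is cut where it enters the last star. Its last arc either goes straight or leaves
  the centre; in the second case the arc before it enters the centre from some source in the
  block.\<close>

lemma paths_snoc:
  assumes J: "J = (a, b)" "1 \<le> a" "a \<le> b" "b \<le> n" and j: "j \<in> {1..n}"
  shows "paths n (Js @ [J]) i j =
    (\<Union>k\<in>block_of n J j. (\<lambda>es. es @ segment J (Suc (length Js)) k j) ` paths n Js i k)"
    (is "_ = ?R")
proof
  let ?m = "Suc (length Js)"
  show "?R \<subseteq> paths n (Js @ [J]) i j"
  proof clarify
    fix k es assume k: "k \<in> block_of n J j" and es: "es \<in> paths n Js i k"
    have "set (segment J ?m k j) \<subseteq> star_arcs n ?m J"
      using k j J by (auto simp: segment_def block_of_def same_block_def in_interval_def split: if_splits)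
    moreover have "walk (Boundary (length Js) k) (segment J ?m k j) (Boundary ?m j)"
      by (simp add: segment_def)
    ultimately show "es @ segment J ?m k j \<in> paths n (Js @ [J]) i j"
      using es by (auto simp: in_paths_iff network_arcs_snoc walk_append)
  qed
  show "paths n (Js @ [J]) i j \<subseteq> ?R"
  proof
    fix es assume es: "es \<in> paths n (Js @ [J]) i j"
    have i: "i \<in> {1..n}" and arcs: "set es \<subseteq> network_arcs n (Js @ [J])"
      and walk: "walk (Boundary 0 i) es (Boundary ?m j)"
      using es by (auto simp: in_paths_iff)
    have rank: "\<forall>e\<in>set es. rank (fst e) < rank (snd e)"
      using arcs network_arcs_rank(1) by blast
    \<comment> \<open>Arcs of the last star end above rank \<open>2 * length Js\<close>, the rank of
      its source column, so a walk that ends in this column cannot contain any of them.\<close>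
    have old: "es' \<in> paths n Js i k"
      if "set es' \<subseteq> set es" "walk (Boundary 0 i) es' (Boundary (length Js) k)" for es' k
    proof -
      have "e \<in> network_arcs n Js" if "e \<in> set es'" for e
      proof (rule ccontr)
        assume "e \<notin> network_arcs n Js"
        then have "e \<in> star_arcs n ?m J"
          using \<open>e \<in> set es'\<close> \<open>set es' \<subseteq> set es\<close> arcs by (auto simp: network_arcs_snoc)
        then have "2 * length Js < rank (snd e)"
          using star_arcs_rank[of e n ?m J] by simp
        moreover have "\<forall>e\<in>set es'. rank (fst e) < rank (snd e)"
          using rank \<open>set es' \<subseteq> set es\<close> by blast
        then have "rank (snd e) \<le> 2 * length Js"
          using walk_rank[OF \<open>walk (Boundary 0 i) es' _\<close>] \<open>e \<in> set es'\<close> by auto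
        ultimately show False
          by simp
      qed
      then show ?thesis
        using i that(2) by (auto simp: in_paths_iff)
    qed
    have "es \<noteq> []"
      using walk by auto
    then obtain es1 e where e: "es = es1 @ [e]"
      by (metis append_butlast_last_id)
    have walk1: "walk (Boundary 0 i) es1 (fst e)" and snd_e: "snd e = Boundary ?m j"
      using walk by (auto simp: e walk_append)
    have "e \<notin> network_arcs n Js"
      using network_arcs_rank(2)[of e n Js] snd_e by auto
    then have "e \<in> star_arcs n ?m J"
      using arcs by (auto simp: e network_arcs_snoc)
    then consider "e = (Boundary (length Js) j, Boundary ?m j)" "\<not> (a < b \<and> in_interval J j)"
      | "e = (Central ?m, Boundary ?m j)" "a < b" "in_interval J j"
      using snd_e J by (auto simp: in_interval_def split: if_splits)
    then show "es \<in> ?R"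
    proof cases
      case 1
      then have "es1 \<in> paths n Js i j"
        using old[of es1 j] walk1 e by auto
      moreover have "es = es1 @ segment J ?m j j"
        using 1 e J by (auto simp: segment_def)
      ultimately show ?thesis
        using j by (auto simp: block_of_def same_block_def)
    next
      case 2
      have "es1 \<noteq> []"
        using walk1 2 by auto
      then obtain es2 e' where e': "es1 = es2 @ [e']"
        by (metis append_butlast_last_id)
      have walk2: "walk (Boundary 0 i) es2 (fst e')" and snd_e': "snd e' = Central ?m"
        using walk1 2 by (auto simp: e' walk_append)
      have "e' \<notin> network_arcs n Js"
        using network_arcs_rank(2)[of e' n Js] snd_e' by auto
      then have "e' \<in> star_arcs n ?m J"
        using arcs by (auto simp: e e' network_arcs_snoc)
      then obtain k where k: "e' = (Boundary (length Js) k, Central ?m)" "a \<le> k" "k \<le> b"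
        using snd_e' J by (auto split: if_splits)
      then have "es2 \<in> paths n Js i k"
        using old[of es2 k] walk2 e e' by auto
      moreover have "es = es2 @ segment J ?m k j"
        using 2 k e e' J by (auto simp: segment_def)
      moreover have "k \<in> block_of n J j"
        using 2 k J by (auto simp: block_of_def same_block_def in_interval_def)
      ultimately show ?thesis
        by blast
    qed
  qed
qed

lemma finite_paths:
  assumes "\<forall>(a, b)\<in>set Js. 1 \<le> a \<and> a \<le> b \<and> b \<le> n" "j \<in> {1..n}"
  shows "finite (paths n Js i j)"
  using assms
proof (induction Js arbitrary: j rule: rev_induct)
  case (snoc J Js)
  obtain a b where J: "J = (a, b)" "1 \<le> a" "a \<le> b" "b \<le> n"
    using snoc.prems by (cases J) auto
  show ?case
    unfolding paths_snoc[OF J snoc.prems(2)]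
    using snoc by (intro finite_UN_I finite_imageI) (auto simp: block_of_def)
qed (simp add: paths_Nil)

lemma sum_paths_snoc:
  assumes Js: "\<forall>(a, b)\<in>set (Js @ [J]). 1 \<le> a \<and> a \<le> b \<and> b \<le> n" and j: "j \<in> {1..n}"
  shows "(\<Sum>es\<in>paths n (Js @ [J]) i j. F es) =
    (\<Sum>k\<in>block_of n J j. \<Sum>es\<in>paths n Js i k. F (es @ segment J (Suc (length Js)) k j))"
proof -
  obtain a b where J: "J = (a, b)" "1 \<le> a" "a \<le> b" "b \<le> n"
    using Js by (cases J) auto
  let ?g = "\<lambda>k es. es @ segment J (Suc (length Js)) k j"
  have fin: "finite (block_of n J j)"
    by (simp add: block_of_def)
  have "(\<Sum>es\<in>paths n (Js @ [J]) i j. F es) = (\<Sum>k\<in>block_of n J j. sum F (?g k ` paths n Js i k))"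
    unfolding paths_snoc[OF J j]
  proof (rule sum.UNION_disjoint[OF fin])
    show "\<forall>k\<in>block_of n J j. finite (?g k ` paths n Js i k)"
      using finite_paths[of Js n] Js by (auto simp: block_of_def)
    \<comment> \<open>The segment records its source \<open>k\<close>, so the sets of paths for
      different \<open>k\<close> are disjoint.\<close>
    show "\<forall>k\<in>block_of n J j. \<forall>k'\<in>block_of n J j. k \<noteq> k' \<longrightarrow>
        ?g k ` paths n Js i k \<inter> ?g k' ` paths n Js i k' = {}"
      by (auto simp: segment_def)
  qed
  also have "\<dots> = (\<Sum>k\<in>block_of n J j. \<Sum>es\<in>paths n Js i k. F (?g k es))"
    by (rule sum.cong[OF refl], subst sum.reindex) (auto simp: inj_on_def)
  finally show ?thesis .
qed

section \<open>Families of paths\<close>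

lemma sum_listset_Cons:
  "(\<Sum>xs\<in>listset (A # As). F xs) = (\<Sum>x\<in>A. \<Sum>xs\<in>listset As. F (x # xs))"
proof -
  have "listset (A # As) = (\<lambda>(x, xs). x # xs) ` (A \<times> listset As)"
    by (auto simp: set_Cons_def)
  then have "(\<Sum>xs\<in>listset (A # As). F xs) = (\<Sum>(x, xs)\<in>A \<times> listset As. F (x # xs))"
    by (simp add: sum.reindex inj_on_def case_prod_unfold)
  then show ?thesis
    by (simp add: sum.cartesian_product)
qed

text \<open>\<open>listset\<close> keeps the factors in their order, as distributivity in a
  noncommutative ring requires.\<close>

lemma prod_list_sum:
  fixes f :: "'a \<Rightarrow> 'b :: semiring_1"
  shows "prod_list (map (\<lambda>A. \<Sum>x\<in>A. f x) As) = (\<Sum>xs\<in>listset As. prod_list (map f xs))"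
proof (induction As)
  case (Cons A As)
  show ?case
    unfolding sum_listset_Cons by (simp add: Cons sum_product)
qed simp

lemma listset_iff: "xs \<in> listset As \<longleftrightarrow> list_all2 (\<in>) xs As"
proof (induction As arbitrary: xs)
  case (Cons A As)
  then show ?case
    by (cases xs) (auto simp: set_Cons_def)
qed simp

lemma finite_listset: "(\<And>A. A \<in> set As \<Longrightarrow> finite A) \<Longrightarrow> finite (listset As)"
proof (induction As)
  case (Cons A As)
  have "listset (A # As) = (\<lambda>(x, xs). x # xs) ` (A \<times> listset As)"
    by (auto simp: set_Cons_def)
  then show ?case
    using Cons by simp
qed simp

text \<open>A decomposition available in each coordinate is applied to all of them at once. In the
  use below \<open>P'\<close> gives paths in the longer network, \<open>P\<close> paths in the
  shorter one, \<open>V\<close> the intermediate points, and \<open>g\<close> appends the last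
  segment.\<close>

lemma sum_listset_refine:
  assumes "length us = length ws"
    and "\<And>u w F. w \<in> set ws \<Longrightarrow> (\<Sum>x\<in>P' u w. F x :: 'c :: comm_monoid_add) = (\<Sum>v\<in>V w. \<Sum>x\<in>P u v. F (g x v w))"
  shows "(\<Sum>xs\<in>listset (map2 P' us ws). (F xs :: 'c)) =
    (\<Sum>vs\<in>listset (map V ws). \<Sum>xs\<in>listset (map2 P us vs). F (map2 (\<lambda>x (v, w). g x v w) xs (zip vs ws)))"
  using assms
proof (induction us ws arbitrary: F rule: list_induct2)
  case Nil
  then show ?case
    by simp
next
  case (Cons u us w ws)
  let ?G = "\<lambda>xs vs. map2 (\<lambda>x (v, w). g x v w) xs (zip vs ws)"
  have "(\<Sum>xs\<in>listset (map2 P' (u # us) (w # ws)). F xs) =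
      (\<Sum>x\<in>P' u w. \<Sum>xs\<in>listset (map2 P' us ws). F (x # xs))"
    unfolding list.map zip_Cons_Cons prod.case sum_listset_Cons ..
  also have "\<dots> = (\<Sum>v\<in>V w. \<Sum>x\<in>P u v. \<Sum>xs\<in>listset (map2 P' us ws). F (g x v w # xs))"
    by (rule Cons.prems) simp
  also have "\<dots> = (\<Sum>v\<in>V w. \<Sum>x\<in>P u v. \<Sum>vs\<in>listset (map V ws). \<Sum>xs\<in>listset (map2 P us vs).
      F (g x v w # ?G xs vs))"
    by (intro sum.cong refl Cons.IH) (use Cons.prems in simp)
  also have "\<dots> = (\<Sum>v\<in>V w. \<Sum>vs\<in>listset (map V ws). \<Sum>x\<in>P u v. \<Sum>xs\<in>listset (map2 P us vs).
      F (g x v w # ?G xs vs))"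
    by (intro sum.cong refl sum.swap)
  also have "\<dots> = (\<Sum>vs\<in>listset (map V (w # ws)). \<Sum>xs\<in>listset (map2 P (u # us) vs).
      F (map2 (\<lambda>x (v, w). g x v w) xs (zip vs (w # ws))))"
    unfolding list.map sum_listset_Cons zip_Cons_Cons prod.case ..
  finally show ?case .
qed

section \<open>The coefficient of the product of all edge weights\<close>

fun edge_word :: "vertex \<times> vertex \<Rightarrow> (nat \<times> nat \<times> nat) list" where
  "edge_word (Boundary _ h, Central p) = [(h, p, 1)]"
| "edge_word (Central p, Boundary _ h) = [(h, p, 2)]"
| "edge_word _ = []"

definition path_word :: "(vertex \<times> vertex) list \<Rightarrow> (nat \<times> nat \<times> nat) list" where
  "path_word es = concat (map edge_word es)"

lemma edge_word_index: "e \<in> network_arcs n Js \<Longrightarrow> set (edge_word e) \<subseteq> z_index Js"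
proof -
  assume "e \<in> network_arcs n Js"
  then obtain p where p: "1 \<le> p" "p \<le> length Js" "e \<in> star_arcs n p (Js ! (p - 1))"
    by (auto simp: network_arcs_def)
  obtain a b where "Js ! (p - 1) = (a, b)"
    by (cases "Js ! (p - 1)")
  then show ?thesis
    using p by (auto simp: z_index_def split: if_splits)
qed

lemma path_word_index: "es \<in> paths n Js i j \<Longrightarrow> set (path_word es) \<subseteq> z_index Js"
  using edge_word_index[of _ n Js] by (fastforce simp: in_paths_iff path_word_def)

lemma filter_mset_all: "(\<And>x. x \<in># M \<Longrightarrow> P x) \<Longrightarrow> filter_mset P M = M"
  by (induction M) auto

lemma filter_mset_none: "(\<And>x. x \<in># M \<Longrightarrow> \<not> P x) \<Longrightarrow> filter_mset P M = {#}"
  by (induction M) auto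

text \<open>\<open>z_inv\<close> compares entries of equal layer only, so no counted pair straddles
  a division of the word by a property of the layer.\<close>

lemma z_inv_split: "z_inv xs = z_inv (filter (\<lambda>x. R (snd x)) xs) + z_inv (filter (\<lambda>x. \<not> R (snd x)) xs)"
proof (induction xs)
  case (Cons x xs)
  have same: "filter (\<lambda>y. snd y = snd x \<and> fst y < fst x) (filter (\<lambda>y. S (snd y)) xs) =
      filter (\<lambda>y. snd y = snd x \<and> fst y < fst x) xs" if "S (snd x)" for S
    unfolding filter_filter by (rule filter_cong[OF refl]) (use that in metis)
  show ?case
    using Cons.IH same[of R] same[of "\<lambda>q. \<not> R q"]
    by (cases "R (snd x)") (simp_all del: filter_filter)
qed simp

text \<open>The coefficient is multiplicative over a division of the layers. This is used to
  separate the last star from the earlier ones, and within a star the edges into the centre from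
  those out of it.\<close>

lemma z_fun_split:
  assumes "\<And>x. x \<in># M \<Longrightarrow> R (snd x)" "\<And>x. x \<in># N \<Longrightarrow> \<not> R (snd x)"
  shows "z_fun (M + N) xs = z_fun M (filter (\<lambda>x. R (snd x)) xs) * z_fun N (filter (\<lambda>x. \<not> R (snd x)) xs)"
proof -
  have "mset xs = M + N \<longleftrightarrow>
      mset (filter (\<lambda>x. R (snd x)) xs) = M \<and> mset (filter (\<lambda>x. \<not> R (snd x)) xs) = N"
  proof
    assume "mset xs = M + N"
    then show "mset (filter (\<lambda>x. R (snd x)) xs) = M \<and> mset (filter (\<lambda>x. \<not> R (snd x)) xs) = N"
      using filter_mset_all[of M "\<lambda>x. R (snd x)"] filter_mset_none[of M "\<lambda>x. \<not> R (snd x)"]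
        filter_mset_all[of N "\<lambda>x. \<not> R (snd x)"] filter_mset_none[of N "\<lambda>x. R (snd x)"] assms
      by simp
  next
    assume "mset (filter (\<lambda>x. R (snd x)) xs) = M \<and> mset (filter (\<lambda>x. \<not> R (snd x)) xs) = N"
    then show "mset xs = M + N"
      using multiset_partition[of "mset xs" "\<lambda>x. R (snd x)"] by simp
  qed
  then show ?thesis
    using z_inv_split[of xs R] by (simp add: z_fun_def qhalf_mult)
qed

lemma z_fun_layer:
  "z_fun (image_mset (\<lambda>h. (h, q)) N) (map (\<lambda>h. (h, q)) hs) = (if mset hs = N then qhalf (int (list_inv hs)) else 0)"
proof -
  have "inj (\<lambda>h :: nat. (h, q))"
    by (auto simp: inj_def)
  then have "mset (map (\<lambda>h. (h, q)) hs) = image_mset (\<lambda>h. (h, q)) N \<longleftrightarrow> mset hs = N"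
    using inj_eq[OF multiset.inj_map] by simp
  moreover have "z_inv (map (\<lambda>h. (h, q)) hs) = list_inv hs"
    by (induction hs) (simp_all add: filter_map o_def)
  ultimately show ?thesis
    by (simp add: z_fun_def)
qed

definition star_index :: "nat \<times> nat \<Rightarrow> nat \<Rightarrow> (nat \<times> nat \<times> nat) set" where
  "star_index J p = {(h, p', k). p' = p \<and> k \<in> {1, 2} \<and> fst J < snd J \<and> in_interval J h}"

lemma z_index_snoc: "z_index (Js @ [J]) = z_index Js \<union> star_index J (Suc (length Js))"
  by (auto simp: z_index_def star_index_def in_interval_def nth_append less_Suc_eq_le le_Suc_eq
      split: if_splits)

lemma mset_z_index_snoc:
  "mset_set (z_index (Js @ [J])) = mset_set (z_index Js) + mset_set (star_index J (Suc (length Js)))"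
proof -
  have "finite (star_index J (Suc (length Js)))"
    using finite_z_index[of "Js @ [J]"] by (simp add: z_index_snoc)
  moreover have "z_index Js \<inter> star_index J (Suc (length Js)) = {}"
    by (auto simp: z_index_def star_index_def)
  ultimately show ?thesis
    unfolding z_index_snoc by (rule mset_set_Union[OF finite_z_index])
qed

lemma mset_star_index:
  assumes "fst J < snd J"
  shows "mset_set (star_index J p) =
    image_mset (\<lambda>h. (h, p, 1)) (mset_set {fst J..snd J}) + image_mset (\<lambda>h. (h, p, 2)) (mset_set {fst J..snd J})"
proof -
  have "star_index J p = (\<lambda>h. (h, p, 1)) ` {fst J..snd J} \<union> (\<lambda>h. (h, p, 2)) ` {fst J..snd J}"
    using assms by (auto simp: star_index_def in_interval_def)
  moreover have "mset_set ((\<lambda>h. (h, p, 1)) ` {fst J..snd J} \<union> (\<lambda>h. (h, p, 2)) ` {fst J..snd J}) =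
      mset_set ((\<lambda>h. (h, p, 1 :: nat)) ` {fst J..snd J}) + mset_set ((\<lambda>h. (h, p, 2)) ` {fst J..snd J})"
    by (rule mset_set_Union) auto
  ultimately show ?thesis
    by (simp add: image_mset_mset_set inj_on_def)
qed

lemma list_inv_const: "set xs \<subseteq> {a} \<Longrightarrow> list_inv xs = 0"
  by (induction xs) (auto simp: filter_empty_conv)

lemma path_word_segment:
  "path_word (segment J p v w) = (if fst J < snd J \<and> in_interval J w then [(v, p, 1), (w, p, 2)] else [])"
  by (simp add: path_word_def segment_def)

text \<open>Outside \<open>J\<close> the two lists agree letter by letter, so their contents can
  differ only inside \<open>J\<close>.\<close>

lemma one_lines_same_block:
  assumes "list_all2 (same_block J) vs ws" "ws \<in> one_lines n"
  shows "vs \<in> one_lines n \<longleftrightarrow> mset (filter (in_interval J) vs) = mset (filter (in_interval J) ws)"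
proof -
  have "filter (\<lambda>x. \<not> in_interval J x) vs = filter (\<lambda>x. \<not> in_interval J x) ws"
    using assms(1) by (induction rule: list_all2_induct) (auto simp: same_block_def)
  then have "mset vs = mset ws \<longleftrightarrow> mset (filter (in_interval J) vs) = mset (filter (in_interval J) ws)"
    using multiset_partition[of "mset vs" "in_interval J"] multiset_partition[of "mset ws" "in_interval J"]
    by (metis add_right_cancel mset_filter)
  then show ?thesis
    using assms(2) by (simp add: one_lines_def)
qed

text \<open>Read in the order of the paths, the edges into the centre spell the letters of
  \<open>vs\<close> in \<open>J\<close> and the edges out of it those of \<open>ws\<close>. That
  every edge into the centre occurs exactly once is the condition that \<open>vs\<close> is a
  permutation. A one-point interval has no indeterminates, and its matrix is the identity.\<close>

lemma z_fun_star:
  assumes J: "fst J \<le> snd J" "1 \<le> fst J" "snd J \<le> n"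
    and vw: "list_all2 (same_block J) vs ws" and ws: "ws \<in> one_lines n"
  shows "z_fun (mset_set (star_index J p)) (concat (map2 (\<lambda>v w. path_word (segment J p v w)) vs ws)) =
    (if vs \<in> one_lines n then star_matrix J vs ws else 0)"
proof (cases "fst J < snd J")
  case False
  then have eq: "fst J = snd J"
    using J(1) by simp
  have "vs = ws"
    using vw by (induction rule: list_all2_induct) (auto simp: same_block_def in_interval_def eq)
  moreover have "star_inv J ws = 0"
    unfolding star_inv_def by (rule list_inv_const[of _ "snd J"]) (auto simp: in_interval_def eq)
  moreover have "concat (map2 (\<lambda>v w. path_word (segment J p v w)) vs ws) = []"
    using False by (simp add: path_word_segment)
  moreover have "star_index J p = {}"
    using False by (auto simp: star_index_def)
  ultimately have "z_fun (mset_set (star_index J p))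
      (concat (map2 (\<lambda>v w. path_word (segment J p v w)) vs ws)) = 1"
    by (simp only: z_fun_def mset_set.empty mset.simps z_inv.simps of_nat_0 qhalf_0 if_True simp_thms)
  then show ?thesis
    using ws vw \<open>vs = ws\<close> \<open>star_inv J ws = 0\<close> by (simp add: star_matrix_def qhalf_0)
next
  case True
  let ?W = "concat (map2 (\<lambda>v w. path_word (segment J p v w)) vs ws)"
  let ?v = "filter (in_interval J) vs" and ?w = "filter (in_interval J) ws"
  let ?M = "mset_set {fst J..snd J}"
  have 1: "filter (\<lambda>x. snd (snd x) = 1) ?W = map (\<lambda>h. (h, p, 1)) ?v"
    using vw by (induction rule: list_all2_induct)
      (use True in \<open>auto simp: path_word_segment same_block_def\<close>)
  have 2: "filter (\<lambda>x. snd (snd x) \<noteq> 1) ?W = map (\<lambda>h. (h, p, 2)) ?w"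
    using vw by (induction rule: list_all2_induct)
      (use True in \<open>auto simp: path_word_segment same_block_def\<close>)
  have "z_fun (mset_set (star_index J p)) ?W =
      z_fun (image_mset (\<lambda>h. (h, p, 1)) ?M) (filter (\<lambda>x. snd (snd x) = 1) ?W) *
      z_fun (image_mset (\<lambda>h. (h, p, 2)) ?M) (filter (\<lambda>x. snd (snd x) \<noteq> 1) ?W)"
    unfolding mset_star_index[OF True] by (rule z_fun_split) auto
  also have "\<dots> = (if mset ?v = ?M then qhalf (int (list_inv ?v)) else 0) *
      (if mset ?w = ?M then qhalf (int (list_inv ?w)) else 0)"
    unfolding 1 2 z_fun_layer ..
  also have "mset ?w = ?M"
  proof -
    have "distinct ?w" "set ?w = {fst J..snd J}"
      using one_linesD[OF ws] J by (auto simp: in_interval_def)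
    then show ?thesis
      using mset_set_set[of ?w] by simp
  qed
  finally show ?thesis
    using one_lines_same_block[OF vw ws] \<open>mset ?w = ?M\<close> vw
    by (simp add: star_matrix_def star_inv_def qhalf_mult)
qed

text \<open>The word of a family alternates, path by path, between weights of the earlier stars and
  weights of the last one. Filtering by the number of the star separates the two.\<close>

lemma filter_family:
  assumes "length xs = length vs" "length vs = length ws"
    and "\<And>x. x \<in> set xs \<Longrightarrow> set (path_word x) \<subseteq> z_index Js"
  shows "filter (\<lambda>x. fst (snd x) \<le> length Js) (concat (map path_word
      (map2 (\<lambda>x (v, w). x @ segment J (Suc (length Js)) v w) xs (zip vs ws)))) = concat (map path_word xs) \<and>
    filter (\<lambda>x. \<not> fst (snd x) \<le> length Js) (concat (map path_word
      (map2 (\<lambda>x (v, w). x @ segment J (Suc (length Js)) v w) xs (zip vs ws)))) =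
      concat (map2 (\<lambda>v w. path_word (segment J (Suc (length Js)) v w)) vs ws)"
proof -
  have step: "filter (\<lambda>x. fst (snd x) \<le> length Js) (path_word (x @ segment J (Suc (length Js)) v w)) = path_word x \<and>
      filter (\<lambda>x. \<not> fst (snd x) \<le> length Js) (path_word (x @ segment J (Suc (length Js)) v w)) =
        path_word (segment J (Suc (length Js)) v w)" if "set (path_word x) \<subseteq> z_index Js" for x v w
  proof -
    have "path_word (x @ segment J (Suc (length Js)) v w) =
        path_word x @ path_word (segment J (Suc (length Js)) v w)"
      by (simp add: path_word_def)
    moreover have "\<forall>y\<in>set (path_word x). fst (snd y) \<le> length Js"
      using that by (auto simp: z_index_def)
    moreover have "\<forall>y\<in>set (path_word (segment J (Suc (length Js)) v w)). \<not> fst (snd y) \<le> length Js"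
      by (auto simp: path_word_segment)
    ultimately show ?thesis
      by (simp add: filter_id_conv filter_empty_conv)
  qed
  show ?thesis
    using assms by (induction xs vs ws rule: list_induct3) (auto simp: step)
qed

lemma sum_paths_Nil:
  assumes "length us = length ws" "set us \<subseteq> {1..n}"
  shows "(\<Sum>xs\<in>listset (map2 (paths n []) us ws). F xs) = (if us = ws then F (map (\<lambda>_. []) us) else 0)"
  using assms
proof (induction us ws arbitrary: F rule: list_induct2)
  case (Cons u us w ws)
  have "(\<Sum>xs\<in>listset (map2 (paths n []) (u # us) (w # ws)). F xs) =
      (\<Sum>x\<in>paths n [] u w. if us = ws then F (x # map (\<lambda>_. []) us) else 0)"
    unfolding list.map zip_Cons_Cons prod.case sum_listset_Cons
    by (intro sum.cong refl Cons.IH) (use Cons.prems in simp)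
  then show ?case
    using Cons.prems by (simp add: paths_Nil)
qed simp

text \<open>Cutting off the last star turns the sum over families into a sum over the points
  \<open>vs\<close> where the paths enter it, which is the recursion of \<open>transfer\<close>. The
  sources \<open>us\<close> stay fixed while the sinks vary in the induction.\<close>

lemma sum_path_families:
  assumes "\<forall>(a, b)\<in>set Js. 1 \<le> a \<and> a \<le> b \<and> b \<le> n"
    and us: "length us = n" "set us \<subseteq> {1..n}" and ws: "ws \<in> one_lines n"
  shows "(\<Sum>xs\<in>listset (map2 (paths n Js) us ws).
      z_fun (mset_set (z_index Js)) (concat (map path_word xs))) = transfer n (rev Js) us ws"
  using assms(1) ws
proof (induction Js arbitrary: ws rule: rev_induct)
  case Nil
  have len: "length us = length ws"
    using us one_linesD(1)[OF Nil(2)] by simp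
  have "z_index [] = {}"
    by (auto simp: z_index_def)
  moreover have "concat (map path_word (map (\<lambda>_. []) us)) = []"
    by (simp add: path_word_def)
  ultimately show ?case
    unfolding sum_paths_Nil[OF len us(2)]
    by (simp only: z_fun_def mset_set.empty mset.simps z_inv.simps of_nat_0 qhalf_0 if_True simp_thms
        rev.simps transfer.simps)
next
  case (snoc J Js)
  let ?p = "Suc (length Js)"
  let ?Z = "\<lambda>Js xs. z_fun (mset_set (z_index Js)) (concat (map path_word xs))"
  let ?L = "listset (map (block_of n J) ws)"
  have Js: "\<forall>(a, b)\<in>set Js. 1 \<le> a \<and> a \<le> b \<and> b \<le> n"
    and J: "fst J \<le> snd J" "1 \<le> fst J" "snd J \<le> n"
    using snoc.prems(1) by auto
  have len: "length us = length ws" and ws_set: "set ws = {1..n}"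
    using us one_linesD[OF snoc.prems(2)] by auto
  have L: "vs \<in> ?L \<longleftrightarrow> set vs \<subseteq> {1..n} \<and> list_all2 (same_block J) vs ws" for vs
  proof -
    have "vs \<in> ?L \<longleftrightarrow> list_all2 (\<lambda>v w. v \<in> {1..n} \<and> same_block J v w) vs ws"
      by (simp add: listset_iff list_all2_map2 block_of_def)
    then show ?thesis
      by (auto simp: list_all2_conv_all_nth in_set_conv_nth subset_iff)
  qed
  have fin: "finite ?L"
    by (rule finite_listset) (auto simp: block_of_def)
  have "(\<Sum>xs\<in>listset (map2 (paths n (Js @ [J])) us ws). ?Z (Js @ [J]) xs) =
      (\<Sum>vs\<in>?L. \<Sum>xs\<in>listset (map2 (paths n Js) us vs).
        ?Z (Js @ [J]) (map2 (\<lambda>x (v, w). x @ segment J ?p v w) xs (zip vs ws)))"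
  proof (rule sum_listset_refine[OF len])
    fix u w and F :: "_ \<Rightarrow> laurent"
    assume "w \<in> set ws"
    then have "w \<in> {1..n}"
      using ws_set by simp
    then show "(\<Sum>x\<in>paths n (Js @ [J]) u w. F x) =
        (\<Sum>v\<in>block_of n J w. \<Sum>x\<in>paths n Js u v. F (x @ segment J ?p v w))"
      by (rule sum_paths_snoc[OF snoc.prems(1)])
  qed
  \<comment> \<open>When \<open>vs\<close> is not a permutation, the family does not use every edge
    into the last centre exactly once, and its coefficient is zero.\<close>
  also have "\<dots> = (\<Sum>vs\<in>?L. if vs \<in> one_lines n then transfer n (rev Js) us vs * star_matrix J vs ws else 0)"
  proof (intro sum.cong refl)
    fix vs assume "vs \<in> ?L"
    then have vw: "list_all2 (same_block J) vs ws" and len': "length vs = length ws"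
      by (auto simp: L dest: list_all2_lengthD)
    have "(\<Sum>xs\<in>listset (map2 (paths n Js) us vs).
        ?Z (Js @ [J]) (map2 (\<lambda>x (v, w). x @ segment J ?p v w) xs (zip vs ws))) =
      (\<Sum>xs\<in>listset (map2 (paths n Js) us vs). ?Z Js xs *
        z_fun (mset_set (star_index J ?p)) (concat (map2 (\<lambda>v w. path_word (segment J ?p v w)) vs ws)))"
    proof (intro sum.cong refl)
      fix xs assume "xs \<in> listset (map2 (paths n Js) us vs)"
      then have all: "list_all2 (\<in>) xs (map2 (paths n Js) us vs)"
        by (simp only: listset_iff)
      then have lx: "length xs = length vs"
        using len len' by (auto dest: list_all2_lengthD)
      have idx: "set (path_word x) \<subseteq> z_index Js" if "x \<in> set xs" for x
      proof -
        obtain k where k: "k < length xs" "x = xs ! k"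
          using \<open>x \<in> set xs\<close> by (auto simp: in_set_conv_nth)
        then have "x \<in> paths n Js (us ! k) (vs ! k)"
          using list_all2_nthD[OF all k(1)] lx len len' by simp
        then show ?thesis
          by (rule path_word_index)
      qed
      show "?Z (Js @ [J]) (map2 (\<lambda>x (v, w). x @ segment J ?p v w) xs (zip vs ws)) = ?Z Js xs *
          z_fun (mset_set (star_index J ?p)) (concat (map2 (\<lambda>v w. path_word (segment J ?p v w)) vs ws))"
        unfolding mset_z_index_snoc
      \<comment> \<open>The layers are divided by the number \<open>p\<close> of the star, the first
        component of \<open>(p, k)\<close>.\<close>
      proof (subst z_fun_split[where R = "\<lambda>q. fst q \<le> length Js"])
        have "finite (star_index J ?p)"
          using finite_z_index[of "Js @ [J]"] by (simp add: z_index_snoc)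
        then show "\<not> fst (snd x) \<le> length Js" if "x \<in># mset_set (star_index J ?p)" for x
          using that by (auto simp: star_index_def)
        show "fst (snd x) \<le> length Js" if "x \<in># mset_set (z_index Js)" for x
          using that finite_z_index[of Js] by (auto simp: z_index_def)
      qed (simp only: filter_family[OF lx len' idx])
    qed
    also have "\<dots> = (\<Sum>xs\<in>listset (map2 (paths n Js) us vs). ?Z Js xs) *
        (if vs \<in> one_lines n then star_matrix J vs ws else 0)"
      unfolding z_fun_star[OF J vw snoc.prems(2)] by (rule sum_distrib_right[symmetric])
    finally show "(\<Sum>xs\<in>listset (map2 (paths n Js) us vs).
        ?Z (Js @ [J]) (map2 (\<lambda>x (v, w). x @ segment J ?p v w) xs (zip vs ws))) =
      (if vs \<in> one_lines n then transfer n (rev Js) us vs * star_matrix J vs ws else 0)"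
      using snoc.IH[OF Js, of vs] by simp
  qed
  also have "\<dots> = (\<Sum>vs\<in>?L \<inter> one_lines n. transfer n (rev Js) us vs * star_matrix J vs ws)"
    by (rule sum.inter_restrict[OF fin, symmetric])
  \<comment> \<open>The permutations outside \<open>?L\<close> may be added, since they do not match
    \<open>ws\<close> up to blocks and their entry in \<open>star_matrix\<close> is zero.\<close>
  also have "\<dots> = (\<Sum>vs\<in>one_lines n. transfer n (rev Js) us vs * star_matrix J vs ws)"
    by (rule sum.mono_neutral_left[OF finite_one_lines])
      (auto simp: L star_matrix_def dest: one_linesD(3))
  finally show ?case
    by simp
qed

section \<open>Products of entries of the path matrix\<close>

context edge_algebra
begin

lemma edge_weight_eq: "edge_weight Js e = proj (wmon (edge_word e))"
  by (cases e rule: edge_word.cases)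
    (simp_all add: z_gen_def generator_eq_proj Z_alg_def presented_simps wmon_Nil)

text \<open>The product of sums over paths is expanded in the free algebra into families with one
  path from each source; the coefficient of z_G is then taken family by family.\<close>

lemma z_coeff_path_matrix:
  assumes Js: "\<forall>(a, b)\<in>set Js. 1 \<le> a \<and> a \<le> b \<and> b \<le> n" and w: "w \<in> perms n"
  shows "z_coeff Js (list_mult (Z_alg Js) (map (\<lambda>i. path_matrix n Js i (w i)) [1..<n+1])) =
    transfer n (rev Js) (one_line n id) (one_line n w)"
proof -
  let ?b = "\<lambda>i j. \<Sum>es\<in>paths n Js i j. wmon (path_word es)"
  have b_carrier: "?b i j \<in> free_carrier (z_index Js)" for i j
    by (intro free_carrier_sum free_carrier_wmon path_word_index)
  have b: "path_matrix n Js i j = proj (?b i j)" if j: "j \<in> {1..n}" for i j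
    unfolding path_matrix_def Z_alg_def
  proof (rule finsum_proj'[OF finite_paths[OF Js j]])
    fix es assume es: "es \<in> paths n Js i j"
    show "wmon (path_word es) \<in> free_carrier (z_index Js)"
      by (rule free_carrier_wmon[OF path_word_index[OF es]])
    have "list_mult Q (map (edge_weight Js) es) = proj (prod_list (map (\<lambda>e. wmon (edge_word e)) es))"
    proof (rule list_mult_proj)
      fix e assume "e \<in> set es"
      then have "set (edge_word e) \<subseteq> z_index Js"
        using path_word_index[OF es] by (auto simp: path_word_def)
      then show "wmon (edge_word e) \<in> free_carrier (z_index Js)"
        by (rule free_carrier_wmon)
    qed (rule edge_weight_eq)
    also have "prod_list (map (\<lambda>e. wmon (edge_word e)) es) = wmon (path_word es)"
      using prod_list_wmon[of "map edge_word es"] by (simp add: path_word_def o_def)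
    finally show "list_mult Q (map (edge_weight Js) es) = proj (wmon (path_word es))" .
  qed
  have "list_mult (Z_alg Js) (map (\<lambda>i. path_matrix n Js i (w i)) [1..<n+1]) =
      proj (prod_list (map (\<lambda>i. ?b i (w i)) [1..<n+1]))"
    unfolding Z_alg_def
  proof (rule list_mult_proj)
    fix i assume "i \<in> set [1..<n+1]"
    then have "i \<in> {1..n}"
      unfolding set_upt_Suc_1 .
    then have "w i \<in> {1..n}"
      using w permutes_in_image[of w "{1..n}" i] unfolding perms_def by blast
    then show "path_matrix n Js i (w i) = proj (?b i (w i))"
      by (rule b)
  qed (rule b_carrier)
  moreover have "prod_list (map (\<lambda>i. ?b i (w i)) [1..<n+1]) \<in> free_carrier (z_index Js)"
    by (intro free_carrier_prod_list b_carrier)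
  ultimately have "z_coeff Js (list_mult (Z_alg Js) (map (\<lambda>i. path_matrix n Js i (w i)) [1..<n+1])) =
      lin (z_fun (mset_set (z_index Js))) (prod_list (map (\<lambda>i. ?b i (w i)) [1..<n+1]))"
    by (simp only: z_coeff_proj)
  also have "map (\<lambda>i. ?b i (w i)) [1..<n+1] = map (\<lambda>A. \<Sum>es\<in>A. wmon (path_word es))
      (map2 (paths n Js) (one_line n id) (one_line n w))"
    unfolding one_line_def map2_map_map id_apply map_map o_def ..
  also have "prod_list \<dots> = (\<Sum>xs\<in>listset (map2 (paths n Js) (one_line n id) (one_line n w)).
      wmon (concat (map path_word xs)))"
    unfolding prod_list_sum
    by (intro sum.cong refl) (simp only: prod_list_wmon[symmetric] map_map o_def)
  also have "lin (z_fun (mset_set (z_index Js))) \<dots> =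
      (\<Sum>xs\<in>listset (map2 (paths n Js) (one_line n id) (one_line n w)).
        z_fun (mset_set (z_index Js)) (concat (map path_word xs)))"
    unfolding lin_sum lin_wmon ..
  also have "\<dots> = transfer n (rev Js) (one_line n id) (one_line n w)"
    by (rule sum_path_families[OF Js])
      (use one_linesD(3)[OF one_line_in[OF id_perms[of n]]] one_line_in[OF w] in auto)
  finally show ?thesis .
qed

end

theorem theorem5p2:
  fixes n :: nat
    and Js :: "(nat \<times> nat) list"
    and \<theta> :: "nat free_alg set \<Rightarrow> laurent"
  assumes "linear_functional (hecke n) \<theta>"
    and "\<forall>(a, b) \<in> set Js. 1 \<le> a \<and> a \<le> b \<and> b \<le> n"
  shows "\<theta> (list_mult (hecke n) (map (C_tilde n) Js)) =
    sigma n Js (path_matrix n Js) (Imm n \<theta>)"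
proof -
  interpret H: hecke_algebra n
    by unfold_locales (rule hecke_relations_carrier)
  interpret A: qmat_algebra n
    by unfold_locales (rule qmat_relations_carrier)
  interpret Z: edge_algebra Js
    by unfold_locales (rule z_relations_carrier)
  show ?thesis
    unfolding H.theta_prod_C_tilde[OF assms(2,1)]
    by (rule A.sigma_Imm[OF Z.z_coeff_path_matrix[OF assms(2)], symmetric])
qed

end
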